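(* Let $K:\mathbb R\to\mathbb R$ be bounded, square integrable, symmetric, with $\int_{\mathbb R}K(y)\,dy=1$ and $K(0)>0$. Assume that $f$ is bounded, that $bf$ is bounded, that $\frac1{nh_{\min}}\leqslant1$, and that there exists $\alpha>0$ such that $\mathbb E(\exp(\alpha|Y_1|))<\infty$. Then there exist two deterministic constants $\mathfrak a,\mathfrak b>0$, not depending on $n$, $h_{\min}$ and $\vartheta$, such that for every $\vartheta\in(0,1)$, $$\mathbb E\left(\|\widehat{bf}_{n,\widetilde h_n}-bf\|_2^2\right)\leqslant(1+\vartheta)\inf_{h\in\mathcal H_n}\mathbb E\left(\|\widehat{bf}_{n,h}-bf\|_2^2\right)+\frac{\mathfrak a}{\vartheta}\|(bf)_{h_{\min}}-bf\|_2^2+\frac{\mathfrak b}{\vartheta}\cdot\frac{\log(n)^5}{n}.$$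
   Context: Model: $X_1,\dots,X_n$ are independent real random variables with common probability density $f$ with respect to Lebesgue measure, $b:\mathbb R\to\mathbb R$ is measurable, and $Y_i=b(X_i)+\varepsilon_i$, where $\varepsilon_1,\dots,\varepsilon_n$ are i.i.d. centered random variables with variance $\sigma^2>0$, independent of $X_1,\dots,X_n$. $bf$ denotes the product of $b$ and $f$. Notation: $\|\cdot\|_2$ and $\langle\cdot,\cdot\rangle_2$ are the norm and inner product of $L^2(\mathbb R,dx)$, $\ast$ is convolution on $\mathbb R$, $K_h:=\frac1hK(\cdot/h)$, $(bf)_h:=K_h\ast(bf)$. Bandwidths: for each $n$, $\mathcal H_n=\{h_1,\dots,h_{N(n)}\}\subset[0,1]$ is a finite (deterministic) collection with $N(n)\in\{1,\dots,n\}$ and $\frac1n<h_1<\dots<h_{N(n)}$; $h_{\min}:=h_1$ is the smallest element of $\mathcal H_n$. Estimator: $\widehat{bf}_{n,h}(x):=\frac1{nh}\sum_{i=1}^nK\left(\frac{X_i-x}{h}\right)Y_i$. PCO selection: $$\mathrm{crit}(h):=\|\widehat{bf}_{n,h}-\widehat{bf}_{n,h_{\min}}\|_2^2+\mathrm{pen}(h),\qquad\mathrm{pen}(h):=\frac{2\langle K_{h_{\min}},K_h\rangle_2}{n^2}\sum_{i=1}^nY_i^2,$$ and $\widetilde h_n\in\arg\min_{h\in\mathcal H_n}\mathrm{crit}(h)$ (a measurable minimizer). *)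

theory Defs
  imports "HOL-Probability.Probability"
begin

text \<open>
  The sample is indexed by \<open>{1..n}\<close>. The measure \<open>\<nu>\<close> is the common law of the errors;
  it is a parameter so that models with different \<open>n\<close> can be required to share all of
  their laws.
\<close>

locale regression_sample = prob_space M for M :: "'a measure" +
  fixes n :: nat
    and f b :: "real \<Rightarrow> real"
    and \<nu> :: "real measure"
    and \<sigma> :: real
    and X \<epsilon> Y :: "nat \<Rightarrow> 'a \<Rightarrow> real"
  assumes X_density: "\<And>i. i \<in> {1..n} \<Longrightarrow> distributed M lborel (X i) (\<lambda>x. ennreal (f x))"
    and X_indep: "indep_vars (\<lambda>_. borel) X {1..n}"
    and \<epsilon>_measurable: "\<And>i. i \<in> {1..n} \<Longrightarrow> random_variable borel (\<epsilon> i)"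
    and \<epsilon>_law: "\<And>i. i \<in> {1..n} \<Longrightarrow> distr M borel (\<epsilon> i) = \<nu>"
    and \<epsilon>_indep: "indep_vars (\<lambda>_. borel) \<epsilon> {1..n}"
    and \<epsilon>_integrable: "\<And>i. i \<in> {1..n} \<Longrightarrow> integrable M (\<epsilon> i)"
    and \<epsilon>_centered: "\<And>i. i \<in> {1..n} \<Longrightarrow> expectation (\<epsilon> i) = 0"
    and \<epsilon>_square_integrable: "\<And>i. i \<in> {1..n} \<Longrightarrow> integrable M (\<lambda>\<omega>. (\<epsilon> i \<omega>)\<^sup>2)"
    and \<epsilon>_variance: "\<And>i. i \<in> {1..n} \<Longrightarrow> variance (\<epsilon> i) = \<sigma>\<^sup>2"
    and X_\<epsilon>_indep: "indep_var
          (PiM {1..n} (\<lambda>_. borel)) (\<lambda>\<omega>. \<lambda>i\<in>{1..n}. X i \<omega>)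
          (PiM {1..n} (\<lambda>_. borel)) (\<lambda>\<omega>. \<lambda>i\<in>{1..n}. \<epsilon> i \<omega>)"
    and Y_eq: "\<And>i \<omega>. i \<in> {1..n} \<Longrightarrow> \<omega> \<in> space M \<Longrightarrow> Y i \<omega> = b (X i \<omega>) + \<epsilon> i \<omega>"

text \<open>
  Inner product and norm of the real space \<open>L\<^sup>2\<close> over Lebesgue measure. They are meaningful for
  measurable, square integrable arguments only: a divergent integral has the value \<open>0\<close>.
\<close>

definition L2_inner :: "(real \<Rightarrow> real) \<Rightarrow> (real \<Rightarrow> real) \<Rightarrow> real"
  where "L2_inner u v = (\<integral>x. u x * v x \<partial>lborel)"

definition L2_norm :: "(real \<Rightarrow> real) \<Rightarrow> real"
  where "L2_norm u = sqrt (L2_inner u u)"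

definition conv :: "(real \<Rightarrow> real) \<Rightarrow> (real \<Rightarrow> real) \<Rightarrow> real \<Rightarrow> real"
  where "conv u v x = (\<integral>y. u (x - y) * v y \<partial>lborel)"

definition scaled_kernel :: "(real \<Rightarrow> real) \<Rightarrow> real \<Rightarrow> real \<Rightarrow> real"
  where "scaled_kernel K h x = 1 / h * K (x / h)"

definition bf_estimator ::
    "(real \<Rightarrow> real) \<Rightarrow> nat \<Rightarrow> (nat \<Rightarrow> 'a \<Rightarrow> real) \<Rightarrow> (nat \<Rightarrow> 'a \<Rightarrow> real) \<Rightarrow> real \<Rightarrow> 'a \<Rightarrow> real \<Rightarrow> real"
  where "bf_estimator K n X Y h \<omega> x =
    1 / (real n * h) * (\<Sum>i=1..n. K ((X i \<omega> - x) / h) * Y i \<omega>)"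

definition bandwidths :: "nat \<Rightarrow> real set \<Rightarrow> bool"
  where "bandwidths n H \<longleftrightarrow>
    finite H \<and> card H \<in> {1..n} \<and> H \<subseteq> {0..1} \<and> (\<forall>h\<in>H. 1 / real n < h)"

definition pen ::
    "(real \<Rightarrow> real) \<Rightarrow> nat \<Rightarrow> real set \<Rightarrow> (nat \<Rightarrow> 'a \<Rightarrow> real) \<Rightarrow> 'a \<Rightarrow> real \<Rightarrow> real"
  where "pen K n H Y \<omega> h =
    2 * L2_inner (scaled_kernel K (Min H)) (scaled_kernel K h) / (real n)\<^sup>2 * (\<Sum>i=1..n. (Y i \<omega>)\<^sup>2)"

definition crit ::
    "(real \<Rightarrow> real) \<Rightarrow> nat \<Rightarrow> real set \<Rightarrow> (nat \<Rightarrow> 'a \<Rightarrow> real) \<Rightarrow> (nat \<Rightarrow> 'a \<Rightarrow> real) \<Rightarrow> 'a \<Rightarrow> real \<Rightarrow> real"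
  where "crit K n H X Y \<omega> h =
    (L2_norm (\<lambda>x. bf_estimator K n X Y h \<omega> x - bf_estimator K n X Y (Min H) \<omega> x))\<^sup>2 + pen K n H Y \<omega> h"

definition pco_selection ::
    "'a measure \<Rightarrow> (real \<Rightarrow> real) \<Rightarrow> nat \<Rightarrow> real set \<Rightarrow> (nat \<Rightarrow> 'a \<Rightarrow> real) \<Rightarrow> (nat \<Rightarrow> 'a \<Rightarrow> real) \<Rightarrow> ('a \<Rightarrow> real) \<Rightarrow> bool"
  where "pco_selection M K n H X Y hsel \<longleftrightarrow>
    hsel \<in> borel_measurable M \<and>
    (\<forall>\<omega>\<in>space M. is_arg_min (crit K n H X Y \<omega>) (\<lambda>h. h \<in> H) (hsel \<omega>))"

end

theory Submission
  imports Defs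
begin

text \<open>
  Write \<open>s = b f\<close>, \<open>s_h = K_h * s\<close>, \<open>e_h\<close> for the estimator with bandwidth \<open>h\<close>, \<open>m\<close> for the smallest
  bandwidth, and \<open>W_i^h(x) = K_h(X_i - x) Y_i\<close>, so that \<open>e_h\<close> is the mean of the \<open>W_i^h\<close> and each of them has
  expectation \<open>s_h\<close>. If \<open>g\<close> minimises the criterion then, for every competitor \<open>h\<close>, expanding the squares gives
  \<open>||e_g - s||^2 \<le> ||e_h - s||^2 + 2 \<psi>(h) - 2 \<psi>(g)\<close> with \<open>\<psi>(h) = pen(h) / 2 - <e_h - s, e_m - s>\<close>
  (\<open>loss_selection\<close>). The inner product in \<open>\<psi>(h)\<close> contains the diagonal terms
  \<open><W_i^h, W_i^m> = Y_i^2 <K_h, K_m>\<close>, and half the penalty is exactly their sum divided by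
  \<open>n^2\<close>; this is why the penalty has its form. What remains is

  \<^item> a degenerate double sum over pairs of distinct observations,
  \<^item> centred sums \<open><e_h - s_h, s_k - s>\<close> of independent variables,
  \<^item> the product \<open><s_h - s, s_m - s>\<close> of two biases, and terms of order \<open>1/n\<close>.

  All of it is at most \<open>\<eta> (1/(nh) + ||s_h - s||^2)\<close> plus a multiple of \<open>(||s_m - s||^2 + \<Xi>) / \<eta>\<close>, for every
  \<open>\<eta> \<le> 1\<close> and all bandwidths at once, where \<open>\<Xi>\<close> does not depend on the bandwidth and has expectation of order
  \<open>log(n)^5 / n\<close> (\<open>noise_control\<close>, \<open>criterion_error\<close>). Conversely \<open>1/(nh) + ||s_h - s||^2\<close> is at most a
  multiple of \<open>||e_h - s||^2 + \<Xi>\<close>, again for all bandwidths simultaneously (\<open>risk_lower_bound\<close>), so it can be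
  absorbed into the two losses. The choice of \<open>\<eta>\<close> proportional to \<open>\<theta>\<close> gives an oracle
  inequality that holds for every sample point (\<open>pathwise_oracle_inequality\<close>); integrating it proves the theorem.

  The probabilistic core is \<open>noise_control\<close>. Averaging over all subsets \<open>I\<close> of the sample turns the double sum
  into inner products \<open><A, B>\<close> of a sum \<open>A\<close> over \<open>I\<close> and a sum \<open>B\<close> over the complement, which are independent.
  Given \<open>A\<close>, the number \<open><A, B>\<close> is a centred sum of independent variables \<open>Y_j u(X_j)\<close> with \<open>u = K_k * A\<close>, and
  \<open>\<bar>u\<bar>\<close> is at most a multiple of \<open>sqrt n ||A||\<close>; a Bernstein argument shows that a small multiple of
  \<open>|<A, B>| / (log(n) sqrt n ||A||)\<close> has exponential moments polynomial in \<open>n\<close>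
  (\<open>exp_moment_linear_statistic\<close>, \<open>exp_moment_cross\<close>). The norm \<open>||A||\<close> is treated by Pinelis's method for sums in
  a Hilbert space: a small multiple of \<open>sqrt (h log(n) / n) ||A||\<close> has exponential moments polynomial in \<open>n\<close>, too
  (\<open>exp_moment_dev_sum\<close>). Variables \<open>T\<close> with such moments satisfy \<open>T \<le> C log n\<close> up to a negligible error, even
  after a maximum over all pairs of bandwidths, and the two scales multiply to
  \<open>|<A, B>| / n^2 \<le> C log(n)^(5/2) / (n sqrt h) \<le> \<eta> / (nh) + C^2 log(n)^5 / (4 \<eta> n)\<close>. This is the source of the
  power of the logarithm.

  The constants depend only on \<open>K\<close>, \<open>\<alpha>\<close>, \<open>s\<close> and the common law of the pairs \<open>(X_i, Y_i)\<close>, and that law is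
  determined by \<open>f\<close>, \<open>b\<close> and \<open>\<nu>\<close> (\<open>sample_joint_law\<close>).
\<close>

section \<open>Elementary inequalities\<close>

lemma exp_le_quadratic: "exp y \<le> 1 + y + y\<^sup>2 / 2 * exp \<bar>y\<bar>" for y :: real
proof -
  obtain t where t: "\<bar>t\<bar> \<le> \<bar>y\<bar>" "exp y = (\<Sum>m<2. y ^ m / fact m) + exp t / fact 2 * y ^ 2"
    using Maclaurin_exp_le[of y 2] by auto
  have "exp t * y\<^sup>2 \<le> exp \<bar>y\<bar> * y\<^sup>2"
    using t(1) by (intro mult_right_mono) auto
  then show ?thesis
    using t(2) by (simp add: numeral_2_eq_2 field_simps)
qed

lemma square_le_two_exp: "t\<^sup>2 \<le> 2 * exp t" if "0 \<le> t" for t :: real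
  using exp_lower_Taylor_quadratic[OF that] that by simp

text \<open>
  Used to bound maxima: if \<open>T\<close> ranges over polynomially many variables with polynomial exponential
  moments, \<open>x\<close> is taken to be a large multiple of \<open>log n\<close> and the exponentials are simply added up.
\<close>

lemma fourth_power_le_exp: "T ^ 4 \<le> 8 * x ^ 4 + 192 * exp (T - x)" if "0 \<le> T" "0 \<le> x" for T x :: real
proof (cases "T \<le> x")
  case True
  then have "T ^ 4 \<le> x ^ 4" using that by (intro power_mono) auto
  then show ?thesis using that zero_le_power[OF that(2), of 4]
    by (smt (verit) exp_ge_zero)
next
  case False
  define d where "d = T - x"
  have d: "d \<ge> 0" and T: "T = x + d" using False by (auto simp: d_def)
  have "d ^ 4 / 24 \<le> exp d"
  proof (cases "d = 0")
    case False
    then obtain t where t: "0 < t" "exp d = (\<Sum>m<4. d ^ m / fact m) + exp t / fact 4 * d ^ 4"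
      using Maclaurin[of d 4 "\<lambda>_. exp" exp] d by auto
    have "1 * d ^ 4 \<le> exp t * d ^ 4" using d t(1) by (intro mult_right_mono) auto
    moreover have "(\<Sum>m<4. d ^ m / fact m) \<ge> 0" using d by (intro sum_nonneg) auto
    ultimately show ?thesis using t(2) by (simp add: fact_numeral)
  qed simp
  moreover have "(x + d) ^ 4 \<le> 8 * (x ^ 4 + d ^ 4)"
  proof -
    have "(x + d)\<^sup>2 \<le> 2 * (x\<^sup>2 + d\<^sup>2)" using sum_squares_bound[of x d] by (simp add: power2_sum)
    then have "((x + d)\<^sup>2)\<^sup>2 \<le> (2 * (x\<^sup>2 + d\<^sup>2))\<^sup>2" by (intro power_mono) auto
    also have "\<dots> = 4 * (x\<^sup>2 + d\<^sup>2)\<^sup>2" by (subst power_mult_distrib) simp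
    also have "(x\<^sup>2 + d\<^sup>2)\<^sup>2 \<le> 2 * ((x\<^sup>2)\<^sup>2 + (d\<^sup>2)\<^sup>2)"
      using sum_squares_bound[of "x\<^sup>2" "d\<^sup>2"] by (simp add: power2_sum)
    finally show ?thesis by simp
  qed
  ultimately show ?thesis by (simp add: T)
qed

text \<open>
  The power series of \<open>cosh (sqrt y)\<close> has nonnegative coefficients, and every power is convex on the half line.
\<close>

lemma cosh_sqrt_convex:
  fixes p y z :: real
  assumes "0 \<le> p" "p \<le> 1" "0 \<le> y" "0 \<le> z"
  shows "cosh (sqrt (p * y + (1 - p) * z)) \<le> p * cosh (sqrt y) + (1 - p) * cosh (sqrt z)"
proof -
  have ser: "(\<lambda>k. w ^ k / fact (2 * k)) sums cosh (sqrt w)" if "0 \<le> w" for w :: real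
  proof -
    have "(\<lambda>k. (\<lambda>n. if even n then sqrt w ^ n /\<^sub>R fact n else 0) (2 * k)) sums cosh (sqrt w)"
      using cosh_converges[of "sqrt w"]
      by (subst sums_mono_reindex) (auto simp: strict_mono_def elim!: evenE)
    moreover have "sqrt w ^ (2 * k) = w ^ k" for k using that by (simp add: power_mult)
    ultimately show ?thesis by (simp add: divide_inverse mult.commute)
  qed
  have conv_pow: "(p * y + (1 - p) * z) ^ k \<le> p * y ^ k + (1 - p) * z ^ k" for k
  proof (induction k)
    case (Suc k)
    have "(p * y + (1 - p) * z) ^ Suc k \<le> (p * y + (1 - p) * z) * (p * y ^ k + (1 - p) * z ^ k)"
      using Suc assms by (auto intro!: mult_left_mono)
    also have "\<dots> = p * y ^ Suc k + (1 - p) * z ^ Suc k - p * (1 - p) * ((y - z) * (y ^ k - z ^ k))"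
      by (simp add: algebra_simps)
    also have "\<dots> \<le> p * y ^ Suc k + (1 - p) * z ^ Suc k"
    proof -
      have "0 \<le> (y - z) * (y ^ k - z ^ k)"
      proof (cases "y \<le> z")
        case True
        then have "y ^ k \<le> z ^ k" using assms by (intro power_mono)
        then show ?thesis using True by (intro mult_nonpos_nonpos) auto
      next
        case False
        then have "z ^ k \<le> y ^ k" using assms by (intro power_mono) auto
        then show ?thesis using False by (intro mult_nonneg_nonneg) auto
      qed
      then show ?thesis using assms by simp
    qed
    finally show ?case .
  qed simp
  show ?thesis
  proof (rule sums_le)
    show "(\<lambda>k. (p * y + (1 - p) * z) ^ k / fact (2 * k)) sums cosh (sqrt (p * y + (1 - p) * z))"
      using assms by (intro ser) simp
    show "(\<lambda>k. p * (y ^ k / fact (2 * k)) + (1 - p) * (z ^ k / fact (2 * k)))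
        sums (p * cosh (sqrt y) + (1 - p) * cosh (sqrt z))"
      using assms by (intro sums_add sums_mult ser)
    show "(p * y + (1 - p) * z) ^ k / fact (2 * k)
        \<le> p * (y ^ k / fact (2 * k)) + (1 - p) * (z ^ k / fact (2 * k))" for k
      using conv_pow[of k] by (simp add: field_simps divide_right_mono)
  qed
qed

lemma sinh_ge_self: "u \<le> sinh u" if "0 \<le> u" for u :: real
proof -
  have "((\<lambda>x. sinh x - x) 0) \<le> ((\<lambda>x. sinh x - x) u)"
  proof (rule DERIV_nonneg_imp_nondecreasing[OF that])
    fix x :: real
    have "((\<lambda>x. sinh x - x) has_real_derivative cosh x - 1) (at x)"
      by (auto intro!: derivative_eq_intros)
    moreover have "0 \<le> cosh x - 1" using cosh_real_ge_1[of x] by simp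
    ultimately show "\<exists>y. ((\<lambda>x. sinh x - x) has_real_derivative y) (at x) \<and> 0 \<le> y" by blast
  qed
  then show ?thesis by simp
qed

text \<open>
  The one-step inequality of Pinelis's method. For vectors with norms \<open>r\<close>, \<open>u\<close> and inner product \<open>c\<close> the left side is
  \<open>cosh\<close> of the norm of their sum. By convexity in \<open>c\<close> it lies below the chord between the extreme cases
  \<open>c = r u\<close> and \<open>c = - r u\<close>, where the norm is \<open>r + u\<close> and \<open>\<bar>r - u\<bar>\<close>. The chord is then split so that the
  second summand is linear in the vector of norm \<open>u\<close> and disappears when that vector is centred.
\<close>

lemma cosh_sqrt_step:
  fixes r u c :: real
  assumes r: "0 \<le> r" and u: "0 \<le> u" and c: "\<bar>c\<bar> \<le> r * u"
  shows "cosh (sqrt (r\<^sup>2 + 2 * c + u\<^sup>2)) \<le> cosh r * (exp u - u) + c * (sinh r / r)"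
proof (cases "r = 0 \<or> u = 0")
  case True
  then have c0: "c = 0" using c by auto
  have "u \<le> sinh u" "exp u = cosh u + sinh u" using u by (auto simp: sinh_ge_self cosh_plus_sinh)
  then show ?thesis using True c0 r u by (auto simp: c0)
next
  case False
  then have pos: "0 < r" "0 < u" using r u by auto
  define t where "t = c / (r * u)"
  \<comment> \<open>the weight of the extreme case \<open>c = r * u\<close> in the convex combination that gives \<open>c\<close>\<close>
  define p where "p = (1 + t) / 2"
  have t: "\<bar>t\<bar> \<le> 1" using c pos by (simp add: t_def abs_mult)
  have p01: "0 \<le> p" "p \<le> 1" using t by (auto simp: p_def)
  have ct: "c = t * (r * u)" using pos by (simp add: t_def)
  have "r\<^sup>2 + 2 * c + u\<^sup>2 = p * (r + u)\<^sup>2 + (1 - p) * (r - u)\<^sup>2"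
    unfolding p_def ct by (simp add: field_simps power2_eq_square)
  then have "cosh (sqrt (r\<^sup>2 + 2 * c + u\<^sup>2)) \<le> p * cosh (sqrt ((r + u)\<^sup>2)) + (1 - p) * cosh (sqrt ((r - u)\<^sup>2))"
    using cosh_sqrt_convex[OF p01, of "(r + u)\<^sup>2" "(r - u)\<^sup>2"] by simp
  also have "\<dots> = cosh r * cosh u + t * sinh r * sinh u"
    by (simp add: p_def cosh_add cosh_diff field_simps)
  also have "\<dots> \<le> cosh r * (exp u - u) + t * sinh r * u"
  proof -
    have "t * sinh r * (sinh u - u) \<le> 1 * cosh r * (sinh u - u)"
    proof (rule mult_right_mono)
      have "t * sinh r \<le> 1 * sinh r" using t r by (intro mult_right_mono) auto
      also have "sinh r \<le> cosh r" using sinh_less_cosh_real[of r] by simp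
      finally show "t * sinh r \<le> 1 * cosh r" by simp
    qed (use sinh_ge_self[OF u] in simp)
    then show ?thesis by (simp add: cosh_plus_sinh[symmetric] algebra_simps)
  qed
  also have "t * sinh r * u = c * (sinh r / r)" using pos by (simp add: ct)
  finally show ?thesis .
qed

lemma square_le_one_plus_fourth: "t\<^sup>2 \<le> 1 + t ^ 4" for t :: real
proof -
  have "2 * t\<^sup>2 \<le> 1 + (t\<^sup>2)\<^sup>2" using sum_squares_bound[of 1 "t\<^sup>2"] by simp
  moreover have "0 \<le> (t\<^sup>2)" by simp
  moreover have "(t\<^sup>2)\<^sup>2 = t ^ 4" by simp
  ultimately show ?thesis by linarith
qed

lemma le_one_plus_fourth: "t \<le> 1 + t ^ 4" for t :: real
proof -
  have "2 * t \<le> 1 + t\<^sup>2" using sum_squares_bound[of 1 t] by simp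
  moreover have "0 \<le> t ^ 4" using zero_le_power2[of "t\<^sup>2"] by simp
  ultimately show ?thesis using square_le_one_plus_fourth[of t] by linarith
qed

lemma mult_le_square_split: "p * q \<le> p\<^sup>2 / 4 + q\<^sup>2" for p q :: real
  using sum_squares_bound[of "p / 2" q] by (simp add: power_divide)

text \<open>
  Every logarithmic factor below can absorb a constant: \<open>1 \<le> 2 log n \<le> 16 log(n)^4\<close> and so on.
\<close>

lemma ln_ge_half: "1 / 2 \<le> ln (real n)" if "2 \<le> n"
proof -
  have "exp (1 / 2 :: real) \<le> 1 + 1 / 2 + (1 / 2)\<^sup>2"
    by (rule exp_bound) auto
  then have "exp (1 / 2) \<le> real n" using that by (simp add: power2_eq_square)
  then show ?thesis using that by (subst ln_ge_iff) auto
qed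

section \<open>Bounded integrable functions as vectors of the Hilbert space of square integrable functions\<close>

text \<open>
  All functions of the proof are bounded and integrable (the kernel, \<open>s\<close>, the smoothed functions, the estimators).
  This class is closed under linear combinations and convolution, and products of its members are
  integrable, so inner products can be expanded freely.
\<close>

definition bounded_integrable :: "(real \<Rightarrow> real) \<Rightarrow> bool"
  where "bounded_integrable u \<longleftrightarrow> integrable lborel u \<and> bounded (range u)"

lemma bounded_integrable_measurable: "bounded_integrable u \<Longrightarrow> u \<in> borel_measurable borel"
  by (auto simp: bounded_integrable_def dest: borel_measurable_integrable)

lemma bounded_integrableI:
  assumes "integrable lborel u" "\<And>x. \<bar>u x\<bar> \<le> c"
  shows "bounded_integrable u"
  using assms by (auto simp: bounded_integrable_def bounded_iff)

lemma bounded_integrableE: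
  assumes "bounded_integrable u"
  obtains c where "0 \<le> c" "\<And>x. \<bar>u x\<bar> \<le> c"
proof -
  obtain c where "\<And>x. \<bar>u x\<bar> \<le> c"
    using assms by (auto simp: bounded_integrable_def bounded_iff)
  then show ?thesis using that[of "\<bar>c\<bar>"] by (meson abs_ge_self abs_ge_zero order_trans)
qed

lemma bounded_integrable_mult:
  assumes "bounded_integrable u" "bounded_integrable v"
  shows "integrable lborel (\<lambda>x. u x * v x)"
proof -
  obtain c where c: "0 \<le> c" "\<And>x. \<bar>u x\<bar> \<le> c" using bounded_integrableE[OF assms(1)] by metis
  note [measurable] = assms[THEN bounded_integrable_measurable]
  show ?thesis
  proof (rule Bochner_Integration.integrable_bound)
    show "integrable lborel (\<lambda>x. c * v x)" using assms(2) by (simp add: bounded_integrable_def)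
    show "AE x in lborel. norm (u x * v x) \<le> norm (c * v x)"
      using c by (auto simp: abs_mult intro!: mult_right_mono)
  qed measurable
qed

lemma bounded_integrable_cmult: "bounded_integrable u \<Longrightarrow> bounded_integrable (\<lambda>x. c * u x)"
proof -
  assume u: "bounded_integrable u"
  obtain d where d: "0 \<le> d" "\<And>x. \<bar>u x\<bar> \<le> d" using bounded_integrableE[OF u] by metis
  show ?thesis
  proof (rule bounded_integrableI)
    show "integrable lborel (\<lambda>x. c * u x)" using u by (simp add: bounded_integrable_def)
    show "\<bar>c * u x\<bar> \<le> \<bar>c\<bar> * d" for x using d by (auto simp: abs_mult intro!: mult_left_mono)
  qed
qed

lemma bounded_integrable_add:
  assumes "bounded_integrable u" "bounded_integrable v"
  shows "bounded_integrable (\<lambda>x. u x + v x)"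
proof -
  obtain c d where "\<And>x. \<bar>u x\<bar> \<le> c" "\<And>x. \<bar>v x\<bar> \<le> d"
    using assms[THEN bounded_integrableE] by metis
  then have "\<bar>u x + v x\<bar> \<le> c + d" for x by (meson abs_triangle_ineq add_mono order_trans)
  then show ?thesis using assms by (intro bounded_integrableI) (auto simp: bounded_integrable_def)
qed

lemma bounded_integrable_diff:
  assumes "bounded_integrable u" "bounded_integrable v"
  shows "bounded_integrable (\<lambda>x. u x - v x)"
  using bounded_integrable_add[OF assms(1) bounded_integrable_cmult[OF assms(2), of "-1"]] by simp

lemma bounded_integrable_sum:
  assumes "\<And>i. i \<in> I \<Longrightarrow> bounded_integrable (u i)"
  shows "bounded_integrable (\<lambda>x. \<Sum>i\<in>I. u i x)"
  using assms
proof (induction I rule: infinite_finite_induct)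
  case (insert i I)
  then show ?case using bounded_integrable_add[of "u i" "\<lambda>x. \<Sum>i\<in>I. u i x"] by simp
qed (auto simp: bounded_integrable_def)

lemmas bounded_integrable_intros =
  bounded_integrable_cmult bounded_integrable_add bounded_integrable_diff bounded_integrable_sum

lemma L2_inner_commute: "L2_inner u v = L2_inner v u"
  by (simp add: L2_inner_def mult.commute)

lemma L2_inner_cmult_left: "L2_inner (\<lambda>x. c * u x) v = c * L2_inner u v"
  by (simp add: L2_inner_def mult.assoc)

lemma L2_inner_cmult_right: "L2_inner u (\<lambda>x. c * v x) = c * L2_inner u v"
  by (metis L2_inner_commute L2_inner_cmult_left)

lemma L2_inner_add_left:
  assumes "bounded_integrable u" "bounded_integrable v" "bounded_integrable w"
  shows "L2_inner (\<lambda>x. u x + v x) w = L2_inner u w + L2_inner v w"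
  unfolding L2_inner_def using assms by (simp add: distrib_right bounded_integrable_mult)

lemma L2_inner_add_right:
  assumes "bounded_integrable u" "bounded_integrable v" "bounded_integrable w"
  shows "L2_inner w (\<lambda>x. u x + v x) = L2_inner w u + L2_inner w v"
  using L2_inner_add_left[OF assms] by (simp add: L2_inner_commute)

lemma L2_inner_diff_left:
  assumes "bounded_integrable u" "bounded_integrable v" "bounded_integrable w"
  shows "L2_inner (\<lambda>x. u x - v x) w = L2_inner u w - L2_inner v w"
  unfolding L2_inner_def using assms by (simp add: left_diff_distrib bounded_integrable_mult)

lemma L2_inner_diff_right:
  assumes "bounded_integrable u" "bounded_integrable v" "bounded_integrable w"
  shows "L2_inner w (\<lambda>x. u x - v x) = L2_inner w u - L2_inner w v"
  using L2_inner_diff_left[OF assms] by (simp add: L2_inner_commute)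

lemma L2_inner_sum_left:
  assumes "\<And>i. i \<in> I \<Longrightarrow> bounded_integrable (u i)" "bounded_integrable w"
  shows "L2_inner (\<lambda>x. \<Sum>i\<in>I. u i x) w = (\<Sum>i\<in>I. L2_inner (u i) w)"
  unfolding L2_inner_def using assms
  by (subst integral_sum'[symmetric]) (auto simp: sum_distrib_right bounded_integrable_mult)

lemma L2_inner_sum_right:
  assumes "\<And>i. i \<in> I \<Longrightarrow> bounded_integrable (u i)" "bounded_integrable w"
  shows "L2_inner w (\<lambda>x. \<Sum>i\<in>I. u i x) = (\<Sum>i\<in>I. L2_inner w (u i))"
  using L2_inner_sum_left[OF assms] by (simp add: L2_inner_commute)

lemma L2_inner_self_nonneg: "0 \<le> L2_inner u u"
  unfolding L2_inner_def by (intro integral_nonneg_AE) auto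

lemma L2_norm_nonneg: "0 \<le> L2_norm u"
  by (simp add: L2_norm_def L2_inner_self_nonneg)

lemma L2_norm_square: "(L2_norm u)\<^sup>2 = L2_inner u u"
  by (simp add: L2_norm_def L2_inner_self_nonneg)

lemma L2_norm_cmult: "L2_norm (\<lambda>x. c * u x) = \<bar>c\<bar> * L2_norm u"
  by (simp add: L2_norm_def L2_inner_cmult_left L2_inner_cmult_right real_sqrt_mult)

lemma L2_inner_add_add:
  assumes "bounded_integrable u" "bounded_integrable v" "bounded_integrable u'" "bounded_integrable v'"
  shows "L2_inner (\<lambda>x. u x + v x) (\<lambda>x. u' x + v' x)
    = L2_inner u u' + L2_inner u v' + L2_inner v u' + L2_inner v v'"
  using assms by (simp add: L2_inner_add_left L2_inner_add_right bounded_integrable_add)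

lemma L2_norm_square_add:
  assumes "bounded_integrable u" "bounded_integrable v"
  shows "(L2_norm (\<lambda>x. u x + v x))\<^sup>2 = (L2_norm u)\<^sup>2 + 2 * L2_inner u v + (L2_norm v)\<^sup>2"
  unfolding L2_norm_square
  using assms by (simp add: L2_inner_add_left L2_inner_add_right bounded_integrable_intros L2_inner_commute)

lemma L2_norm_square_diff:
  assumes "bounded_integrable u" "bounded_integrable v"
  shows "(L2_norm (\<lambda>x. u x - v x))\<^sup>2 = (L2_norm u)\<^sup>2 - 2 * L2_inner u v + (L2_norm v)\<^sup>2"
  unfolding L2_norm_square
  using assms by (simp add: L2_inner_diff_left L2_inner_diff_right bounded_integrable_intros L2_inner_commute)

lemma L2_Cauchy_Schwarz:
  assumes u: "bounded_integrable u" and v: "bounded_integrable v"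
  shows "\<bar>L2_inner u v\<bar> \<le> L2_norm u * L2_norm v"
proof -
  have pos: "0 \<le> (L2_norm u)\<^sup>2 - 2 * t * L2_inner u v + t\<^sup>2 * (L2_norm v)\<^sup>2" for t
  proof -
    have "0 \<le> (L2_norm (\<lambda>x. u x - t * v x))\<^sup>2" by simp
    also have "\<dots> = (L2_norm u)\<^sup>2 - 2 * t * L2_inner u v + t\<^sup>2 * (L2_norm v)\<^sup>2"
      unfolding L2_norm_square_diff[OF u bounded_integrable_cmult[OF v]] L2_norm_square
        L2_inner_cmult_left L2_inner_cmult_right
      by (simp add: power2_eq_square)
    finally show ?thesis .
  qed
  have "(L2_inner u v)\<^sup>2 \<le> (L2_norm u)\<^sup>2 * (L2_norm v)\<^sup>2"
  proof (cases "L2_norm v = 0")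
    case True
    have "L2_inner u v = 0"
    proof (rule ccontr)
      assume "L2_inner u v \<noteq> 0"
      then show False
        using pos[of "((L2_norm u)\<^sup>2 + 1) / (2 * L2_inner u v)"] True by simp
    qed
    then show ?thesis by simp
  next
    case False
    define B where "B = (L2_norm v)\<^sup>2"
    have B: "0 < B" using False by (simp add: B_def)
    have "0 \<le> (L2_norm u)\<^sup>2 - 2 * (L2_inner u v / B) * L2_inner u v + (L2_inner u v / B)\<^sup>2 * B"
      using pos[of "L2_inner u v / B"] by (simp only: B_def)
    also have "\<dots> = (L2_norm u)\<^sup>2 - (L2_inner u v)\<^sup>2 / B"
      using B by (simp add: power2_eq_square)
    finally show ?thesis unfolding B_def[symmetric] using B by (simp add: pos_divide_le_eq)
  qed
  then have "\<bar>L2_inner u v\<bar>\<^sup>2 \<le> (L2_norm u * L2_norm v)\<^sup>2"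
    by (simp add: power_mult_distrib)
  then show ?thesis
    by (rule power2_le_imp_le) (simp add: L2_norm_nonneg)
qed

lemma L2_inner_young:
  assumes "bounded_integrable u" "bounded_integrable v" "0 < t"
  shows "2 * \<bar>L2_inner u v\<bar> \<le> t * (L2_norm u)\<^sup>2 + (L2_norm v)\<^sup>2 / t"
proof -
  have "2 * (L2_norm u * L2_norm v) \<le> t * (L2_norm u)\<^sup>2 + (L2_norm v)\<^sup>2 / t"
    using sum_squares_bound[of "sqrt t * L2_norm u" "L2_norm v / sqrt t"] assms(3)
    by (simp add: power_mult_distrib power_divide)
  then show ?thesis using L2_Cauchy_Schwarz[OF assms(1,2)] by linarith
qed

lemma L2_norm_square_diff_le:
  assumes "bounded_integrable u" "bounded_integrable v"
  shows "(L2_norm (\<lambda>x. u x - v x))\<^sup>2 \<le> 2 * (L2_norm u)\<^sup>2 + 2 * (L2_norm v)\<^sup>2"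
  using L2_inner_young[OF assms, of 1] by (simp add: L2_norm_square_diff[OF assms])

section \<open>Convolution\<close>

lemma nn_integral_reflect_translate:
  fixes g :: "real \<Rightarrow> ennreal"
  assumes [measurable]: "g \<in> borel_measurable borel"
  shows "(\<integral>\<^sup>+y. g (x - y) \<partial>lborel) = (\<integral>\<^sup>+y. g y \<partial>lborel)"
  using nn_integral_real_affine[of g "-1" x] by (simp add: one_ennreal_def[symmetric])

lemma nn_integral_translate:
  fixes g :: "real \<Rightarrow> ennreal"
  assumes [measurable]: "g \<in> borel_measurable borel"
  shows "(\<integral>\<^sup>+y. g (y - x) \<partial>lborel) = (\<integral>\<^sup>+y. g y \<partial>lborel)"
  using nn_integral_real_affine[of g 1 "-x"] by (simp add: one_ennreal_def[symmetric])

lemma integral_reflect_translate: "(\<integral>y. g (x - y) \<partial>lborel) = (\<integral>y. g y \<partial>lborel)"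
  for g :: "real \<Rightarrow> real"
  using lborel_integral_real_affine[of "-1" g x] by simp

lemma bounded_integrable_reflect_translate:
  assumes "bounded_integrable k"
  shows "bounded_integrable (\<lambda>y. k (x - y))"
proof -
  obtain c where "\<And>x. \<bar>k x\<bar> \<le> c" using bounded_integrableE[OF assms] by metis
  then show ?thesis
    using assms lborel_integrable_real_affine[of k "-1" x]
    by (intro bounded_integrableI[of _ c]) (auto simp: bounded_integrable_def)
qed

lemma L2_norm_reflect_translate: "L2_norm (\<lambda>y. k (x - y)) = L2_norm k"
  unfolding L2_norm_def L2_inner_def using integral_reflect_translate[of "\<lambda>y. k y * k y" x] by simp

lemma conv_eq_L2_inner: "conv k v x = L2_inner (\<lambda>y. k (x - y)) v"
  by (simp add: conv_def L2_inner_def)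

lemma conv_le_L2:
  assumes "bounded_integrable k" "bounded_integrable v"
  shows "\<bar>conv k v x\<bar> \<le> L2_norm k * L2_norm v"
  using L2_Cauchy_Schwarz[OF bounded_integrable_reflect_translate[OF assms(1)] assms(2)]
  by (simp add: conv_eq_L2_inner L2_norm_reflect_translate)

lemma conv_le_bound:
  assumes k: "bounded_integrable k" and v: "bounded_integrable v" "\<And>x. \<bar>v x\<bar> \<le> c"
  shows "\<bar>conv k v x\<bar> \<le> (\<integral>y. \<bar>k y\<bar> \<partial>lborel) * c"
proof -
  note k' = bounded_integrable_reflect_translate[OF k, of x]
  have "\<bar>conv k v x\<bar> \<le> (\<integral>y. \<bar>k (x - y) * v y\<bar> \<partial>lborel)"
    unfolding conv_def using integral_norm_bound[of lborel "\<lambda>y. k (x - y) * v y"] by simp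
  also have "\<dots> \<le> (\<integral>y. \<bar>k (x - y)\<bar> * c \<partial>lborel)"
    using v k' integrable_abs[OF bounded_integrable_mult[OF k' v(1)]]
    by (intro integral_mono) (auto simp: abs_mult bounded_integrable_def intro!: mult_left_mono)
  also have "\<dots> = (\<integral>y. \<bar>k y\<bar> \<partial>lborel) * c"
    using integral_reflect_translate[of "\<lambda>y. \<bar>k y\<bar>" x] by simp
  finally show ?thesis .
qed

lemma conv_measurable:
  assumes "bounded_integrable k" "bounded_integrable v"
  shows "conv k v \<in> borel_measurable borel"
proof -
  note [measurable] = assms[THEN bounded_integrable_measurable]
  have "(\<lambda>x. \<integral>y. k (x - y) * v y \<partial>lborel) \<in> borel_measurable lborel"
    by (rule lborel.borel_measurable_lebesgue_integral) measurable
  then show ?thesis by (simp add: conv_def[abs_def])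
qed

lemma bounded_integrable_conv:
  assumes k: "bounded_integrable k" and v: "bounded_integrable v"
  shows "bounded_integrable (conv k v)"
proof (rule bounded_integrableI[OF _ conv_le_L2[OF assms]])
  note [measurable] = assms[THEN bounded_integrable_measurable] conv_measurable[OF assms]
  have "(\<integral>\<^sup>+x. ennreal \<bar>conv k v x\<bar> \<partial>lborel)
      \<le> (\<integral>\<^sup>+x. \<integral>\<^sup>+y. ennreal \<bar>k (x - y)\<bar> * ennreal \<bar>v y\<bar> \<partial>lborel \<partial>lborel)"
  proof (rule nn_integral_mono)
    fix x
    show "ennreal \<bar>conv k v x\<bar> \<le> (\<integral>\<^sup>+y. ennreal \<bar>k (x - y)\<bar> * ennreal \<bar>v y\<bar> \<partial>lborel)"
      unfolding conv_def
      using integral_norm_bound_ennreal[OF bounded_integrable_mult[OF bounded_integrable_reflect_translate[OF k, of x] v]]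
      by (simp add: abs_mult ennreal_mult)
  qed
  also have "\<dots> = (\<integral>\<^sup>+y. \<integral>\<^sup>+x. ennreal \<bar>k (x - y)\<bar> * ennreal \<bar>v y\<bar> \<partial>lborel \<partial>lborel)"
    by (rule lborel_pair.Fubini') measurable
  also have "\<dots> = (\<integral>\<^sup>+y. (\<integral>\<^sup>+x. ennreal \<bar>k x\<bar> \<partial>lborel) * ennreal \<bar>v y\<bar> \<partial>lborel)"
    by (simp add: nn_integral_multc nn_integral_translate[where g = "\<lambda>x. ennreal \<bar>k x\<bar>"])
  also have "\<dots> = (\<integral>\<^sup>+x. ennreal \<bar>k x\<bar> \<partial>lborel) * (\<integral>\<^sup>+y. ennreal \<bar>v y\<bar> \<partial>lborel)"
    by (simp add: nn_integral_cmult)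
  also have "\<dots> < \<infinity>"
    using k v by (auto simp: bounded_integrable_def integrable_iff_bounded ennreal_mult_less_top)
  finally show "integrable lborel (conv k v)"
    by (intro integrableI_bounded) auto
qed

text \<open>
  Young's inequality for an integrable kernel: write \<open>\<bar>k\<bar> \<bar>v\<bar> = sqrt \<bar>k\<bar> (sqrt \<bar>k\<bar> \<bar>v\<bar>)\<close>, apply the Cauchy-Schwarz
  inequality, and integrate the result with Tonelli's theorem.
\<close>

lemma L2_norm_conv_le:
  assumes k: "bounded_integrable k" and v: "bounded_integrable v"
  shows "L2_norm (conv k v) \<le> (\<integral>y. \<bar>k y\<bar> \<partial>lborel) * L2_norm v"
proof -
  note [measurable] = assms[THEN bounded_integrable_measurable] conv_measurable[OF assms]
  define k1 where "k1 = (\<integral>y. \<bar>k y\<bar> \<partial>lborel)"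
  have k1: "0 \<le> k1" by (simp add: k1_def)
  have kint: "(\<integral>\<^sup>+y. ennreal \<bar>k y\<bar> \<partial>lborel) = ennreal k1"
    using k by (simp add: k1_def nn_integral_eq_integral bounded_integrable_def)
  have vint: "(\<integral>\<^sup>+y. ennreal ((v y)\<^sup>2) \<partial>lborel) = ennreal ((L2_norm v)\<^sup>2)"
    unfolding L2_norm_square L2_inner_def using bounded_integrable_mult[OF v v]
    by (simp add: nn_integral_eq_integral power2_eq_square)
  have pt: "ennreal ((conv k v x)\<^sup>2) \<le> ennreal k1 * (\<integral>\<^sup>+y. ennreal \<bar>k (x - y)\<bar> * ennreal ((v y)\<^sup>2) \<partial>lborel)" for x
  proof -
    have "ennreal \<bar>conv k v x\<bar> \<le> (\<integral>\<^sup>+y. ennreal \<bar>k (x - y)\<bar> * ennreal \<bar>v y\<bar> \<partial>lborel)"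
      unfolding conv_def
      using integral_norm_bound_ennreal[OF bounded_integrable_mult[OF bounded_integrable_reflect_translate[OF k, of x] v]]
      by (simp add: abs_mult ennreal_mult)
    also have "\<dots> = (\<integral>\<^sup>+y. ennreal (sqrt \<bar>k (x - y)\<bar>) * ennreal (sqrt \<bar>k (x - y)\<bar> * \<bar>v y\<bar>) \<partial>lborel)"
      by (intro nn_integral_cong) (simp add: ennreal_mult'[symmetric] mult.assoc[symmetric])
    finally have "(ennreal \<bar>conv k v x\<bar>)\<^sup>2
        \<le> (\<integral>\<^sup>+y. ennreal (sqrt \<bar>k (x - y)\<bar>) * ennreal (sqrt \<bar>k (x - y)\<bar> * \<bar>v y\<bar>) \<partial>lborel)\<^sup>2"
      by (rule power_mono) simp
    also have "\<dots> \<le> (\<integral>\<^sup>+y. (ennreal (sqrt \<bar>k (x - y)\<bar>))\<^sup>2 \<partial>lborel)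
        * (\<integral>\<^sup>+y. (ennreal (sqrt \<bar>k (x - y)\<bar> * \<bar>v y\<bar>))\<^sup>2 \<partial>lborel)"
      by (rule Cauchy_Schwarz_nn_integral) measurable
    also have "(\<integral>\<^sup>+y. (ennreal (sqrt \<bar>k (x - y)\<bar>))\<^sup>2 \<partial>lborel) = ennreal k1"
      by (simp add: ennreal_power nn_integral_reflect_translate[where g = "\<lambda>x. ennreal \<bar>k x\<bar>"] kint)
    also have "(\<integral>\<^sup>+y. (ennreal (sqrt \<bar>k (x - y)\<bar> * \<bar>v y\<bar>))\<^sup>2 \<partial>lborel)
        = (\<integral>\<^sup>+y. ennreal \<bar>k (x - y)\<bar> * ennreal ((v y)\<^sup>2) \<partial>lborel)"
      by (intro nn_integral_cong) (simp add: ennreal_power power_mult_distrib ennreal_mult)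
    finally show ?thesis by (simp add: ennreal_power)
  qed
  have "ennreal ((L2_norm (conv k v))\<^sup>2) = (\<integral>\<^sup>+x. ennreal ((conv k v x)\<^sup>2) \<partial>lborel)"
    unfolding L2_norm_square L2_inner_def
    using bounded_integrable_mult[OF bounded_integrable_conv[OF k v] bounded_integrable_conv[OF k v]]
    by (simp add: nn_integral_eq_integral power2_eq_square)
  also have "\<dots> \<le> (\<integral>\<^sup>+x. ennreal k1 * (\<integral>\<^sup>+y. ennreal \<bar>k (x - y)\<bar> * ennreal ((v y)\<^sup>2) \<partial>lborel) \<partial>lborel)"
    by (intro nn_integral_mono pt)
  also have "\<dots> = ennreal k1 * (\<integral>\<^sup>+x. (\<integral>\<^sup>+y. ennreal \<bar>k (x - y)\<bar> * ennreal ((v y)\<^sup>2) \<partial>lborel) \<partial>lborel)"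
    by (rule nn_integral_cmult) measurable
  also have "(\<integral>\<^sup>+x. (\<integral>\<^sup>+y. ennreal \<bar>k (x - y)\<bar> * ennreal ((v y)\<^sup>2) \<partial>lborel) \<partial>lborel)
      = (\<integral>\<^sup>+y. (\<integral>\<^sup>+x. ennreal \<bar>k (x - y)\<bar> * ennreal ((v y)\<^sup>2) \<partial>lborel) \<partial>lborel)"
    by (rule lborel_pair.Fubini') measurable
  also have "\<dots> = (\<integral>\<^sup>+y. ennreal k1 * ennreal ((v y)\<^sup>2) \<partial>lborel)"
    by (simp add: nn_integral_multc nn_integral_translate[where g = "\<lambda>x. ennreal \<bar>k x\<bar>"] kint)
  also have "\<dots> = ennreal k1 * ennreal ((L2_norm v)\<^sup>2)"
    by (simp add: nn_integral_cmult vint)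
  finally have "ennreal ((L2_norm (conv k v))\<^sup>2) \<le> ennreal ((k1 * L2_norm v)\<^sup>2)"
    using k1 by (simp add: ennreal_mult'[symmetric] power_mult_distrib power2_eq_square mult_ac)
  then have "(L2_norm (conv k v))\<^sup>2 \<le> (k1 * L2_norm v)\<^sup>2"
    by simp
  then show ?thesis
    unfolding k1_def[symmetric]
    by (rule power2_le_imp_le) (simp add: k1 L2_norm_nonneg)
qed

lemma L2_inner_conv_self_adjoint:
  assumes k: "bounded_integrable k" and even: "\<And>x. k (- x) = k x"
    and u: "bounded_integrable u" and v: "bounded_integrable v"
  shows "L2_inner u (conv k v) = L2_inner (conv k u) v"
proof -
  note [measurable] = assms(1,3,4)[THEN bounded_integrable_measurable]
  let ?f = "\<lambda>(x, y). u x * (k (x - y) * v y)"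
  have bi_abs: "bounded_integrable (\<lambda>x. \<bar>w x\<bar>)" if "bounded_integrable w" for w
    using that by (auto simp: bounded_integrable_def bounded_iff)
  have "integrable (lborel \<Otimes>\<^sub>M lborel) ?f"
  proof (rule lborel_pair.Fubini_integrable)
    have "(\<integral>y. norm (?f (x, y)) \<partial>lborel) = \<bar>u x\<bar> * conv (\<lambda>x. \<bar>k x\<bar>) (\<lambda>x. \<bar>v x\<bar>) x" for x
      by (simp add: conv_def abs_mult)
    then show "integrable lborel (\<lambda>x. \<integral>y. norm (?f (x, y)) \<partial>lborel)"
      using bounded_integrable_mult[OF bi_abs[OF u] bounded_integrable_conv[OF bi_abs[OF k] bi_abs[OF v]]]
      by simp
    have "integrable lborel (\<lambda>y. ?f (x, y))" for x
      using bounded_integrable_mult[OF bounded_integrable_reflect_translate[OF k, of x] v] by simp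
    then show "AE x in lborel. integrable lborel (\<lambda>y. ?f (x, y))" by simp
  qed measurable
  then have "(\<integral>y. \<integral>x. u x * (k (x - y) * v y) \<partial>lborel \<partial>lborel) = (\<integral>x. \<integral>y. u x * (k (x - y) * v y) \<partial>lborel \<partial>lborel)"
    by (rule lborel_pair.Fubini_integral)
  moreover have "(\<integral>y. u x * (k (x - y) * v y) \<partial>lborel) = u x * conv k v x" for x
    by (simp add: conv_def)
  moreover have "(\<integral>x. u x * (k (x - y) * v y) \<partial>lborel) = conv k u y * v y" for y
  proof -
    have "(\<lambda>x. u x * (k (x - y) * v y)) = (\<lambda>x. (k (y - x) * u x) * v y)"
      using even[of "x - y" for x] by (auto simp: fun_eq_iff)
    then show ?thesis by (simp add: conv_def)
  qed
  ultimately show ?thesis by (simp only: L2_inner_def)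
qed

section \<open>Decoupling by averaging over subsets\<close>

text \<open>
  For \<open>i \<noteq> j\<close> exactly a quarter of all subsets \<open>I\<close> separate \<open>i \<in> I\<close> from \<open>j \<notin> I\<close>. So the off-diagonal part of a double
  sum is four times its average over all splittings, and each splitting involves two disjoint groups of indices.
\<close>

lemma sum_over_splittings:
  fixes g :: "'i \<Rightarrow> 'i \<Rightarrow> real"
  assumes "finite N"
  shows "4 * (\<Sum>I\<in>Pow N. \<Sum>i\<in>I. \<Sum>j\<in>N - I. g i j) = 2 ^ card N * (\<Sum>i\<in>N. \<Sum>j\<in>N - {i}. g i j)"
proof -
  have count: "4 * real (card {I \<in> Pow N. i \<in> I \<and> j \<notin> I}) = (if i = j then 0 else 2 ^ card N)"
    if ij: "i \<in> N" "j \<in> N" for i j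
  proof (cases "i = j")
    case False
    have eq: "{I \<in> Pow N. i \<in> I \<and> j \<notin> I} = insert i ` Pow (N - {i, j})"
    proof (intro set_eqI iffI)
      fix I assume "I \<in> {I \<in> Pow N. i \<in> I \<and> j \<notin> I}"
      then have "I = insert i (I - {i})" "I - {i} \<in> Pow (N - {i, j})" by auto
      then show "I \<in> insert i ` Pow (N - {i, j})" by blast
    qed (use ij False in auto)
    have inj: "inj_on (insert i) (Pow (N - {i, j}))"
      by (auto simp: inj_on_def)
    have "card N = card {i, j} + card (N - {i, j})"
      using ij assms card_Diff_subset[of "{i, j}" N] card_mono[of N "{i, j}"] by simp
    then have "card N = Suc (Suc (card (N - {i, j})))" using False by simp
    then show ?thesis unfolding eq card_image[OF inj] using assms False by (simp add: card_Pow)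
  qed auto
  have "(\<Sum>I\<in>Pow N. \<Sum>i\<in>I. \<Sum>j\<in>N - I. g i j)
      = (\<Sum>I\<in>Pow N. \<Sum>i\<in>N. \<Sum>j\<in>N. if i \<in> I \<and> j \<notin> I then g i j else 0)"
  proof (rule sum.cong[OF refl])
    fix I assume I: "I \<in> Pow N"
    have "(\<Sum>i\<in>I. \<Sum>j\<in>N - I. g i j) = (\<Sum>i\<in>N. if i \<in> I then \<Sum>j\<in>N - I. g i j else 0)"
      using I assms by (subst sum.inter_restrict[symmetric]) (auto simp: Int_absorb1)
    also have "\<dots> = (\<Sum>i\<in>N. \<Sum>j\<in>N. if i \<in> I \<and> j \<notin> I then g i j else 0)"
      using assms by (intro sum.cong) (auto simp: sum.If_cases Diff_eq Compl_eq)
    finally show "(\<Sum>i\<in>I. \<Sum>j\<in>N - I. g i j) = \<dots>" .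
  qed
  also have "\<dots> = (\<Sum>i\<in>N. \<Sum>j\<in>N. \<Sum>I\<in>Pow N. if i \<in> I \<and> j \<notin> I then g i j else 0)"
    by (subst sum.swap, rule sum.cong[OF refl], subst sum.swap) (rule refl)
  also have "\<dots> = (\<Sum>i\<in>N. \<Sum>j\<in>N. real (card {I \<in> Pow N. i \<in> I \<and> j \<notin> I}) * g i j)"
    using assms by (intro sum.cong refl) (simp add: sum.If_cases Int_def)
  finally have "4 * (\<Sum>I\<in>Pow N. \<Sum>i\<in>I. \<Sum>j\<in>N - I. g i j)
      = (\<Sum>i\<in>N. \<Sum>j\<in>N. (4 * real (card {I \<in> Pow N. i \<in> I \<and> j \<notin> I})) * g i j)"
    by (simp add: sum_distrib_left mult.assoc)
  also have "\<dots> = (\<Sum>i\<in>N. \<Sum>j\<in>N. if j \<in> N - {i} then 2 ^ card N * g i j else 0)"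
    by (intro sum.cong refl) (subst count, auto)
  also have "\<dots> = (\<Sum>i\<in>N. \<Sum>j\<in>N - {i}. 2 ^ card N * g i j)"
    using assms by (intro sum.cong refl sum.mono_neutral_cong_right) auto
  finally show ?thesis by (simp add: sum_distrib_left)
qed

section \<open>Exponential moments for independent identically distributed samples\<close>

lemma integrable_of_nn_integral_le:
  fixes f :: "'b \<Rightarrow> real"
  assumes [measurable]: "f \<in> borel_measurable M" and nonneg: "\<And>x. 0 \<le> f x"
    and le: "(\<integral>\<^sup>+x. ennreal (f x) \<partial>M) \<le> ennreal c" and c: "0 \<le> c"
  shows "integrable M f" "(\<integral>x. f x \<partial>M) \<le> c"
proof -
  show int: "integrable M f"
    using le nonneg by (intro integrableI_bounded) (auto simp: top_unique less_top[symmetric])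
  show "(\<integral>x. f x \<partial>M) \<le> c"
    using le c by (simp add: nn_integral_eq_integral[OF int] nonneg)
qed

lemma L2_inner_measurable:
  assumes "case_prod F \<in> borel_measurable (N \<Otimes>\<^sub>M borel)" "case_prod G \<in> borel_measurable (N \<Otimes>\<^sub>M borel)"
  shows "(\<lambda>z. L2_inner (F z) (G z)) \<in> borel_measurable N"
proof -
  have [measurable]: "case_prod F \<in> borel_measurable (N \<Otimes>\<^sub>M lborel)" "case_prod G \<in> borel_measurable (N \<Otimes>\<^sub>M lborel)"
    using assms by (simp_all cong: measurable_cong_sets sets_pair_measure_cong)
  show ?thesis unfolding L2_inner_def
    by (rule lborel.borel_measurable_lebesgue_integral) measurable
qed

lemma L2_norm_measurable:
  assumes "case_prod F \<in> borel_measurable (N \<Otimes>\<^sub>M borel)"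
  shows "(\<lambda>z. L2_norm (F z)) \<in> borel_measurable N"
proof -
  note [measurable] = L2_inner_measurable[OF assms assms]
  show ?thesis unfolding L2_norm_def by measurable
qed

lemma sum_components_measurable:
  fixes V :: "'q \<Rightarrow> real \<Rightarrow> real"
  assumes V: "case_prod V \<in> borel_measurable (Q \<Otimes>\<^sub>M borel)" and I: "I \<subseteq> N"
  shows "(\<lambda>(z, x). \<Sum>i\<in>I. V (z i) x) \<in> borel_measurable (PiM N (\<lambda>_. Q) \<Otimes>\<^sub>M borel)"
proof -
  have "(\<lambda>p. \<Sum>i\<in>I. V (fst p i) (snd p)) \<in> borel_measurable (PiM N (\<lambda>_. Q) \<Otimes>\<^sub>M borel)"
  proof (rule borel_measurable_sum)
    fix i assume "i \<in> I"
    then have [measurable]: "(\<lambda>z. z i) \<in> measurable (PiM N (\<lambda>_. Q)) Q" using I by auto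
    have "(\<lambda>p. (fst p i, snd p)) \<in> measurable (PiM N (\<lambda>_. Q) \<Otimes>\<^sub>M borel) (Q \<Otimes>\<^sub>M borel)"
      by measurable
    from measurable_compose[OF this V]
    show "(\<lambda>p. V (fst p i) (snd p)) \<in> borel_measurable (PiM N (\<lambda>_. Q) \<Otimes>\<^sub>M borel)" by simp
  qed
  then show ?thesis by (simp add: case_prod_beta')
qed

context prob_space
begin

lemma product_sigma_finite_iid: "product_sigma_finite (\<lambda>_. M)"
  by unfold_locales

lemma nn_integral_iid_prod:
  assumes "finite I" "g \<in> borel_measurable M"
  shows "(\<integral>\<^sup>+z. (\<Prod>i\<in>I. g (z i)) \<partial>PiM I (\<lambda>_. M)) = (\<integral>\<^sup>+y. g y \<partial>M) ^ card I"
  using product_sigma_finite.product_nn_integral_prod[OF product_sigma_finite_iid assms(1), of "\<lambda>_. g"] assms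
  by simp

lemma nn_integral_exp_sum_iid:
  fixes g :: "'a \<Rightarrow> real"
  assumes "finite I" and [measurable]: "g \<in> borel_measurable M"
  shows "(\<integral>\<^sup>+z. ennreal (exp (\<Sum>i\<in>I. g (z i))) \<partial>PiM I (\<lambda>_. M)) = (\<integral>\<^sup>+y. ennreal (exp (g y)) \<partial>M) ^ card I"
  using nn_integral_iid_prod[OF assms(1), of "\<lambda>y. ennreal (exp (g y))"]
  by (simp add: exp_sum[OF assms(1)] prod_ennreal)

text \<open>
  Pinelis's exponential inequality for a sum of independent centred random functions. The inequality
  \<open>cosh_sqrt_step\<close> is applied to the sum of the other terms and one new term; its linear part integrates to zero, so
  each term contributes the factor \<open>E (exp ||V|| - ||V||)\<close>.
\<close>

lemma nn_integral_cosh_L2_norm_sum: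
  assumes meas: "case_prod V \<in> borel_measurable (M \<Otimes>\<^sub>M borel)"
    and bi: "\<And>z. z \<in> space M \<Longrightarrow> bounded_integrable (V z)"
    and centered: "\<And>v. bounded_integrable v \<Longrightarrow> has_bochner_integral M (\<lambda>z. L2_inner v (V z)) 0"
    and exp_int: "integrable M (\<lambda>z. exp (L2_norm (V z)) - L2_norm (V z))"
    and "finite I"
  shows "(\<integral>\<^sup>+z. ennreal (cosh (L2_norm (\<lambda>x. \<Sum>i\<in>I. V (z i) x))) \<partial>PiM I (\<lambda>_. M))
    \<le> ennreal (expectation (\<lambda>z. exp (L2_norm (V z)) - L2_norm (V z))) ^ card I"
  using \<open>finite I\<close>
proof (induction I)
  case empty
  interpret P: prob_space "PiM {} (\<lambda>_. M)" by (intro prob_space_PiM prob_space_axioms)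
  show ?case by (simp add: P.emeasure_space_1 L2_norm_def L2_inner_def)
next
  case (insert i I)
  interpret product_sigma_finite "\<lambda>_. M" by (rule product_sigma_finite_iid)
  let ?c = "expectation (\<lambda>z. exp (L2_norm (V z)) - L2_norm (V z))"
  let ?S = "\<lambda>z x. \<Sum>j\<in>I. V (z j) x"
  have norm_meas: "(\<lambda>z. L2_norm (\<lambda>x. \<Sum>j\<in>J. V (z j) x)) \<in> borel_measurable (PiM J (\<lambda>_. M))" for J
    using L2_norm_measurable[OF sum_components_measurable[OF meas subset_refl]] .
  have c: "0 \<le> ?c"
  proof (rule Bochner_Integration.integral_nonneg)
    fix z
    show "0 \<le> exp (L2_norm (V z)) - L2_norm (V z)"
      using exp_ge_add_one_self[of "L2_norm (V z)"] by linarith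
  qed
  have inner: "(\<integral>\<^sup>+y. ennreal (cosh (L2_norm (\<lambda>x. \<Sum>j\<in>insert i I. V ((z(i := y)) j) x))) \<partial>M)
      \<le> ennreal ?c * ennreal (cosh (L2_norm (?S z)))"
    if z: "z \<in> space (PiM I (\<lambda>_. M))" for z
  proof -
    have Sbi: "bounded_integrable (?S z)"
      using z by (intro bounded_integrable_sum bi) (auto simp: space_PiM)
    let ?r = "L2_norm (?S z)"
    let ?F = "\<lambda>y. cosh ?r * (exp (L2_norm (V y)) - L2_norm (V y)) + L2_inner (?S z) (V y) * (sinh ?r / ?r)"
    have pt: "cosh (L2_norm (\<lambda>x. \<Sum>j\<in>insert i I. V ((z(i := y)) j) x)) \<le> ?F y" if y: "y \<in> space M" for y
    proof -
      have "(\<Sum>j\<in>insert i I. V ((z(i := y)) j) x) = ?S z x + V y x" for x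
        using insert.hyps by (auto simp: intro!: sum.cong)
      then have "L2_norm (\<lambda>x. \<Sum>j\<in>insert i I. V ((z(i := y)) j) x) = L2_norm (\<lambda>x. ?S z x + V y x)"
        by simp
      also have "\<dots> = sqrt (?r\<^sup>2 + 2 * L2_inner (?S z) (V y) + (L2_norm (V y))\<^sup>2)"
        using L2_norm_square_add[OF Sbi bi[OF y]] L2_norm_nonneg[of "\<lambda>x. ?S z x + V y x"]
        by (metis real_sqrt_unique)
      finally show ?thesis
        using cosh_sqrt_step[OF L2_norm_nonneg L2_norm_nonneg L2_Cauchy_Schwarz[OF Sbi bi[OF y]]] by simp
    qed
    have int: "integrable M ?F"
      using exp_int centered[OF Sbi] by (auto simp: has_bochner_integral_iff)
    have "(\<integral>\<^sup>+y. ennreal (cosh (L2_norm (\<lambda>x. \<Sum>j\<in>insert i I. V ((z(i := y)) j) x))) \<partial>M)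
        \<le> (\<integral>\<^sup>+y. ennreal (?F y) \<partial>M)"
      using pt by (intro nn_integral_mono ennreal_leI)
    also have "\<dots> = ennreal (integral\<^sup>L M ?F)"
    proof (rule nn_integral_eq_integral[OF int])
      show "AE y in M. 0 \<le> ?F y"
        using pt by (intro AE_I2) (meson cosh_real_nonneg order_trans)
    qed
    also have "integral\<^sup>L M ?F = cosh ?r * ?c"
      using exp_int centered[OF Sbi] by (simp add: has_bochner_integral_iff)
    finally show ?thesis using c by (simp add: ennreal_mult'[symmetric] mult.commute)
  qed
  have "(\<integral>\<^sup>+z. ennreal (cosh (L2_norm (\<lambda>x. \<Sum>j\<in>insert i I. V (z j) x))) \<partial>PiM (insert i I) (\<lambda>_. M))
      = (\<integral>\<^sup>+z. \<integral>\<^sup>+y. ennreal (cosh (L2_norm (\<lambda>x. \<Sum>j\<in>insert i I. V ((z(i := y)) j) x))) \<partial>M \<partial>PiM I (\<lambda>_. M))"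
  proof (rule product_nn_integral_insert[OF insert.hyps])
    note [measurable] = norm_meas[of "insert i I"]
    show "(\<lambda>z. ennreal (cosh (L2_norm (\<lambda>x. \<Sum>j\<in>insert i I. V (z j) x)))) \<in> borel_measurable (PiM (insert i I) (\<lambda>_. M))"
      unfolding cosh_def by measurable
  qed
  also have "\<dots> \<le> (\<integral>\<^sup>+z. ennreal ?c * ennreal (cosh (L2_norm (?S z))) \<partial>PiM I (\<lambda>_. M))"
    by (intro nn_integral_mono inner)
  also have "\<dots> = ennreal ?c * (\<integral>\<^sup>+z. ennreal (cosh (L2_norm (?S z))) \<partial>PiM I (\<lambda>_. M))"
  proof (rule nn_integral_cmult)
    note [measurable] = norm_meas[of I]
    show "(\<lambda>z. ennreal (cosh (L2_norm (?S z)))) \<in> borel_measurable (PiM I (\<lambda>_. M))"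
      unfolding cosh_def by measurable
  qed
  also have "\<dots> \<le> ennreal ?c * ennreal ?c ^ card I"
    by (intro mult_left_mono insert.IH) simp
  finally show ?case using insert.hyps by simp
qed

end

section \<open>The kernel estimator under a fixed law\<close>

lemma bandwidthsD:
  assumes "bandwidths n H"
  shows "finite H" "card H \<le> n" "H \<noteq> {}" "\<forall>h\<in>H. 1 / real n < h \<and> h \<le> 1" "2 \<le> n"
proof -
  show *: "finite H" "card H \<le> n" "\<forall>h\<in>H. 1 / real n < h \<and> h \<le> 1" "H \<noteq> {}"
    using assms by (auto simp: bandwidths_def)
  then obtain h where "h \<in> H" by auto
  then have "1 / real n < 1" using *(3) by fastforce
  moreover have "n \<noteq> 0" using assms by (auto simp: bandwidths_def)
  ultimately show "2 \<le> n" by (cases "n = 1") auto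
qed

text \<open>
  \<open>Q\<close> is the law of a pair \<open>(X, Y)\<close> and \<open>s\<close> is the product of the regression function and the density of \<open>X\<close>. The
  assumption \<open>weighted_density\<close> says that \<open>E (\<bar>Y\<bar> | X = t)\<close> times the density at \<open>t\<close> is at most \<open>D\<close>.
  The analogous bound for \<open>Y\<^sup>2\<close> would need \<open>b\<^sup>2 f\<close> to be bounded, which can fail; it is replaced by
  \<open>Y\<^sup>2 \<le> L \<bar>Y\<bar>\<close> for \<open>\<bar>Y\<bar> \<le> L\<close> with \<open>L\<close> of order \<open>log n\<close>.
\<close>

locale regression_law = prob_space Q for Q :: "(real \<times> real) measure" +
  fixes K s :: "real \<Rightarrow> real" and \<alpha> D :: real
  assumes sets_Q: "sets Q = sets (borel \<Otimes>\<^sub>M borel)"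
    and K_bi: "bounded_integrable K"
    and K_even: "\<And>x. K (- x) = K x"
    and K_integral: "(\<integral>x. K x \<partial>lborel) = 1"
    and s_bi: "bounded_integrable s"
    and \<alpha>_pos: "0 < \<alpha>"
    and exp_moment: "integrable Q (\<lambda>z. exp (\<alpha> * \<bar>snd z\<bar>))"
    and regression: "\<And>g. g \<in> borel_measurable borel \<Longrightarrow> bounded (range g) \<Longrightarrow>
        (\<integral>z. snd z * g (fst z) \<partial>Q) = (\<integral>t. s t * g t \<partial>lborel)"
    and D_nonneg: "0 \<le> D"
    and weighted_density: "\<And>g. g \<in> borel_measurable borel \<Longrightarrow> (\<And>t. 0 \<le> g t) \<Longrightarrow>
        (\<integral>\<^sup>+z. ennreal (\<bar>snd z\<bar> * g (fst z)) \<partial>Q) \<le> ennreal D * (\<integral>\<^sup>+t. ennreal (g t) \<partial>lborel)"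
    and nondegenerate: "\<not> (AE z in Q. snd z = 0)"
begin

abbreviation Kh :: "real \<Rightarrow> real \<Rightarrow> real" where "Kh \<equiv> scaled_kernel K"

definition K_L1 :: real where "K_L1 = (\<integral>x. \<bar>K x\<bar> \<partial>lborel)"
definition K_L2 :: real where "K_L2 = L2_norm K"
definition exp_mom :: real where "exp_mom = expectation (\<lambda>z. exp (\<alpha> * \<bar>snd z\<bar>))"
definition weight :: "real \<Rightarrow> real \<times> real \<Rightarrow> real \<Rightarrow> real"
  where "weight h z x = Kh h (fst z - x) * snd z"
definition smooth :: "real \<Rightarrow> real \<Rightarrow> real" where "smooth h = conv (Kh h) s"
definition dev :: "real \<Rightarrow> real \<times> real \<Rightarrow> real \<Rightarrow> real"
  where "dev h z x = weight h z x - smooth h x"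
definition bias :: "real \<Rightarrow> real \<Rightarrow> real" where "bias h x = smooth h x - s x"

lemma space_Q [simp]: "space Q = UNIV"
  using sets_eq_imp_space_eq[OF sets_Q] by (simp add: space_pair_measure)

lemma prob_UNIV [simp]: "prob UNIV = 1"
  using prob_space by simp

lemma fst_meas [measurable]: "fst \<in> measurable Q borel"
  and snd_meas [measurable]: "snd \<in> measurable Q borel"
  using measurable_fst[of borel borel] measurable_snd[of borel borel]
  by (simp_all cong: measurable_cong_sets add: sets_Q measurable_cong_sets[OF sets_Q refl])

lemma K_meas [measurable]: "K \<in> borel_measurable borel"
  by (rule bounded_integrable_measurable[OF K_bi])

lemma s_meas [measurable]: "s \<in> borel_measurable borel"
  by (rule bounded_integrable_measurable[OF s_bi])

lemma Kh_meas [measurable]: "Kh h \<in> borel_measurable borel"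
  unfolding scaled_kernel_def[abs_def] by measurable

lemma Kh_even: "Kh h (- x) = Kh h x"
  using K_even[of "x / h"] by (simp add: scaled_kernel_def)

lemma Kh_bi: "bounded_integrable (Kh h)" if "0 < h"
proof -
  obtain c where c: "\<And>x. \<bar>K x\<bar> \<le> c" using bounded_integrableE[OF K_bi] by metis
  show ?thesis
  proof (rule bounded_integrableI)
    show "integrable lborel (Kh h)"
      using lborel_integrable_real_affine[of K "1 / h" 0] K_bi that
      by (auto simp: scaled_kernel_def[abs_def] bounded_integrable_def)
    show "\<bar>Kh h x\<bar> \<le> c / h" for x
      using c[of "x / h"] that by (simp add: scaled_kernel_def abs_mult divide_right_mono)
  qed
qed

lemma Kh_abs_integral: "(\<integral>x. \<bar>Kh h x\<bar> \<partial>lborel) = K_L1" if "0 < h"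
  using lborel_integral_real_affine[of "1 / h" "\<lambda>x. \<bar>K x\<bar>" 0] that
  by (simp add: scaled_kernel_def K_L1_def abs_mult)

lemma Kh_norm: "L2_norm (Kh h) = K_L2 / sqrt h" if "0 < h"
proof -
  have "(\<integral>x. K x * K x \<partial>lborel) = (1 / h) * (\<integral>x. K (x / h) * K (x / h) \<partial>lborel)"
    using lborel_integral_real_affine[of "1 / h" "\<lambda>x. K x * K x" 0] that by simp
  then have "L2_inner (Kh h) (Kh h) = L2_inner K K / h"
    using that by (simp add: L2_inner_def scaled_kernel_def mult_ac)
  then show ?thesis by (simp add: L2_norm_def K_L2_def real_sqrt_divide)
qed

lemma K_L1_ge_1: "1 \<le> K_L1"
proof -
  have "1 = (\<integral>x. K x \<partial>lborel)" by (simp add: K_integral)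
  also have "\<dots> \<le> K_L1" unfolding K_L1_def
    using K_bi by (intro integral_mono) (auto simp: bounded_integrable_def)
  finally show ?thesis .
qed

lemma K_L2_pos: "0 < K_L2"
proof -
  have "K_L2 \<noteq> 0"
  proof
    assume "K_L2 = 0"
    then have "(\<integral>x. K x * K x \<partial>lborel) = 0"
      using L2_norm_square[of K] by (simp add: K_L2_def L2_inner_def)
    then have "AE x in lborel. K x * K x = 0"
      by (subst (asm) integral_nonneg_eq_0_iff_AE) (auto intro: bounded_integrable_mult K_bi)
    then have "AE x in lborel. K x = 0" by eventually_elim simp
    then have "(\<integral>x. K x \<partial>lborel) = 0"
      using integral_cong_AE[of K lborel "\<lambda>_. 0"] by simp
    then show False by (simp add: K_integral)
  qed
  then show ?thesis using L2_norm_nonneg[of K] by (simp add: K_L2_def)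
qed

lemma conv_Kh_meas: "0 < h \<Longrightarrow> bounded_integrable v \<Longrightarrow> conv (Kh h) v \<in> borel_measurable borel"
  by (intro bounded_integrable_measurable bounded_integrable_conv Kh_bi)

lemma smooth_bi: "0 < h \<Longrightarrow> bounded_integrable (smooth h)"
  unfolding smooth_def by (intro bounded_integrable_conv Kh_bi s_bi)

lemma bias_bi: "0 < h \<Longrightarrow> bounded_integrable (bias h)"
  unfolding bias_def[abs_def] by (intro bounded_integrable_diff smooth_bi s_bi)

lemma weight_bi: "0 < h \<Longrightarrow> bounded_integrable (weight h z)"
  unfolding weight_def[abs_def]
  using bounded_integrable_cmult[OF bounded_integrable_reflect_translate[OF Kh_bi], of h "snd z" "fst z"]
  by (simp add: mult.commute)

lemma dev_bi: "0 < h \<Longrightarrow> bounded_integrable (dev h z)"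
  unfolding dev_def[abs_def] by (intro bounded_integrable_diff smooth_bi weight_bi)

lemma L2_inner_weight: "L2_inner v (weight h z) = snd z * conv (Kh h) v (fst z)"
  unfolding L2_inner_def weight_def conv_def
  by (subst integral_mult_right_zero[symmetric]) (simp add: mult_ac)

lemma L2_inner_weight_weight: "L2_inner (weight h z) (weight k z) = (snd z)\<^sup>2 * L2_inner (Kh h) (Kh k)"
proof -
  have "L2_inner (weight h z) (weight k z)
      = (snd z)\<^sup>2 * (\<integral>x. Kh h (fst z - x) * Kh k (fst z - x) \<partial>lborel)"
    unfolding L2_inner_def weight_def
    by (subst integral_mult_right_zero[symmetric]) (simp add: mult_ac power2_eq_square)
  then show ?thesis
    using integral_reflect_translate[of "\<lambda>x. Kh h x * Kh k x" "fst z"] by (simp add: L2_inner_def)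
qed

lemma L2_norm_weight_square: "(L2_norm (weight h z))\<^sup>2 = (snd z)\<^sup>2 * K_L2\<^sup>2 / h" if "0 < h"
proof -
  have "L2_inner (Kh h) (Kh h) = K_L2\<^sup>2 / h"
    using L2_norm_square[of "Kh h"] that by (simp add: Kh_norm power_divide)
  then show ?thesis by (simp add: L2_norm_square L2_inner_weight_weight)
qed

lemma smooth_norm_le: "0 < h \<Longrightarrow> L2_norm (smooth h) \<le> K_L1 * L2_norm s"
  unfolding smooth_def using L2_norm_conv_le[OF Kh_bi s_bi, of h] by (simp add: Kh_abs_integral)

lemma snd_integrable: "integrable Q (\<lambda>z. \<bar>snd z\<bar>)"
proof (rule Bochner_Integration.integrable_bound)
  show "integrable Q (\<lambda>z. (1 / \<alpha>) * exp (\<alpha> * \<bar>snd z\<bar>))"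
    using exp_moment by simp
  show "AE z in Q. norm \<bar>snd z\<bar> \<le> norm ((1 / \<alpha>) * exp (\<alpha> * \<bar>snd z\<bar>))"
  proof (rule AE_I2)
    fix z :: "real \<times> real"
    have "\<alpha> * \<bar>snd z\<bar> \<le> exp (\<alpha> * \<bar>snd z\<bar>)"
      using exp_ge_add_one_self[of "\<alpha> * \<bar>snd z\<bar>"] by linarith
    then show "norm \<bar>snd z\<bar> \<le> norm ((1 / \<alpha>) * exp (\<alpha> * \<bar>snd z\<bar>))"
      using \<alpha>_pos by (simp add: field_simps)
  qed
qed measurable

lemma snd_mult_integrable:
  assumes [measurable]: "g \<in> borel_measurable borel" and "\<And>t. \<bar>g t\<bar> \<le> c"
  shows "integrable Q (\<lambda>z. snd z * g (fst z))"
proof (rule Bochner_Integration.integrable_bound)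
  show "integrable Q (\<lambda>z. c * \<bar>snd z\<bar>)" using snd_integrable by simp
  show "AE z in Q. norm (snd z * g (fst z)) \<le> norm (c * \<bar>snd z\<bar>)"
  proof (rule AE_I2)
    fix z :: "real \<times> real"
    have "\<bar>g (fst z)\<bar> \<le> \<bar>c\<bar>" using assms(2)[of "fst z"] by linarith
    then show "norm (snd z * g (fst z)) \<le> norm (c * \<bar>snd z\<bar>)"
      using mult_left_mono[of "\<bar>g (fst z)\<bar>" "\<bar>c\<bar>" "\<bar>snd z\<bar>"] by (simp add: abs_mult mult.commute)
  qed
qed measurable

lemma exp_mom_ge_1: "1 \<le> exp_mom"
proof -
  have "expectation (\<lambda>_. 1) \<le> exp_mom"
    unfolding exp_mom_def using exp_moment \<alpha>_pos by (intro integral_mono) auto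
  then show ?thesis by (simp add: prob_space)
qed

lemma L2_inner_dev:
  assumes "0 < h" "bounded_integrable v"
  shows "L2_inner v (dev h z) = snd z * conv (Kh h) v (fst z) - L2_inner s (conv (Kh h) v)"
proof -
  have "L2_inner v (dev h z) = L2_inner v (weight h z) - L2_inner v (smooth h)"
    unfolding dev_def[abs_def] using assms by (intro L2_inner_diff_right weight_bi smooth_bi)
  also have "L2_inner v (smooth h) = L2_inner s (conv (Kh h) v)"
    unfolding smooth_def using L2_inner_conv_self_adjoint[OF Kh_bi Kh_even assms(2) s_bi] assms(1)
    by (simp add: L2_inner_commute)
  finally show ?thesis by (simp add: L2_inner_weight)
qed

lemma dev_centered:
  assumes "0 < h" "bounded_integrable v"
  shows "has_bochner_integral Q (\<lambda>z. L2_inner v (dev h z)) 0"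
proof -
  have bi: "bounded_integrable (conv (Kh h) v)"
    using assms by (intro bounded_integrable_conv Kh_bi)
  then obtain c where c: "\<And>x. \<bar>conv (Kh h) v x\<bar> \<le> c" using bounded_integrableE by metis
  have int: "integrable Q (\<lambda>z. snd z * conv (Kh h) v (fst z))"
    using snd_mult_integrable[OF conv_Kh_meas[OF assms] c] .
  have "expectation (\<lambda>z. snd z * conv (Kh h) v (fst z)) = L2_inner s (conv (Kh h) v)"
    using regression[OF conv_Kh_meas[OF assms]] bi by (simp add: L2_inner_def bounded_integrable_def)
  then show ?thesis
    using int by (simp add: has_bochner_integral_iff L2_inner_dev[OF assms] prob_space)
qed

lemma dev_meas: "0 < h \<Longrightarrow> case_prod (dev h) \<in> borel_measurable (Q \<Otimes>\<^sub>M borel)"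
proof -
  assume "0 < h"
  then have [measurable]: "smooth h \<in> borel_measurable borel"
    using bounded_integrable_measurable smooth_bi by blast
  show ?thesis unfolding dev_def[abs_def] weight_def by measurable
qed

section \<open>Bernstein bounds for linear statistics\<close>

text \<open>
  Bernstein's bound for one summand. In \<open>exp y \<le> 1 + y + y\<^sup>2 / 2 * exp \<bar>y\<bar>\<close> with \<open>y = \<mu> Y u(X)\<close> the quadratic term is
  handled separately for \<open>\<bar>Y\<bar> \<le> L = (2 / \<alpha>) log n\<close>, where the exponential factor is bounded and
  \<open>Y\<^sup>2 \<le> L \<bar>Y\<bar>\<close>, and for larger \<open>\<bar>Y\<bar>\<close>, where the exponential moment of \<open>Y\<close> yields a factor \<open>1/n\<close>.
  The expectation of the linear term is kept exactly and cancels against the centring.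
\<close>

lemma exp_moment_one_term:
  assumes n: "2 \<le> n"
    and u: "bounded_integrable u" "\<And>x. \<bar>u x\<bar> \<le> B" "L2_norm u \<le> b"
    and lam: "0 \<le> \<mu>" "\<mu> * B * ln (real n) \<le> \<alpha> / 8" "real n * \<mu>\<^sup>2 * b\<^sup>2 \<le> 1"
  shows "(\<integral>\<^sup>+z. ennreal (exp (\<mu> * (snd z * u (fst z) - L2_inner s u))) \<partial>Q)
    \<le> ennreal (exp ((exp_mom + 2 * D / \<alpha> * ln (real n)) / real n))"
proof -
  note [measurable] = bounded_integrable_measurable[OF u(1)]
  define L where "L = 2 / \<alpha> * ln (real n)"
  have lnpos: "1 / 2 \<le> ln (real n)" by (rule ln_ge_half[OF n])
  have L: "0 < L" using lnpos \<alpha>_pos by (simp add: L_def)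
  have B: "0 \<le> B" using u(2)[of 0] by linarith
  have lamB: "\<mu> * B \<le> \<alpha> / 4"
  proof -
    have "\<mu> * B * (1 / 2) \<le> \<mu> * B * ln (real n)" using lnpos lam B by (intro mult_left_mono) auto
    then show ?thesis using lam(2) by simp
  qed
  define m where "m = L2_inner s u"
  define F where "F z = 1 + \<mu> * (snd z * u (fst z)) + \<mu>\<^sup>2 * L * (\<bar>snd z\<bar> * (u (fst z))\<^sup>2)
      + exp (\<alpha> * \<bar>snd z\<bar>) / real n" for z :: "real \<times> real"
  have pt: "exp (\<mu> * (snd z * u (fst z))) \<le> F z" for z
  proof -
    define y where "y = \<bar>snd z\<bar>"
    define v where "v = \<bar>u (fst z)\<bar>"
    have yv: "0 \<le> y" "0 \<le> v" "v \<le> B" using u(2) by (auto simp: y_def v_def)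
    have abs: "\<bar>\<mu> * (snd z * u (fst z))\<bar> = \<mu> * v * y"
      using lam by (simp add: abs_mult y_def v_def mult_ac)
    have "exp (\<mu> * (snd z * u (fst z)))
        \<le> 1 + \<mu> * (snd z * u (fst z)) + (\<mu> * v * y)\<^sup>2 / 2 * exp (\<mu> * v * y)"
      using exp_le_quadratic[of "\<mu> * (snd z * u (fst z))"] unfolding abs
      by (metis abs power2_abs)
    also have "(\<mu> * v * y)\<^sup>2 / 2 * exp (\<mu> * v * y) \<le> \<mu>\<^sup>2 * L * (y * v\<^sup>2) + exp (\<alpha> * y) / real n"
    proof (cases "y \<le> L")
      case True
      have "\<mu> * v * y \<le> \<mu> * B * L" using yv True lam B L by (intro mult_mono) auto
      also have "\<mu> * B * L = (2 / \<alpha>) * (\<mu> * B * ln (real n))" by (simp add: L_def)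
      also have "\<dots> \<le> (2 / \<alpha>) * (\<alpha> / 8)" using lam \<alpha>_pos by (intro mult_left_mono) auto
      also have "\<dots> = 1 / 4" using \<alpha>_pos by simp
      finally have "exp (\<mu> * v * y) \<le> exp (1 / 4)" by simp
      also have "exp (1 / 4 :: real) \<le> 1 + 1 / 4 + (1 / 4)\<^sup>2" by (rule exp_bound) auto
      also have "\<dots> \<le> 2" by (simp add: power2_eq_square)
      finally have "(\<mu> * v * y)\<^sup>2 / 2 * exp (\<mu> * v * y) \<le> (\<mu> * v * y)\<^sup>2 / 2 * 2"
        by (intro mult_left_mono) auto
      also have "\<dots> = \<mu>\<^sup>2 * (y * v\<^sup>2) * y" by (simp add: power2_eq_square)
      also have "\<dots> \<le> \<mu>\<^sup>2 * (y * v\<^sup>2) * L" using True yv by (intro mult_left_mono) auto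
      finally show ?thesis by (simp add: mult_ac add_increasing2)
    next
      case False
      define t where "t = \<alpha> / 4 * y"
      have t: "0 \<le> t" using \<alpha>_pos yv by (simp add: t_def)
      have "\<mu> * v \<le> \<mu> * B" using yv lam by (intro mult_left_mono)
      then have le: "\<mu> * v * y \<le> t" unfolding t_def using lamB yv by (intro mult_right_mono) auto
      have "(\<mu> * v * y)\<^sup>2 / 2 * exp (\<mu> * v * y) \<le> t\<^sup>2 / 2 * exp t"
        using le yv lam by (intro mult_mono divide_right_mono power_mono) auto
      also have "\<dots> \<le> exp t * exp t" using square_le_two_exp[OF t] by (intro mult_right_mono) auto
      also have "\<dots> = exp (\<alpha> * y) * exp (- (\<alpha> / 2 * y))" by (simp add: t_def exp_add[symmetric])
      also have "\<dots> \<le> exp (\<alpha> * y) * exp (- (\<alpha> / 2 * L))"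
        using False \<alpha>_pos by (intro mult_left_mono) auto
      also have "exp (- (\<alpha> / 2 * L)) = 1 / real n"
        using n \<alpha>_pos by (simp add: L_def exp_minus inverse_eq_divide)
      finally show ?thesis using yv L by (simp add: add_increasing)
    qed
    finally show ?thesis by (simp add: F_def y_def v_def)
  qed
  have yu2: "integrable Q (\<lambda>z. \<bar>snd z\<bar> * (u (fst z))\<^sup>2) \<and> expectation (\<lambda>z. \<bar>snd z\<bar> * (u (fst z))\<^sup>2) \<le> D * b\<^sup>2"
  proof -
    have "(\<integral>\<^sup>+z. ennreal (\<bar>snd z\<bar> * (u (fst z))\<^sup>2) \<partial>Q) \<le> ennreal D * (\<integral>\<^sup>+t. ennreal ((u t)\<^sup>2) \<partial>lborel)"
      by (rule weighted_density) auto
    also have "(\<integral>\<^sup>+t. ennreal ((u t)\<^sup>2) \<partial>lborel) = ennreal ((L2_norm u)\<^sup>2)"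
      unfolding L2_norm_square L2_inner_def using bounded_integrable_mult[OF u(1) u(1)]
      by (simp add: nn_integral_eq_integral power2_eq_square)
    also have "\<dots> \<le> ennreal (b\<^sup>2)"
      using u(3) L2_norm_nonneg by (intro ennreal_leI power_mono)
    finally have le: "(\<integral>\<^sup>+z. ennreal (\<bar>snd z\<bar> * (u (fst z))\<^sup>2) \<partial>Q) \<le> ennreal (D * b\<^sup>2)"
      using D_nonneg by (simp add: ennreal_mult mult_left_mono)
    have "integrable Q (\<lambda>z. \<bar>snd z\<bar> * (u (fst z))\<^sup>2)"
      using le by (intro integrableI_bounded) (auto simp: top_unique less_top[symmetric])
    moreover from this have "expectation (\<lambda>z. \<bar>snd z\<bar> * (u (fst z))\<^sup>2) \<le> D * b\<^sup>2"
      using le D_nonneg by (simp add: nn_integral_eq_integral)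
    ultimately show ?thesis by simp
  qed
  have yu: "integrable Q (\<lambda>z. snd z * u (fst z))" "expectation (\<lambda>z. snd z * u (fst z)) = m"
    using snd_mult_integrable[OF bounded_integrable_measurable[OF u(1)] u(2)]
      regression[OF bounded_integrable_measurable[OF u(1)]] u(1)
    by (auto simp: m_def L2_inner_def bounded_integrable_def)
  have Fint: "integrable Q F"
    unfolding F_def using yu yu2 exp_moment by simp
  have "expectation F = 1 + \<mu> * m + \<mu>\<^sup>2 * L * expectation (\<lambda>z. \<bar>snd z\<bar> * (u (fst z))\<^sup>2) + exp_mom / real n"
    unfolding F_def using yu yu2 exp_moment by (simp add: exp_mom_def)
  also have "\<dots> \<le> 1 + \<mu> * m + \<mu>\<^sup>2 * L * (D * b\<^sup>2) + exp_mom / real n"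
    using mult_left_mono[OF conjunct2[OF yu2], of "\<mu>\<^sup>2 * L"] L by simp
  also have "\<mu>\<^sup>2 * L * (D * b\<^sup>2) \<le> L * D / real n"
  proof -
    have "\<mu>\<^sup>2 * b\<^sup>2 \<le> 1 / real n" using lam(3) n by (simp add: field_simps)
    then have "(L * D) * (\<mu>\<^sup>2 * b\<^sup>2) \<le> (L * D) * (1 / real n)"
      using L D_nonneg by (intro mult_left_mono) auto
    then show ?thesis by (simp add: mult_ac)
  qed
  also have "1 + \<mu> * m + L * D / real n + exp_mom / real n = 1 + (\<mu> * m + (exp_mom + 2 * D / \<alpha> * ln (real n)) / real n)"
    by (simp add: L_def add_divide_distrib)
  also have "\<dots> \<le> exp (\<mu> * m + (exp_mom + 2 * D / \<alpha> * ln (real n)) / real n)"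
    by (rule exp_ge_add_one_self)
  finally have EF: "expectation F \<le> exp (\<mu> * m) * exp ((exp_mom + 2 * D / \<alpha> * ln (real n)) / real n)"
    by (simp add: exp_add)
  have "(\<integral>\<^sup>+z. ennreal (exp (\<mu> * (snd z * u (fst z) - m))) \<partial>Q)
      \<le> (\<integral>\<^sup>+z. ennreal (exp (- (\<mu> * m)) * F z) \<partial>Q)"
  proof (intro nn_integral_mono ennreal_leI)
    fix z
    have "exp (\<mu> * (snd z * u (fst z) - m)) = exp (- (\<mu> * m)) * exp (\<mu> * (snd z * u (fst z)))"
      by (simp add: exp_add[symmetric] algebra_simps)
    then show "exp (\<mu> * (snd z * u (fst z) - m)) \<le> exp (- (\<mu> * m)) * F z"
      using pt[of z] by simp
  qed
  also have "\<dots> = ennreal (exp (- (\<mu> * m)) * expectation F)"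
  proof -
    have "0 \<le> F z" for z using pt[of z] exp_ge_zero order_trans by blast
    then show ?thesis using Fint by (subst nn_integral_eq_integral) auto
  qed
  also have "\<dots> \<le> ennreal (exp ((exp_mom + 2 * D / \<alpha> * ln (real n)) / real n))"
  proof (rule ennreal_leI)
    have "exp (- (\<mu> * m)) * expectation F
        \<le> exp (- (\<mu> * m)) * (exp (\<mu> * m) * exp ((exp_mom + 2 * D / \<alpha> * ln (real n)) / real n))"
      using EF by (intro mult_left_mono) auto
    also have "\<dots> = exp ((exp_mom + 2 * D / \<alpha> * ln (real n)) / real n)"
      unfolding mult.assoc[symmetric] exp_add[symmetric] by simp
    finally show "exp (- (\<mu> * m)) * expectation F \<le> exp ((exp_mom + 2 * D / \<alpha> * ln (real n)) / real n)" .
  qed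
  finally show ?thesis by (simp add: m_def)
qed

text \<open>
  Independence gives one factor for each term; the absolute value costs a factor two, since \<open>u\<close> and \<open>- u\<close> satisfy the
  same assumptions.
\<close>

lemma exp_moment_linear_statistic:
  assumes n: "2 \<le> n" and J: "finite J" "card J \<le> n"
    and u: "bounded_integrable u" "\<And>x. \<bar>u x\<bar> \<le> B" "L2_norm u \<le> b"
    and lam: "0 \<le> \<mu>" "\<mu> * B * ln (real n) \<le> \<alpha> / 8" "real n * \<mu>\<^sup>2 * b\<^sup>2 \<le> 1"
  shows "(\<integral>\<^sup>+z. ennreal (exp (\<mu> * \<bar>\<Sum>j\<in>J. snd (z j) * u (fst (z j)) - L2_inner s u\<bar>)) \<partial>PiM J (\<lambda>_. Q))
    \<le> ennreal (2 * exp (exp_mom + 2 * D / \<alpha> * ln (real n)))"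
proof -
  let ?e = "exp_mom + 2 * D / \<alpha> * ln (real n)"
  have e: "0 \<le> ?e" using exp_mom_ge_1 D_nonneg \<alpha>_pos ln_ge_half[OF n] by simp
  have one: "(\<integral>\<^sup>+z. ennreal (exp (\<Sum>j\<in>J. \<mu> * (snd (z j) * v (fst (z j)) - L2_inner s v))) \<partial>PiM J (\<lambda>_. Q))
      \<le> ennreal (exp ?e)"
    if v: "bounded_integrable v" "\<And>x. \<bar>v x\<bar> \<le> B" "L2_norm v \<le> b" for v
  proof -
    note [measurable] = bounded_integrable_measurable[OF v(1)]
    have "(\<integral>\<^sup>+z. ennreal (exp (\<Sum>j\<in>J. \<mu> * (snd (z j) * v (fst (z j)) - L2_inner s v))) \<partial>PiM J (\<lambda>_. Q))
        = (\<integral>\<^sup>+y. ennreal (exp (\<mu> * (snd y * v (fst y) - L2_inner s v))) \<partial>Q) ^ card J"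
      by (rule nn_integral_exp_sum_iid[OF J(1)]) measurable
    also have "\<dots> \<le> ennreal (exp (?e / real n)) ^ card J"
      by (intro power_mono exp_moment_one_term[OF n v lam]) simp
    also have "\<dots> = ennreal (exp (real (card J) * (?e / real n)))"
      unfolding exp_of_nat_mult by (simp add: ennreal_power)
    also have "\<dots> \<le> ennreal (exp ?e)"
    proof -
      have "real (card J) * (?e / real n) \<le> real n * (?e / real n)"
        using J e n by (intro mult_right_mono) auto
      then show ?thesis using n by (simp add: ennreal_leI)
    qed
    finally show ?thesis .
  qed
  let ?S = "\<lambda>z. \<Sum>j\<in>J. snd (z j) * u (fst (z j)) - L2_inner s u"
  note [measurable] = bounded_integrable_measurable[OF u(1)]
  have comp: "(\<lambda>z. snd (z j) * u (fst (z j)) - L2_inner s u) \<in> borel_measurable (PiM J (\<lambda>_. Q))" if "j \<in> J" for j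
  proof -
    have [measurable]: "(\<lambda>z. z j) \<in> measurable (PiM J (\<lambda>_. Q)) Q" using that by auto
    show ?thesis by measurable
  qed
  have [measurable]: "?S \<in> borel_measurable (PiM J (\<lambda>_. Q))"
    by (intro borel_measurable_sum comp)
  have neg: "L2_inner s (\<lambda>x. - u x) = - L2_inner s u"
    using L2_inner_cmult_right[of s "-1" u] by simp
  have "(\<integral>\<^sup>+z. ennreal (exp (\<mu> * \<bar>?S z\<bar>)) \<partial>PiM J (\<lambda>_. Q))
      \<le> (\<integral>\<^sup>+z. ennreal (exp (\<mu> * ?S z)) + ennreal (exp (\<mu> * - ?S z)) \<partial>PiM J (\<lambda>_. Q))"
    by (intro nn_integral_mono) (auto simp: ennreal_plus[symmetric] abs_if simp del: ennreal_plus intro!: ennreal_leI)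
  also have "\<dots> = (\<integral>\<^sup>+z. ennreal (exp (\<mu> * ?S z)) \<partial>PiM J (\<lambda>_. Q)) + (\<integral>\<^sup>+z. ennreal (exp (\<mu> * - ?S z)) \<partial>PiM J (\<lambda>_. Q))"
    by (rule nn_integral_add) measurable
  also have "\<dots> \<le> ennreal (exp ?e) + ennreal (exp ?e)"
  proof (rule add_mono)
    show "(\<integral>\<^sup>+z. ennreal (exp (\<mu> * ?S z)) \<partial>PiM J (\<lambda>_. Q)) \<le> ennreal (exp ?e)"
      using one[OF u] by (simp add: sum_distrib_left)
    have v: "bounded_integrable (\<lambda>x. - u x)" "\<And>x. \<bar>- u x\<bar> \<le> B" "L2_norm (\<lambda>x. - u x) \<le> b"
      using bounded_integrable_cmult[OF u(1), of "-1"] u(2,3) by (auto simp: L2_norm_def L2_inner_def)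
    have "\<mu> * - ?S z = (\<Sum>j\<in>J. \<mu> * (snd (z j) * - u (fst (z j)) - L2_inner s (\<lambda>x. - u x)))" for z
      unfolding neg sum_distrib_left sum_negf[symmetric] by (intro sum.cong) (auto simp: algebra_simps)
    then show "(\<integral>\<^sup>+z. ennreal (exp (\<mu> * - ?S z)) \<partial>PiM J (\<lambda>_. Q)) \<le> ennreal (exp ?e)"
      using one[OF v] by simp
  qed
  also have "\<dots> = ennreal (2 * exp ?e)"
    by (simp add: ennreal_plus[symmetric] del: ennreal_plus)
  finally show ?thesis .
qed

section \<open>Sums in the Hilbert space\<close>

definition dev_const :: real where "dev_const = 2 * (K_L2 + K_L1 * L2_norm s)"

lemma dev_const_pos: "0 < dev_const"
  using K_L2_pos K_L1_ge_1 L2_norm_nonneg[of s] by (simp add: dev_const_def add_pos_nonneg)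

lemma dev_norm_le:
  assumes h: "0 < h" "h \<le> 1"
  shows "L2_norm (dev h z) \<le> dev_const * (\<bar>snd z\<bar> + 1) / sqrt h"
proof (rule power2_le_imp_le)
  let ?b = "K_L1 * L2_norm s"
  have b: "0 \<le> ?b" using K_L1_ge_1 L2_norm_nonneg[of s] by simp
  have "(L2_norm (dev h z))\<^sup>2 \<le> 2 * (L2_norm (weight h z))\<^sup>2 + 2 * (L2_norm (smooth h))\<^sup>2"
    unfolding dev_def[abs_def] using h by (intro L2_norm_square_diff_le weight_bi smooth_bi)
  also have "\<dots> \<le> 2 * ((snd z)\<^sup>2 * K_L2\<^sup>2 / h) + 2 * (?b\<^sup>2 / h)"
  proof -
    have "(L2_norm (smooth h))\<^sup>2 \<le> ?b\<^sup>2"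
      using smooth_norm_le[OF h(1)] L2_norm_nonneg by (intro power_mono)
    also have "\<dots> \<le> ?b\<^sup>2 / h" using h by (simp add: le_divide_eq mult_left_le)
    finally show ?thesis using L2_norm_weight_square[OF h(1), of z] by simp
  qed
  also have "\<dots> = 2 * ((\<bar>snd z\<bar> * K_L2)\<^sup>2 + ?b\<^sup>2) / h"
    by (simp add: power_mult_distrib add_divide_distrib)
  also have "\<dots> \<le> 4 * (\<bar>snd z\<bar> * K_L2 + ?b)\<^sup>2 / h"
  proof -
    have "0 \<le> \<bar>snd z\<bar> * K_L2 * ?b" using K_L2_pos b by simp
    then have "2 * ((\<bar>snd z\<bar> * K_L2)\<^sup>2 + ?b\<^sup>2) \<le> 4 * (\<bar>snd z\<bar> * K_L2 + ?b)\<^sup>2"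
      unfolding power2_sum by simp
    then show ?thesis using h by (simp add: divide_right_mono)
  qed
  also have "\<dots> \<le> 4 * ((K_L2 + ?b) * (\<bar>snd z\<bar> + 1))\<^sup>2 / h"
  proof -
    have "\<bar>snd z\<bar> * K_L2 + ?b \<le> (K_L2 + ?b) * (\<bar>snd z\<bar> + 1)"
      using K_L2_pos mult_nonneg_nonneg[OF b abs_ge_zero[of "snd z"]] unfolding distrib_left distrib_right by simp
    then show ?thesis using h K_L2_pos b by (intro divide_right_mono mult_left_mono power_mono) auto
  qed
  also have "\<dots> = (dev_const * (\<bar>snd z\<bar> + 1) / sqrt h)\<^sup>2"
    unfolding dev_const_def power_mult_distrib power_divide using h by simp
  finally show "(L2_norm (dev h z))\<^sup>2 \<le> (dev_const * (\<bar>snd z\<bar> + 1) / sqrt h)\<^sup>2" .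
  show "0 \<le> dev_const * (\<bar>snd z\<bar> + 1) / sqrt h" using dev_const_pos h by simp
qed

text \<open>
  The scale is that of the typical size \<open>sqrt (n / h)\<close> of the norm, enlarged by \<open>sqrt (log n)\<close>. The factor \<open>log n\<close> under the root
  is what keeps the final rate at \<open>log(n)^5\<close>: a scale without it would only give a bound with an additional logarithm.
\<close>

lemma exp_moment_dev_sum:
  assumes n: "2 \<le> n" and h: "0 < h" "h \<le> 1" and I: "finite I" "card I \<le> n"
  shows "(\<integral>\<^sup>+z. ennreal (exp (\<alpha> / (4 * dev_const) * sqrt (h * ln (real n) / real n)
        * L2_norm (\<lambda>x. \<Sum>i\<in>I. dev h (z i) x))) \<partial>PiM I (\<lambda>_. Q))
    \<le> ennreal (2 * exp (exp \<alpha> * exp_mom * ln (real n)))"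
proof -
  \<comment> \<open>one factor of the product exceeds \<open>1\<close> by at most a constant multiple of \<open>q\<close>\<close>
  define q where "q = ln (real n) / real n"
  have ln_le: "ln (real n) \<le> real n" using n ln_le_minus_one[of "real n"] by linarith
  have q: "0 \<le> q" "q \<le> 1"
    using n ln_ge_half[OF n] ln_le by (auto simp: q_def)
  define \<mu> where "\<mu> = \<alpha> / (4 * dev_const) * sqrt (h * q)"
  have mu: "0 \<le> \<mu>" using \<alpha>_pos dev_const_pos h q by (simp add: \<mu>_def)
  define V where "V z x = \<mu> * dev h z x" for z x
  define W where "W z = exp (L2_norm (V z)) - L2_norm (V z)" for z
  note [measurable] = dev_meas[OF h(1)]
  have Vm: "case_prod V \<in> borel_measurable (Q \<Otimes>\<^sub>M borel)"
    unfolding V_def[abs_def] by measurable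
  note [measurable] = L2_norm_measurable[OF Vm]
  have Vn: "L2_norm (V z) = \<mu> * L2_norm (dev h z)" for z
    unfolding V_def[abs_def] L2_norm_cmult using mu by simp
  have W_le: "W z \<le> 1 + q * exp \<alpha> * exp (\<alpha> * \<bar>snd z\<bar>)" for z
  proof -
    define v where "v = L2_norm (V z)"
    define t where "t = \<alpha> / 4 * (\<bar>snd z\<bar> + 1)"
    have v0: "0 \<le> v" by (simp add: v_def L2_norm_nonneg)
    have t0: "0 \<le> t" using \<alpha>_pos by (simp add: t_def)
    have "v \<le> \<mu> * (dev_const * (\<bar>snd z\<bar> + 1) / sqrt h)"
      unfolding v_def Vn using mu by (intro mult_left_mono dev_norm_le h)
    also have "\<dots> = sqrt q * t"
      using h dev_const_pos by (simp add: \<mu>_def t_def real_sqrt_mult field_simps)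
    finally have vt: "v \<le> sqrt q * t" .
    also have "\<dots> \<le> t" using q t0 by (simp add: mult_left_le_one_le)
    finally have vt': "v \<le> t" .
    have "v\<^sup>2 \<le> (sqrt q * t)\<^sup>2" using vt v0 by (intro power_mono)
    then have v2: "v\<^sup>2 \<le> q * t\<^sup>2" using q by (simp add: power_mult_distrib)
    have "exp v - v \<le> 1 + v\<^sup>2 / 2 * exp v"
      using exp_le_quadratic[of v] v0 by simp
    also have "v\<^sup>2 / 2 * exp v \<le> (q * t\<^sup>2) / 2 * exp t"
      using v2 vt' q by (intro mult_mono divide_right_mono) auto
    also have "\<dots> \<le> q * exp t * exp t"
      using mult_right_mono[OF mult_left_mono[OF square_le_two_exp[OF t0] q(1)], of "exp t"] by simp
    also have "\<dots> = q * exp (\<alpha> / 2 * (\<bar>snd z\<bar> + 1))"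
      by (simp add: t_def mult.assoc exp_add[symmetric])
    also have "\<dots> \<le> q * exp (\<alpha> + \<alpha> * \<bar>snd z\<bar>)"
    proof -
      have "0 \<le> \<alpha> * \<bar>snd z\<bar>" using \<alpha>_pos by (intro mult_nonneg_nonneg) auto
      then have "\<alpha> / 2 * (\<bar>snd z\<bar> + 1) \<le> \<alpha> + \<alpha> * \<bar>snd z\<bar>"
        using \<alpha>_pos unfolding distrib_left times_divide_eq_left by linarith
      then show ?thesis using q by (simp add: mult_left_mono)
    qed
    finally show ?thesis by (simp add: W_def v_def exp_add mult.assoc)
  qed
  have W_ge: "0 \<le> W z" for z
    using exp_ge_add_one_self[of "L2_norm (V z)"] unfolding W_def by linarith
  have Wint: "integrable Q W"
  proof (rule Bochner_Integration.integrable_bound)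
    show "integrable Q (\<lambda>z. 1 + q * exp \<alpha> * exp (\<alpha> * \<bar>snd z\<bar>))"
      using exp_moment by simp
    show "W \<in> borel_measurable Q" unfolding W_def[abs_def] by measurable
    show "AE z in Q. norm (W z) \<le> norm (1 + q * exp \<alpha> * exp (\<alpha> * \<bar>snd z\<bar>))"
      using W_le W_ge q by (intro AE_I2) (simp add: order_trans[OF W_ge W_le])
  qed
  have EW: "expectation W \<le> exp (q * (exp \<alpha> * exp_mom))"
  proof -
    have "expectation W \<le> expectation (\<lambda>z. 1 + q * exp \<alpha> * exp (\<alpha> * \<bar>snd z\<bar>))"
      using Wint exp_moment W_le by (intro integral_mono) auto
    also have "\<dots> = 1 + q * (exp \<alpha> * exp_mom)"
      using exp_moment by (simp add: exp_mom_def)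
    also have "\<dots> \<le> exp (q * (exp \<alpha> * exp_mom))" by (rule exp_ge_add_one_self)
    finally show ?thesis .
  qed
  let ?N = "\<lambda>z. L2_norm (\<lambda>x. \<Sum>i\<in>I. V (z i) x)"
  have "(\<lambda>x. \<Sum>i\<in>I. V (z i) x) = (\<lambda>x. \<mu> * (\<Sum>i\<in>I. dev h (z i) x))" for z
    by (simp add: V_def sum_distrib_left)
  then have Neq: "?N z = \<mu> * L2_norm (\<lambda>x. \<Sum>i\<in>I. dev h (z i) x)" for z
    using mu by (simp add: L2_norm_cmult)
  have "(\<integral>\<^sup>+z. ennreal (exp (?N z)) \<partial>PiM I (\<lambda>_. Q)) \<le> (\<integral>\<^sup>+z. 2 * ennreal (cosh (?N z)) \<partial>PiM I (\<lambda>_. Q))"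
  proof (intro nn_integral_mono)
    fix z
    have "exp (?N z) \<le> 2 * cosh (?N z)" unfolding cosh_def by simp
    then have "ennreal (exp (?N z)) \<le> ennreal (2 * cosh (?N z))" by (rule ennreal_leI)
    then show "ennreal (exp (?N z)) \<le> 2 * ennreal (cosh (?N z))" by (simp add: ennreal_mult)
  qed
  also have "\<dots> = 2 * (\<integral>\<^sup>+z. ennreal (cosh (?N z)) \<partial>PiM I (\<lambda>_. Q))"
  proof (rule nn_integral_cmult)
    note [measurable] = L2_norm_measurable[OF sum_components_measurable[OF Vm subset_refl[of I]]]
    show "(\<lambda>z. ennreal (cosh (?N z))) \<in> borel_measurable (PiM I (\<lambda>_. Q))"
      unfolding cosh_def by measurable
  qed
  also have "\<dots> \<le> 2 * ennreal (expectation W) ^ card I"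
  proof (rule mult_left_mono)
    show "(\<integral>\<^sup>+z. ennreal (cosh (?N z)) \<partial>PiM I (\<lambda>_. Q)) \<le> ennreal (expectation W) ^ card I"
      unfolding W_def
    proof (rule nn_integral_cosh_L2_norm_sum[OF Vm _ _ _ I(1)])
      show "bounded_integrable (V z)" for z
        unfolding V_def[abs_def] using h by (intro bounded_integrable_cmult dev_bi)
      show "has_bochner_integral Q (\<lambda>z. L2_inner v (V z)) 0" if "bounded_integrable v" for v
        unfolding V_def[abs_def] L2_inner_cmult_right
        using has_bochner_integral_mult_right[OF dev_centered[OF h(1) that], of \<mu>] by simp
      show "integrable Q (\<lambda>z. exp (L2_norm (V z)) - L2_norm (V z))"
        using Wint by (simp add: W_def[abs_def])
    qed
  qed simp
  also have "\<dots> \<le> 2 * ennreal (exp (q * (exp \<alpha> * exp_mom))) ^ card I"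
    using EW by (intro mult_left_mono power_mono ennreal_leI) auto
  also have "\<dots> = ennreal (2 * exp (real (card I) * (q * (exp \<alpha> * exp_mom))))"
    unfolding exp_of_nat_mult by (simp add: ennreal_power ennreal_mult)
  also have "\<dots> \<le> ennreal (2 * exp (exp \<alpha> * exp_mom * ln (real n)))"
  proof -
    have "real (card I) * (q * (exp \<alpha> * exp_mom)) \<le> real n * (q * (exp \<alpha> * exp_mom))"
      using I q exp_mom_ge_1 by (intro mult_right_mono) auto
    also have "\<dots> = exp \<alpha> * exp_mom * ln (real n)" using n by (simp add: q_def)
    finally show ?thesis by (intro ennreal_leI) simp
  qed
  finally show ?thesis by (simp add: Neq \<mu>_def q_def)
qed

definition s_sup :: real where "s_sup = (SUP x. \<bar>s x\<bar>)"

lemma s_le_sup: "\<bar>s x\<bar> \<le> s_sup"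
proof -
  obtain c where "\<And>x. \<bar>s x\<bar> \<le> c" using bounded_integrableE[OF s_bi] by metis
  then have "bdd_above (range (\<lambda>x. \<bar>s x\<bar>))" by (auto simp: bdd_above_def)
  then show ?thesis unfolding s_sup_def by (intro cSUP_upper) auto
qed

lemma s_sup_nonneg: "0 \<le> s_sup" using s_le_sup[of 0] by linarith

lemma smooth_le: "0 < h \<Longrightarrow> \<bar>smooth h x\<bar> \<le> K_L1 * s_sup"
  unfolding smooth_def using conv_le_bound[OF Kh_bi s_bi s_le_sup] by (simp add: Kh_abs_integral)

lemma bias_le: "0 < h \<Longrightarrow> \<bar>bias h x\<bar> \<le> (K_L1 + 1) * s_sup"
  unfolding bias_def using smooth_le[of h x] s_le_sup[of x] by (simp add: algebra_simps)

definition devsum :: "real \<Rightarrow> nat set \<Rightarrow> (nat \<Rightarrow> real \<times> real) \<Rightarrow> real \<Rightarrow> real"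
  where "devsum h I z x = (\<Sum>i\<in>I. dev h (z i) x)"

lemma devsum_bi: "0 < h \<Longrightarrow> bounded_integrable (devsum h I z)"
  unfolding devsum_def[abs_def] by (intro bounded_integrable_sum dev_bi)

lemma devsum_meas: "0 < h \<Longrightarrow> I \<subseteq> N \<Longrightarrow> case_prod (devsum h I) \<in> borel_measurable (PiM N (\<lambda>_. Q) \<Otimes>\<^sub>M borel)"
  unfolding devsum_def[abs_def] using sum_components_measurable[OF dev_meas] by blast

lemma devsum_norm_meas: "0 < h \<Longrightarrow> I \<subseteq> N \<Longrightarrow> (\<lambda>z. L2_norm (devsum h I z)) \<in> borel_measurable (PiM N (\<lambda>_. Q))"
  by (intro L2_norm_measurable devsum_meas)

lemma devsum_merge1: "devsum h I (merge I J (x, y)) = devsum h I x"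
  unfolding devsum_def[abs_def] by (intro ext sum.cong) (auto simp: merge_def)

lemma devsum_merge2: "I \<inter> J = {} \<Longrightarrow> devsum h J (merge I J (x, y)) = devsum h J y"
  unfolding devsum_def[abs_def] by (intro ext sum.cong) (auto simp: merge_def)

lemma L2_inner_devsum:
  assumes "0 < h" "bounded_integrable v"
  shows "L2_inner v (devsum h J z)
    = (\<Sum>j\<in>J. snd (z j) * conv (Kh h) v (fst (z j)) - L2_inner s (conv (Kh h) v))"
  unfolding devsum_def[abs_def] using assms
  by (simp add: L2_inner_sum_right dev_bi L2_inner_dev)

lemma nn_integral_split:
  assumes N: "finite N" "I \<subseteq> N" and f: "f \<in> borel_measurable (PiM N (\<lambda>_. Q))"
  shows "(\<integral>\<^sup>+z. f z \<partial>PiM N (\<lambda>_. Q))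
    = (\<integral>\<^sup>+x. \<integral>\<^sup>+y. f (merge I (N - I) (x, y)) \<partial>PiM (N - I) (\<lambda>_. Q) \<partial>PiM I (\<lambda>_. Q))"
proof -
  interpret product_sigma_finite "\<lambda>_. Q" by (rule product_sigma_finite_iid)
  have eq: "I \<union> (N - I) = N" using N by auto
  have "finite I" "finite (N - I)" "I \<inter> (N - I) = {}" using N finite_subset by auto
  from product_nn_integral_fold[OF this(3,1,2), of f] show ?thesis using f unfolding eq by blast
qed

text \<open>
  Small enough for both hypotheses of \<open>exp_moment_linear_statistic\<close> with \<open>u\<close> the convolution of \<open>K_k\<close> and \<open>A\<close>: its
  supremum is at most \<open>K_L2 * ||A|| / sqrt k\<close> and its norm at most \<open>K_L1 * ||A||\<close>.
\<close>

definition cross_scale :: real where "cross_scale = min (\<alpha> / (8 * K_L2)) (1 / (2 * K_L1))"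

lemma cross_scale_bounds: "0 < cross_scale" "cross_scale * K_L2 \<le> \<alpha> / 8" "cross_scale * K_L1 \<le> 1 / 2"
proof -
  show "0 < cross_scale" using \<alpha>_pos K_L2_pos K_L1_ge_1 by (simp add: cross_scale_def)
  have "cross_scale * K_L2 \<le> \<alpha> / (8 * K_L2) * K_L2" using K_L2_pos by (intro mult_right_mono) (auto simp: cross_scale_def)
  then show "cross_scale * K_L2 \<le> \<alpha> / 8" using K_L2_pos by simp
  have "cross_scale * K_L1 \<le> 1 / (2 * K_L1) * K_L1" using K_L1_ge_1 by (intro mult_right_mono) (auto simp: cross_scale_def)
  then show "cross_scale * K_L1 \<le> 1 / 2" using K_L1_ge_1 by simp
qed

lemma exp_moment_devsum:
  assumes n: "2 \<le> n" and h: "0 < h" "h \<le> 1" and N: "finite N" "card N \<le> n" "I \<subseteq> N"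
  shows "(\<integral>\<^sup>+z. ennreal (exp (\<alpha> / (4 * dev_const) * sqrt (h * ln (real n) / real n)
        * L2_norm (devsum h I z))) \<partial>PiM N (\<lambda>_. Q))
    \<le> ennreal (2 * exp (exp \<alpha> * exp_mom * ln (real n)))"
proof -
  interpret P: prob_space "PiM (N - I) (\<lambda>_. Q)" by (intro prob_space_PiM prob_space_axioms)
  have I: "finite I" "card I \<le> n" using N finite_subset card_mono[of N I] by auto
  note [measurable] = devsum_norm_meas[OF h(1) N(3)]
  have "(\<integral>\<^sup>+z. ennreal (exp (\<alpha> / (4 * dev_const) * sqrt (h * ln (real n) / real n)
        * L2_norm (devsum h I z))) \<partial>PiM N (\<lambda>_. Q))
    = (\<integral>\<^sup>+z. ennreal (exp (\<alpha> / (4 * dev_const) * sqrt (h * ln (real n) / real n)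
        * L2_norm (devsum h I z))) \<partial>PiM I (\<lambda>_. Q))"
    by (subst nn_integral_split[OF N(1,3)]) (simp_all add: devsum_merge1 P.emeasure_space_1)
  then show ?thesis
    using exp_moment_dev_sum[OF n h I] by (simp only: devsum_def[abs_def])
qed

text \<open>
  Given the observations in \<open>I\<close>, the function \<open>A\<close> is fixed and \<open><A, B>\<close> is a linear statistic of the others, with
  \<open>u = K_k * A\<close>. Its supremum is at most \<open>K_L2 ||A|| / sqrt k\<close>, hence at most \<open>K_L2 sqrt n ||A||\<close> because
  \<open>1 / k \<le> n\<close>. If \<open>A = 0\<close> then the quotient is \<open>0\<close> and there is nothing to show.
\<close>

lemma exp_moment_cross:
  assumes n: "2 \<le> n" and h: "0 < h" and k: "1 / real n < k"
    and N: "finite N" "card N \<le> n" "I \<subseteq> N"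
  shows "(\<integral>\<^sup>+z. ennreal (exp (cross_scale / (ln (real n) * sqrt (real n) * L2_norm (devsum h I z))
        * \<bar>L2_inner (devsum h I z) (devsum k (N - I) z)\<bar>)) \<partial>PiM N (\<lambda>_. Q))
    \<le> ennreal (2 * exp (exp_mom + 2 * D / \<alpha> * ln (real n)))"
proof -
  have k0: "0 < k" using n less_trans[OF _ k, of 0] by simp
  have ln: "1 / 2 \<le> ln (real n)" by (rule ln_ge_half[OF n])
  have J: "finite (N - I)" "card (N - I) \<le> n"
    using N card_mono[of N "N - I"] by auto
  interpret P: prob_space "PiM I (\<lambda>_. Q)" by (intro prob_space_PiM prob_space_axioms)
  note [measurable] = devsum_norm_meas[OF h N(3)]
    L2_inner_measurable[OF devsum_meas[OF h N(3)] devsum_meas[OF k0 Diff_subset]]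
  let ?b = "ennreal (2 * exp (exp_mom + 2 * D / \<alpha> * ln (real n)))"
  have inner: "(\<integral>\<^sup>+y. ennreal (exp (cross_scale / (ln (real n) * sqrt (real n) * L2_norm (devsum h I x))
        * \<bar>L2_inner (devsum h I x) (devsum k (N - I) y)\<bar>)) \<partial>PiM (N - I) (\<lambda>_. Q)) \<le> ?b" for x
  proof -
    define A where "A = devsum h I x"
    define u where "u = conv (Kh k) A"
    define \<mu> where "\<mu> = cross_scale / (ln (real n) * sqrt (real n) * L2_norm A)"
    have A: "bounded_integrable A" unfolding A_def by (rule devsum_bi[OF h])
    have u: "bounded_integrable u" "L2_norm u \<le> K_L1 * L2_norm A"
      using bounded_integrable_conv[OF Kh_bi[OF k0] A] L2_norm_conv_le[OF Kh_bi[OF k0] A] k0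
      by (auto simp: u_def Kh_abs_integral)
    have ub: "\<bar>u x\<bar> \<le> K_L2 / sqrt k * L2_norm A" for x
      using conv_le_L2[OF Kh_bi[OF k0] A] k0 by (simp add: u_def Kh_norm)
    have mu: "0 \<le> \<mu>" using cross_scale_bounds(1) ln L2_norm_nonneg[of A] by (simp add: \<mu>_def)
    have mu1: "\<mu> * (K_L2 / sqrt k * L2_norm A) * ln (real n) \<le> \<alpha> / 8"
    proof (cases "L2_norm A = 0")
      case False
      have "\<mu> * (K_L2 / sqrt k * L2_norm A) * ln (real n) = cross_scale * K_L2 / sqrt (real n * k)"
        using False ln n by (simp add: \<mu>_def real_sqrt_mult)
      also have "\<dots> \<le> cross_scale * K_L2"
      proof -
        have "1 \<le> real n * k" using k n by (simp add: divide_less_eq mult.commute)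
        then have "1 \<le> sqrt (real n * k)" by simp
        moreover have "0 \<le> cross_scale * K_L2" using cross_scale_bounds(1) K_L2_pos by simp
        ultimately show ?thesis using mult_left_mono[of 1 "sqrt (real n * k)" "cross_scale * K_L2"] by (simp add: divide_le_eq)
      qed
      finally show ?thesis using cross_scale_bounds(2) by (rule order_trans)
    qed (use \<alpha>_pos in \<open>simp add: \<mu>_def\<close>)
    have mu2: "real n * \<mu>\<^sup>2 * (K_L1 * L2_norm A)\<^sup>2 \<le> 1"
    proof (cases "L2_norm A = 0")
      case False
      have "real n * \<mu>\<^sup>2 * (K_L1 * L2_norm A)\<^sup>2 = (cross_scale * K_L1 / ln (real n))\<^sup>2"
        using False n by (simp add: \<mu>_def power_mult_distrib power_divide)
      also have "\<dots> \<le> 1\<^sup>2"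
        using cross_scale_bounds(1,3) K_L1_ge_1 ln by (intro power_mono) (auto simp: divide_le_eq)
      finally show ?thesis by simp
    qed simp
    show ?thesis
      using exp_moment_linear_statistic[OF n J u(1) ub u(2) mu mu1 mu2]
      by (simp add: A_def[symmetric] L2_inner_devsum[OF k0 A] u_def[symmetric] \<mu>_def[symmetric])
  qed
  have "(\<integral>\<^sup>+z. ennreal (exp (cross_scale / (ln (real n) * sqrt (real n) * L2_norm (devsum h I z))
        * \<bar>L2_inner (devsum h I z) (devsum k (N - I) z)\<bar>)) \<partial>PiM N (\<lambda>_. Q))
    = (\<integral>\<^sup>+x. \<integral>\<^sup>+y. ennreal (exp (cross_scale / (ln (real n) * sqrt (real n) * L2_norm (devsum h I x))
        * \<bar>L2_inner (devsum h I x) (devsum k (N - I) y)\<bar>)) \<partial>PiM (N - I) (\<lambda>_. Q) \<partial>PiM I (\<lambda>_. Q))"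
    by (subst nn_integral_split[OF N(1,3)]) (simp_all add: devsum_merge1 devsum_merge2)
  also have "\<dots> \<le> (\<integral>\<^sup>+x. ?b \<partial>PiM I (\<lambda>_. Q))"
    by (intro nn_integral_mono inner)
  also have "\<dots> = ?b" by (simp add: P.emeasure_space_1)
  finally show ?thesis .
qed

text \<open>
  As \<open>cross_scale\<close>, for \<open>u\<close> the convolution of \<open>K_h\<close> and the bias of another bandwidth, whose supremum is bounded
  independently of the bandwidths. The summand \<open>1\<close> avoids a division by zero when \<open>s = 0\<close>.
\<close>

definition bias_scale :: real where "bias_scale = min (\<alpha> / (8 * (K_L1 * ((K_L1 + 1) * s_sup) + 1))) (1 / K_L1)"

lemma bias_scale_bounds: "0 < bias_scale" "bias_scale * (K_L1 * ((K_L1 + 1) * s_sup)) \<le> \<alpha> / 8" "bias_scale * K_L1 \<le> 1"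
proof -
  let ?B = "K_L1 * ((K_L1 + 1) * s_sup)"
  have B: "0 \<le> ?B" using K_L1_ge_1 s_sup_nonneg by simp
  show "0 < bias_scale" using \<alpha>_pos K_L1_ge_1 B by (simp add: bias_scale_def)
  have "bias_scale * ?B \<le> \<alpha> / (8 * (?B + 1)) * (?B + 1)"
    using B \<alpha>_pos by (intro mult_mono) (auto simp: bias_scale_def)
  also have "\<dots> = \<alpha> / 8"
  proof -
    have cancel: "x / (8 * y) * y = x / 8" if "0 < y" for x y :: real using that by simp
    show ?thesis by (rule cancel) (use B in linarith)
  qed
  finally show "bias_scale * ?B \<le> \<alpha> / 8" .
  have "bias_scale * K_L1 \<le> 1 / K_L1 * K_L1" using K_L1_ge_1 by (intro mult_right_mono) (auto simp: bias_scale_def)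
  then show "bias_scale * K_L1 \<le> 1" using K_L1_ge_1 by simp
qed

lemma exp_moment_bias:
  assumes n: "2 \<le> n" and h: "0 < h" and k: "0 < k" and N: "finite N" "card N \<le> n"
  shows "(\<integral>\<^sup>+z. ennreal (exp (bias_scale / (ln (real n) + sqrt (real n) * L2_norm (bias k))
        * \<bar>L2_inner (bias k) (devsum h N z)\<bar>)) \<partial>PiM N (\<lambda>_. Q))
    \<le> ennreal (2 * exp (exp_mom + 2 * D / \<alpha> * ln (real n)))"
proof -
  have ln: "1 / 2 \<le> ln (real n)" by (rule ln_ge_half[OF n])
  let ?b = "L2_norm (bias k)"
  let ?B = "K_L1 * ((K_L1 + 1) * s_sup)"
  have B: "0 \<le> ?B" using K_L1_ge_1 s_sup_nonneg by simp
  have b: "0 \<le> ?b" by (rule L2_norm_nonneg)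
  define u where "u = conv (Kh h) (bias k)"
  define \<mu> where "\<mu> = bias_scale / (ln (real n) + sqrt (real n) * ?b)"
  have den: "0 < ln (real n) + sqrt (real n) * ?b" using ln b by (intro add_pos_nonneg) auto
  note bi = bias_bi[OF k]
  have u: "bounded_integrable u" "L2_norm u \<le> K_L1 * ?b" "\<And>x. \<bar>u x\<bar> \<le> ?B"
    using bounded_integrable_conv[OF Kh_bi[OF h] bi] L2_norm_conv_le[OF Kh_bi[OF h] bi]
      conv_le_bound[OF Kh_bi[OF h] bi bias_le[OF k]] h
    by (auto simp: u_def Kh_abs_integral)
  have mu: "0 \<le> \<mu>" using bias_scale_bounds(1) den by (simp add: \<mu>_def)
  have "\<mu> * ln (real n) \<le> bias_scale"
    using bias_scale_bounds(1) den b by (simp add: \<mu>_def divide_le_eq distrib_left)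
  then have "(\<mu> * ln (real n)) * ?B \<le> bias_scale * ?B" using B by (rule mult_right_mono)
  also have "(\<mu> * ln (real n)) * ?B = \<mu> * ?B * ln (real n)" by (simp only: mult_ac)
  finally have mu1: "\<mu> * ?B * ln (real n) \<le> \<alpha> / 8" using bias_scale_bounds(2) by linarith
  have mu2: "real n * \<mu>\<^sup>2 * (K_L1 * ?b)\<^sup>2 \<le> 1"
  proof -
    have "\<mu> * (sqrt (real n) * ?b) \<le> bias_scale"
      using bias_scale_bounds(1) den ln by (simp add: \<mu>_def divide_le_eq distrib_left)
    then have "\<mu> * (sqrt (real n) * ?b) * K_L1 \<le> bias_scale * K_L1"
      using K_L1_ge_1 by (intro mult_right_mono) auto
    then have "(\<mu> * (sqrt (real n) * ?b) * K_L1)\<^sup>2 \<le> 1\<^sup>2"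
      using bias_scale_bounds(3) mu b K_L1_ge_1 by (intro power_mono) (linarith, simp)
    then show ?thesis by (simp add: power_mult_distrib mult_ac)
  qed
  show ?thesis
    using exp_moment_linear_statistic[OF n N u(1,3,2) mu mu1 mu2]
    by (simp add: L2_inner_devsum[OF h bi] u_def[symmetric] \<mu>_def[symmetric])
qed

definition offdiag :: "nat \<Rightarrow> real \<Rightarrow> real \<Rightarrow> (nat \<Rightarrow> real \<times> real) \<Rightarrow> real"
  where "offdiag n h k z = (\<Sum>i\<in>{1..n}. \<Sum>j\<in>{1..n} - {i}. L2_inner (dev h (z i)) (dev k (z j)))"

lemma offdiag_decoupled:
  assumes "0 < h" "0 < k"
  shows "2 ^ n * offdiag n h k z
    = 4 * (\<Sum>I\<in>Pow {1..n}. L2_inner (devsum h I z) (devsum k ({1..n} - I) z))"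
proof -
  have "L2_inner (devsum h I z) (devsum k J z) = (\<Sum>i\<in>I. \<Sum>j\<in>J. L2_inner (dev h (z i)) (dev k (z j)))" for I J
    unfolding devsum_def[abs_def] using assms
    by (subst L2_inner_sum_left) (auto intro!: dev_bi bounded_integrable_sum sum.cong L2_inner_sum_right)
  then show ?thesis
    unfolding offdiag_def using sum_over_splittings[of "{1..n}" "\<lambda>i j. L2_inner (dev h (z i)) (dev k (z j))"]
    by simp
qed

definition noise_bound :: "nat \<Rightarrow> real set \<Rightarrow> ((nat \<Rightarrow> real \<times> real) \<Rightarrow> real) \<Rightarrow> bool"
  where "noise_bound n H \<Xi> \<longleftrightarrow> (\<forall>z. \<forall>h\<in>H. \<forall>k\<in>H. \<forall>\<eta>\<in>{0<..1}.
      \<bar>offdiag n h k z\<bar> / (real n)\<^sup>2 \<le> \<eta> / (real n * h) + \<Xi> z / \<eta>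
    \<and> \<bar>L2_inner (bias k) (devsum h {1..n} z)\<bar> / real n \<le> \<eta> * (L2_norm (bias k))\<^sup>2 + \<Xi> z / \<eta>)"

lemma noise_boundD:
  assumes "noise_bound n H \<Xi>" "h \<in> H" "k \<in> H" "0 < \<eta>" "\<eta> \<le> 1"
  shows "\<bar>offdiag n h k z\<bar> / (real n)\<^sup>2 \<le> \<eta> / (real n * h) + \<Xi> z / \<eta>"
    and "\<bar>L2_inner (bias k) (devsum h {1..n} z)\<bar> / real n \<le> \<eta> * (L2_norm (bias k))\<^sup>2 + \<Xi> z / \<eta>"
  using assms unfolding noise_bound_def by auto

section \<open>Control of the noise for all bandwidths\<close>

text \<open>
  The bandwidth does not occur in \<open>\<Xi>\<close>, so its expectation may be taken after the data-dependent bandwidth has been inserted.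
\<close>

definition remainder :: "nat \<Rightarrow> real \<Rightarrow> ((nat \<Rightarrow> real \<times> real) \<Rightarrow> real) \<Rightarrow> bool"
  where "remainder n r \<Xi> \<longleftrightarrow> integrable (PiM {1..n} (\<lambda>_. Q)) \<Xi> \<and> (\<forall>z. 0 \<le> \<Xi> z)
    \<and> (\<integral>z. \<Xi> z \<partial>PiM {1..n} (\<lambda>_. Q)) \<le> r"

text \<open>
  Three families of variables have exponential moments at most \<open>2 exp (E + C log n)\<close>: the normalised cross products \<open>R\<close>, the
  normalised norms \<open>A\<close> and the normalised bias terms \<open>T\<close>. They are indexed by at most \<open>n\<^sup>2\<close> pairs of bandwidths and,
  for the first two, averaged over all splittings. With \<open>x\<close> a large multiple of \<open>log n\<close> the sum \<open>Xi\<close> of all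
  \<open>exp (R - x)\<close>, \<open>exp (A - x)\<close>, \<open>exp (T - x)\<close> has bounded expectation, and it controls the fourth powers of all of them
  by \<open>fourth_power_le_exp\<close>. Fourth powers appear because the cross product is \<open>R A\<close> up to scale and is squared when
  the factor \<open>sqrt (\<eta> / (nh))\<close> is split off.
\<close>

lemma noise_control:
  "\<exists>C>0. \<forall>n H. bandwidths n H \<longrightarrow> (\<exists>\<Xi>. remainder n (C * (ln (real n) ^ 5 / real n)) \<Xi> \<and> noise_bound n H \<Xi>)"
proof -
  define c0 where "c0 = \<alpha> / (4 * dev_const)"
  have c0: "0 < c0" using \<alpha>_pos dev_const_pos by (simp add: c0_def)
  define e1 where "e1 = 2 * D / \<alpha> + exp \<alpha> * exp_mom"
  have e1: "0 \<le> e1" using D_nonneg \<alpha>_pos exp_mom_ge_1 by (simp add: e1_def)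
  \<comment> \<open>the additional \<open>2\<close> pays for the sum over the \<open>n\<^sup>2\<close> pairs of bandwidths\<close>
  define e2 where "e2 = e1 + 2"
  define Cc where "Cc = 4 / (c0 * cross_scale)\<^sup>2 + 1 / bias_scale + 2 / bias_scale\<^sup>2"
  have Cc: "0 < Cc" "4 / (c0 * cross_scale)\<^sup>2 \<le> Cc" "1 / bias_scale + 2 / bias_scale\<^sup>2 \<le> Cc"
    using c0 cross_scale_bounds(1) bias_scale_bounds(1) by (auto simp: Cc_def add_pos_pos)
  define C where "C = Cc * (16 + 8 * e2 ^ 4 + 16 * (192 * (6 * exp exp_mom)))"
  have Cpos: "0 < C" unfolding C_def using Cc by (intro mult_pos_pos add_pos_nonneg) auto
  have "\<exists>\<Xi>. remainder n (C * (ln (real n) ^ 5 / real n)) \<Xi> \<and> noise_bound n H \<Xi>"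
    if bw: "bandwidths n H" for n H
  proof -
    note H = bandwidthsD(1,2)[OF bw] and hH = bandwidthsD(4)[OF bw] and n = bandwidthsD(5)[OF bw]
    let ?P = "PiM {1..n} (\<lambda>_. Q)"
    interpret P: prob_space ?P by (intro prob_space_PiM prob_space_axioms)
    let ?l = "ln (real n)"
    have l: "1 / 2 \<le> ?l" by (rule ln_ge_half[OF n])
    have Hpos: "0 < h" "h \<le> 1" "1 / real n < h" if "h \<in> H" for h
      using hH that n less_trans[of 0 "1 / real n" h] by auto
    define x where "x = e2 * ?l"
    have x: "0 \<le> x" using e1 l by (simp add: x_def e2_def)
    define R where "R h k I z = cross_scale / (?l * sqrt (real n) * L2_norm (devsum h I z))
        * \<bar>L2_inner (devsum h I z) (devsum k ({1..n} - I) z)\<bar>" for h k I z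
    define A where "A h I z = c0 * sqrt (h * ?l / real n) * L2_norm (devsum h I z)" for h I z
    define T where "T h k z = bias_scale / (?l + sqrt (real n) * L2_norm (bias k))
        * \<bar>L2_inner (bias k) (devsum h {1..n} z)\<bar>" for h k z
    have R0: "0 \<le> R h k I z" for h k I z
      using cross_scale_bounds(1) l L2_norm_nonneg[of "devsum h I z"] by (simp add: R_def)
    have A0: "0 \<le> A h I z" if "h \<in> H" for h I z
      using c0 l L2_norm_nonneg[of "devsum h I z"] Hpos[OF that] by (simp add: A_def)
    have T0: "0 \<le> T h k z" for h k z
      using bias_scale_bounds(1) l L2_norm_nonneg[of "bias k"] by (simp add: T_def)
    define e where "e = 2 * exp (exp_mom + e1 * ?l) * exp (- x)"
    have e0: "0 \<le> e" by (simp add: e_def)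
    have ebound: "ennreal (exp (- x)) * ennreal (2 * exp t) \<le> ennreal e" if "t \<le> exp_mom + e1 * ?l" for t
    proof -
      have "exp (- x) * (2 * exp t) \<le> exp (- x) * (2 * exp (exp_mom + e1 * ?l))" using that by simp
      then show ?thesis by (simp add: ennreal_mult'[symmetric] e_def mult_ac ennreal_leI)
    qed
    have le1: "exp_mom + 2 * D / \<alpha> * ?l \<le> exp_mom + e1 * ?l" "exp \<alpha> * exp_mom * ?l \<le> exp_mom + e1 * ?l"
    proof -
      have "0 \<le> 2 * D / \<alpha> * ?l" "0 \<le> exp \<alpha> * exp_mom * ?l" using D_nonneg \<alpha>_pos l exp_mom_ge_1 by auto
      then show "exp_mom + 2 * D / \<alpha> * ?l \<le> exp_mom + e1 * ?l" "exp \<alpha> * exp_mom * ?l \<le> exp_mom + e1 * ?l"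
        using exp_mom_ge_1 unfolding e1_def distrib_right by linarith+
    qed
    have shift: "integrable ?P (\<lambda>z. exp (F z - x)) \<and> (\<integral>z. exp (F z - x) \<partial>?P) \<le> e"
      if [measurable]: "F \<in> borel_measurable ?P"
        and F: "(\<integral>\<^sup>+z. ennreal (exp (F z)) \<partial>?P) \<le> ennreal (2 * exp t)" and t: "t \<le> exp_mom + e1 * ?l" for F t
    proof -
      have "(\<integral>\<^sup>+z. ennreal (exp (F z - x)) \<partial>?P) = (\<integral>\<^sup>+z. ennreal (exp (- x)) * ennreal (exp (F z)) \<partial>?P)"
        by (intro nn_integral_cong) (simp add: ennreal_mult'[symmetric] exp_add[symmetric])
      also have "\<dots> = ennreal (exp (- x)) * (\<integral>\<^sup>+z. ennreal (exp (F z)) \<partial>?P)"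
        by (rule nn_integral_cmult) measurable
      also have "\<dots> \<le> ennreal (exp (- x)) * ennreal (2 * exp t)" by (intro mult_left_mono F) simp
      also have "\<dots> \<le> ennreal e" by (rule ebound[OF t])
      finally have le: "(\<integral>\<^sup>+z. ennreal (exp (F z - x)) \<partial>?P) \<le> ennreal e" .
      have m: "(\<lambda>z. exp (F z - x)) \<in> borel_measurable ?P" by measurable
      show ?thesis
        using integrable_of_nn_integral_le[OF m _ le e0] by simp
    qed
    have Ri: "integrable ?P (\<lambda>z. exp (R h k I z - x)) \<and> (\<integral>z. exp (R h k I z - x) \<partial>?P) \<le> e"
      if "h \<in> H" "k \<in> H" "I \<in> Pow {1..n}" for h k I
    proof -
      have I: "I \<subseteq> {1..n}" using that by simp
      note [measurable] = devsum_norm_meas[OF Hpos(1)[OF that(1)] I]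
        L2_inner_measurable[OF devsum_meas[OF Hpos(1)[OF that(1)] I] devsum_meas[OF Hpos(1)[OF that(2)] Diff_subset]]
      have m: "R h k I \<in> borel_measurable ?P" unfolding R_def[abs_def] by measurable
      show ?thesis
        by (rule shift[OF m _ le1(1)], unfold R_def)
           (rule exp_moment_cross[OF n Hpos(1)[OF that(1)] Hpos(3)[OF that(2)] _ _ I], simp_all)
    qed
    have Ai: "integrable ?P (\<lambda>z. exp (A h I z - x)) \<and> (\<integral>z. exp (A h I z - x) \<partial>?P) \<le> e"
      if "h \<in> H" "I \<in> Pow {1..n}" for h I
    proof -
      have I: "I \<subseteq> {1..n}" using that by simp
      note [measurable] = devsum_norm_meas[OF Hpos(1)[OF that(1)] I]
      have m: "A h I \<in> borel_measurable ?P" unfolding A_def[abs_def] by measurable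
      show ?thesis
        by (rule shift[OF m _ le1(2)], unfold A_def c0_def)
           (rule exp_moment_devsum[OF n Hpos(1,2)[OF that(1)] _ _ I], simp_all)
    qed
    have Ti: "integrable ?P (\<lambda>z. exp (T h k z - x)) \<and> (\<integral>z. exp (T h k z - x) \<partial>?P) \<le> e"
      if "h \<in> H" "k \<in> H" for h k
    proof -
      note bias_bi[OF Hpos(1)[OF that(2)], THEN bounded_integrable_measurable, measurable]
      have bm: "case_prod (\<lambda>z. bias k) \<in> borel_measurable (?P \<Otimes>\<^sub>M borel)" by measurable
      note [measurable] = L2_inner_measurable[OF bm devsum_meas[OF Hpos(1)[OF that(1)] subset_refl]]
      have m: "T h k \<in> borel_measurable ?P" unfolding T_def[abs_def] by measurable
      show ?thesis
        by (rule shift[OF m _ le1(1)], unfold T_def)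
           (rule exp_moment_bias[OF n Hpos(1)[OF that(1)] Hpos(1)[OF that(2)]], simp_all)
    qed
    define av where "av h k z = (\<Sum>I\<in>Pow {1..n}. exp (R h k I z - x) + exp (A h I z - x)) / 2 ^ n" for h k z
    define Xi where "Xi z = (\<Sum>h\<in>H. \<Sum>k\<in>H. av h k z + exp (T h k z - x))" for z
    have avi: "integrable ?P (av h k) \<and> (\<integral>z. av h k z \<partial>?P) \<le> 2 * e" if "h \<in> H" "k \<in> H" for h k
    proof -
      have "(\<integral>z. av h k z \<partial>?P)
          = (\<Sum>I\<in>Pow {1..n}. (\<integral>z. exp (R h k I z - x) \<partial>?P) + (\<integral>z. exp (A h I z - x) \<partial>?P)) / 2 ^ n"
        unfolding av_def using Ri[OF that] Ai[OF that(1)] by (simp add: Bochner_Integration.integral_sum)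
      also have "\<dots> \<le> (\<Sum>I\<in>Pow {1..n}. e + e) / 2 ^ n"
        using Ri[OF that] Ai[OF that(1)] by (intro divide_right_mono sum_mono add_mono) auto
      also have "\<dots> = 2 * e" by (simp add: card_Pow)
      finally have "(\<integral>z. av h k z \<partial>?P) \<le> 2 * e" .
      moreover have "integrable ?P (av h k)"
        unfolding av_def[abs_def] using Ri[OF that] Ai[OF that(1)] by (intro integrable_divide Bochner_Integration.integrable_sum) auto
      ultimately show ?thesis by simp
    qed
    have Xint: "integrable ?P Xi"
      unfolding Xi_def[abs_def] using avi Ti by (intro Bochner_Integration.integrable_sum Bochner_Integration.integrable_add) auto
    have "(\<integral>z. Xi z \<partial>?P) = (\<Sum>h\<in>H. \<Sum>k\<in>H. (\<integral>z. av h k z \<partial>?P) + (\<integral>z. exp (T h k z - x) \<partial>?P))"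
      unfolding Xi_def using avi Ti by (simp add: Bochner_Integration.integral_sum)
    also have "\<dots> \<le> (\<Sum>h\<in>H. \<Sum>k\<in>H. 2 * e + e)"
      using avi Ti by (intro sum_mono add_mono) auto
    also have "\<dots> = (real (card H))\<^sup>2 * (3 * e)" by (simp add: power2_eq_square)
    also have "\<dots> \<le> (real n)\<^sup>2 * (3 * e)" using H e0 by (intro mult_right_mono power_mono) auto
    also have "\<dots> = 6 * exp exp_mom"
    proof -
      have "(real n)\<^sup>2 = exp (2 * ?l)" using n exp_of_nat_mult[of 2 ?l] by simp
      moreover have "exp (2 * ?l) * (exp (exp_mom + e1 * ?l) * exp (- x)) = exp exp_mom"
        unfolding exp_add[symmetric] by (simp add: x_def e2_def algebra_simps)
      ultimately show ?thesis by (simp add: e_def mult_ac)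
    qed
    finally have EX: "(\<integral>z. Xi z \<partial>?P) \<le> 6 * exp exp_mom" .
    have av0: "0 \<le> av h k z" for h k z by (simp add: av_def sum_nonneg)
    have X0: "0 \<le> Xi z" for z by (simp add: Xi_def sum_nonneg av0)
    have Xi_ge: "av h k z + exp (T h k z - x) \<le> Xi z" if "h \<in> H" "k \<in> H" for h k z
    proof -
      have "av h k z + exp (T h k z - x) \<le> (\<Sum>k\<in>H. av h k z + exp (T h k z - x))"
        using that H by (intro member_le_sum[of k H "\<lambda>k. av h k z + exp (T h k z - x)"]) (auto simp: av0)
      also have "\<dots> \<le> Xi z" unfolding Xi_def
        using that H by (intro member_le_sum[of h H "\<lambda>h. \<Sum>k\<in>H. av h k z + exp (T h k z - x)"])
          (auto intro!: sum_nonneg simp: av0)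
      finally show ?thesis .
    qed
    define Z where "Z z = 8 * x ^ 4 + 192 * Xi z" for z
    have Z0: "0 \<le> Z z" for z using x X0 by (simp add: Z_def)
    define \<Xi> where "\<Xi> z = Cc * (?l / real n) * (1 + Z z)" for z
    have Xi0: "0 \<le> \<Xi> z" for z using Cc l Z0[of z] by (simp add: \<Xi>_def)
    have int: "integrable ?P \<Xi>" unfolding \<Xi>_def[abs_def] Z_def
      by (intro integrable_mult_right Bochner_Integration.integrable_add Xint P.integrable_const)
    have E: "(\<integral>z. \<Xi> z \<partial>?P) \<le> C * (?l ^ 5 / real n)"
    proof -
      have one: "1 \<le> 16 * ?l ^ 4"
        using power_mono[OF l, of 4] by (simp add: power_divide)
      have "(\<integral>z. \<Xi> z \<partial>?P) = Cc * (?l / real n) * (1 + (8 * x ^ 4 + 192 * (\<integral>z. Xi z \<partial>?P)))"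
        unfolding \<Xi>_def Z_def using Xint by (simp add: P.prob_space del: One_nat_def)
      also have "\<dots> \<le> Cc * (?l / real n) * (16 * ?l ^ 4 + (8 * x ^ 4 + 192 * (6 * exp exp_mom) * (16 * ?l ^ 4)))"
      proof (intro mult_left_mono add_mono one order_refl)
        have "192 * (\<integral>z. Xi z \<partial>?P) \<le> 192 * (6 * exp exp_mom) * 1" using EX by simp
        also have "\<dots> \<le> 192 * (6 * exp exp_mom) * (16 * ?l ^ 4)" using one by (intro mult_left_mono) auto
        finally show "192 * (\<integral>z. Xi z \<partial>?P) \<le> 192 * (6 * exp exp_mom) * (16 * ?l ^ 4)" .
      qed (use Cc l in auto)
      also have "\<dots> = C * (?l ^ 5 / real n)"
        by (simp add: C_def x_def power_mult_distrib field_simps numeral_eq_Suc)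
      finally show ?thesis .
    qed
    have U: "\<bar>offdiag n h k z\<bar> / (real n)\<^sup>2 \<le> \<eta> / (real n * h) + \<Xi> z / \<eta>"
      if hk: "h \<in> H" "k \<in> H" and eta: "0 < \<eta>" "\<eta> \<le> 1" for h k \<eta> z
    proof -
      note hp = Hpos[OF hk(1)]
      let ?w = "?l / real n / (c0 * cross_scale)\<^sup>2 / \<eta>"
      have w0: "0 \<le> ?w" using l eta by simp
      have one: "\<bar>L2_inner (devsum h I z) (devsum k ({1..n} - I) z)\<bar> / (real n)\<^sup>2
          \<le> \<eta> / (real n * h) / 4 + ?w * ((R h k I z ^ 4 + A h I z ^ 4) / 2)" for I
      proof -
        let ?G = "\<bar>L2_inner (devsum h I z) (devsum k ({1..n} - I) z)\<bar>"
        let ?N = "L2_norm (devsum h I z)"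
        define p where "p = sqrt (\<eta> / (real n * h))"
        define q where "q = R h k I z * A h I z * sqrt ?l / (c0 * cross_scale * sqrt (real n * \<eta>))"
        \<comment> \<open>the scales of \<open>R\<close> and \<open>A\<close> multiply so that the norm of the sum over \<open>I\<close> cancels\<close>
        have "?G / (real n)\<^sup>2 = p * q"
        proof (cases "?N = 0")
          case True
          have "?G \<le> ?N * L2_norm (devsum k ({1..n} - I) z)"
            using hp Hpos[OF hk(2)] by (intro L2_Cauchy_Schwarz devsum_bi)
          then show ?thesis using True by (simp add: q_def A_def)
        next
          case False
          have sl: "sqrt ?l * sqrt ?l = ?l" "sqrt (real n) * sqrt (real n) = real n" using l by auto
          have "p * q = (sqrt \<eta> / (sqrt (real n) * sqrt h))
              * ((cross_scale / (?l * sqrt (real n) * ?N) * ?G) * (c0 * (sqrt h * sqrt ?l / sqrt (real n)) * ?N)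
                * sqrt ?l / (c0 * cross_scale * (sqrt (real n) * sqrt \<eta>)))"
            by (simp add: p_def q_def R_def A_def real_sqrt_mult real_sqrt_divide)
          also have "\<dots> = ?G * (sqrt ?l * sqrt ?l) / (?l * ((sqrt (real n) * sqrt (real n)) * (sqrt (real n) * sqrt (real n))))"
            using False hp eta c0 cross_scale_bounds(1) n l by (simp add: field_simps)
          also have "\<dots> = ?G / (real n)\<^sup>2" using l unfolding sl by (simp add: power2_eq_square)
          finally show ?thesis by simp
        qed
        also have "\<dots> \<le> p\<^sup>2 / 4 + q\<^sup>2" by (rule mult_le_square_split)
        also have "p\<^sup>2 = \<eta> / (real n * h)" using eta hp by (simp add: p_def)
        also have "q\<^sup>2 = ?w * (R h k I z * A h I z)\<^sup>2"
          using eta l by (simp add: q_def power_mult_distrib power_divide mult_ac)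
        also have "?w * (R h k I z * A h I z)\<^sup>2 \<le> ?w * ((R h k I z ^ 4 + A h I z ^ 4) / 2)"
        proof (rule mult_left_mono[OF _ w0])
          have "2 * ((R h k I z)\<^sup>2 * (A h I z)\<^sup>2) \<le> ((R h k I z)\<^sup>2)\<^sup>2 + ((A h I z)\<^sup>2)\<^sup>2"
            using sum_squares_bound[of "(R h k I z)\<^sup>2" "(A h I z)\<^sup>2"] by simp
          then show "(R h k I z * A h I z)\<^sup>2 \<le> (R h k I z ^ 4 + A h I z ^ 4) / 2"
            by (simp add: power_mult_distrib)
        qed
        finally show ?thesis by simp
      qed
      have four: "(R h k I z ^ 4 + A h I z ^ 4) / 2 \<le> 8 * x ^ 4 + 96 * (exp (R h k I z - x) + exp (A h I z - x))" for I
        using fourth_power_le_exp[OF R0 x, of h k I z] fourth_power_le_exp[OF A0[OF hk(1)] x, of I z] by simp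
      have "2 ^ n * \<bar>offdiag n h k z\<bar>
          = \<bar>4 * (\<Sum>I\<in>Pow {1..n}. L2_inner (devsum h I z) (devsum k ({1..n} - I) z))\<bar>"
        unfolding offdiag_decoupled[OF hp(1) Hpos(1)[OF hk(2)], symmetric] by (simp add: abs_mult)
      then have "2 ^ n * (\<bar>offdiag n h k z\<bar> / (real n)\<^sup>2)
          = 4 * \<bar>\<Sum>I\<in>Pow {1..n}. L2_inner (devsum h I z) (devsum k ({1..n} - I) z)\<bar> / (real n)\<^sup>2"
        unfolding abs_mult times_divide_eq_right by simp
      also have "\<dots> \<le> 4 * (\<Sum>I\<in>Pow {1..n}. \<bar>L2_inner (devsum h I z) (devsum k ({1..n} - I) z)\<bar>) / (real n)\<^sup>2"
        by (intro divide_right_mono mult_left_mono sum_abs) auto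
      also have "\<dots> = (\<Sum>I\<in>Pow {1..n}. 4 * (\<bar>L2_inner (devsum h I z) (devsum k ({1..n} - I) z)\<bar> / (real n)\<^sup>2))"
        by (simp add: sum_distrib_left sum_divide_distrib)
      also have "\<dots> \<le> (\<Sum>I\<in>Pow {1..n}. 4 * (\<eta> / (real n * h) / 4
          + ?w * (8 * x ^ 4 + 96 * (exp (R h k I z - x) + exp (A h I z - x)))))"
        by (intro sum_mono mult_left_mono order_trans[OF one] add_left_mono mult_left_mono[OF four w0]) auto
      also have "\<dots> = 2 ^ n * (\<eta> / (real n * h) + 4 * ?w * (8 * x ^ 4 + 96 * av h k z))"
      proof -
        have "(\<Sum>I\<in>Pow {1..n}. 4 * (p / 4 + w * (X + 96 * t I)))
            = 2 ^ n * (p + 4 * w * (X + 96 * ((\<Sum>I\<in>Pow {1..n}. t I) / 2 ^ n)))"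
          for p w X :: real and t :: "nat set \<Rightarrow> real"
        proof -
          have "4 * (p / 4 + w * (X + 96 * t I)) = (p + 4 * w * X) + (4 * w * 96) * t I" for I
            by (simp add: algebra_simps)
          then have "(\<Sum>I\<in>Pow {1..n}. 4 * (p / 4 + w * (X + 96 * t I)))
              = 2 ^ n * (p + 4 * w * X) + (4 * w * 96) * (\<Sum>I\<in>Pow {1..n}. t I)"
            by (simp add: sum.distrib sum_distrib_left[symmetric] card_Pow distrib_left)
          then show ?thesis by (simp add: field_simps)
        qed
        then show ?thesis unfolding av_def .
      qed
      finally have "\<bar>offdiag n h k z\<bar> / (real n)\<^sup>2 \<le> \<eta> / (real n * h) + 4 * ?w * (8 * x ^ 4 + 96 * av h k z)"
        by (rule mult_left_le_imp_le) simp
      also have "4 * ?w * (8 * x ^ 4 + 96 * av h k z) \<le> 4 * ?w * (1 + Z z)"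
      proof (rule mult_left_mono)
        have "av h k z \<le> Xi z" using Xi_ge[OF hk, of z] exp_ge_zero[of "T h k z - x"] by linarith
        then show "8 * x ^ 4 + 96 * av h k z \<le> 1 + Z z" using X0[of z] by (simp add: Z_def)
      qed (use w0 in simp)
      also have "\<dots> = (4 / (c0 * cross_scale)\<^sup>2) * (?l / real n * (1 + Z z) / \<eta>)" by (simp add: mult_ac)
      also have "\<dots> \<le> Cc * (?l / real n * (1 + Z z) / \<eta>)"
        using Cc(2) l eta Z0[of z] by (intro mult_right_mono) auto
      finally show ?thesis by (simp add: \<Xi>_def mult.assoc)
    qed
    have Bb: "\<bar>L2_inner (bias k) (devsum h {1..n} z)\<bar> / real n \<le> \<eta> * (L2_norm (bias k))\<^sup>2 + \<Xi> z / \<eta>"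
      if hk: "h \<in> H" "k \<in> H" and eta: "0 < \<eta>" "\<eta> \<le> 1" for h k \<eta> z
    proof -
      let ?b = "L2_norm (bias k)"
      let ?t = "T h k z"
      have b: "0 \<le> ?b" by (rule L2_norm_nonneg)
      have den: "0 < ?l + sqrt (real n) * ?b" using l b by (intro add_pos_nonneg) auto
      have "\<bar>L2_inner (bias k) (devsum h {1..n} z)\<bar> = ?t * (?l + sqrt (real n) * ?b) / bias_scale"
        using den bias_scale_bounds(1) by (simp add: T_def)
      then have "\<bar>L2_inner (bias k) (devsum h {1..n} z)\<bar> / real n = ?t * ?l / bias_scale / real n + (sqrt \<eta> * ?b) * (?t / (bias_scale * sqrt (real n) * sqrt \<eta>))"
        using n bias_scale_bounds(1) eta real_sqrt_mult_self[of "real n"] by (simp add: field_simps)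
      also have "(sqrt \<eta> * ?b) * (?t / (bias_scale * sqrt (real n) * sqrt \<eta>))
          \<le> (sqrt \<eta> * ?b)\<^sup>2 / 4 + (?t / (bias_scale * sqrt (real n) * sqrt \<eta>))\<^sup>2"
        by (rule mult_le_square_split)
      also have "(sqrt \<eta> * ?b)\<^sup>2 / 4 \<le> \<eta> * ?b\<^sup>2"
        using eta by (simp add: power_mult_distrib)
      finally have "\<bar>L2_inner (bias k) (devsum h {1..n} z)\<bar> / real n
          \<le> \<eta> * ?b\<^sup>2 + (?t * ?l / bias_scale / real n + (?t / (bias_scale * sqrt (real n) * sqrt \<eta>))\<^sup>2)"
        by simp
      also have "?t * ?l / bias_scale / real n + (?t / (bias_scale * sqrt (real n) * sqrt \<eta>))\<^sup>2 \<le> \<Xi> z / \<eta>"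
      proof -
        have "exp (?t - x) \<le> Xi z" using Xi_ge[OF hk, of z] av0[of h k z] by linarith
        then have "?t ^ 4 \<le> Z z" using fourth_power_le_exp[OF T0 x, of h k z] by (simp add: Z_def)
        then have t: "?t \<le> 1 + Z z" "?t\<^sup>2 \<le> 1 + Z z"
          using le_one_plus_fourth[of ?t] square_le_one_plus_fourth[of ?t] by linarith+
        define r where "r = ?l / real n / \<eta>"
        have r: "?l / real n \<le> r" "1 / (real n * \<eta>) \<le> 2 * r" "0 \<le> ?l / real n"
          using l eta n by (auto simp: r_def field_simps)
        have r0: "0 \<le> r" using r by linarith
        have "?t * ?l / bias_scale / real n = (1 / bias_scale) * (?t * (?l / real n))" by simp
        also have "\<dots> \<le> (1 / bias_scale) * ((1 + Z z) * r)"
          using bias_scale_bounds(1) t r T0 Z0[of z] r0 by (intro mult_left_mono mult_mono) auto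
        finally have 1: "?t * ?l / bias_scale / real n \<le> (1 / bias_scale) * ((1 + Z z) * r)" .
        have "(?t / (bias_scale * sqrt (real n) * sqrt \<eta>))\<^sup>2 = (1 / bias_scale\<^sup>2) * (?t\<^sup>2 * (1 / (real n * \<eta>)))"
          using eta by (simp add: power_mult_distrib power_divide)
        also have "\<dots> \<le> (1 / bias_scale\<^sup>2) * ((1 + Z z) * (2 * r))"
          using t r eta Z0[of z] by (intro mult_left_mono mult_mono) auto
        finally have 2: "(?t / (bias_scale * sqrt (real n) * sqrt \<eta>))\<^sup>2 \<le> (2 / bias_scale\<^sup>2) * ((1 + Z z) * r)"
          by (simp add: mult_ac)
        have "?t * ?l / bias_scale / real n + (?t / (bias_scale * sqrt (real n) * sqrt \<eta>))\<^sup>2 \<le> (1 / bias_scale + 2 / bias_scale\<^sup>2) * ((1 + Z z) * r)"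
          using 1 2 unfolding distrib_right by linarith
        also have "\<dots> \<le> Cc * ((1 + Z z) * r)"
          using Cc(3) r0 Z0[of z] by (intro mult_right_mono) auto
        also have "\<dots> = \<Xi> z / \<eta>" by (simp add: \<Xi>_def r_def mult_ac)
        finally show ?thesis .
      qed
      finally show ?thesis by simp
    qed
    have "noise_bound n H \<Xi>" unfolding noise_bound_def using U Bb by auto
    then show ?thesis using int Xi0 E unfolding remainder_def by blast
  qed
  then show ?thesis using Cpos by blast
qed

section \<open>Loss and criterion\<close>

definition est :: "nat \<Rightarrow> real \<Rightarrow> (nat \<Rightarrow> real \<times> real) \<Rightarrow> real \<Rightarrow> real"
  where "est n h z x = (\<Sum>i\<in>{1..n}. weight h (z i) x) / real n"

definition loss :: "nat \<Rightarrow> real \<Rightarrow> (nat \<Rightarrow> real \<times> real) \<Rightarrow> real"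
  where "loss n h z = (L2_norm (\<lambda>x. est n h z x - s x))\<^sup>2"

text \<open>
  The observation of index \<open>i\<close> is the pair \<open>z i\<close>, and \<open>m\<close> is the smallest bandwidth.
\<close>

definition penalty :: "nat \<Rightarrow> real \<Rightarrow> real \<Rightarrow> (nat \<Rightarrow> real \<times> real) \<Rightarrow> real"
  where "penalty n m h z = 2 * L2_inner (Kh m) (Kh h) / (real n)\<^sup>2 * (\<Sum>i\<in>{1..n}. (snd (z i))\<^sup>2)"

definition criterion :: "nat \<Rightarrow> real \<Rightarrow> real \<Rightarrow> (nat \<Rightarrow> real \<times> real) \<Rightarrow> real"
  where "criterion n m h z = (L2_norm (\<lambda>x. est n h z x - est n m z x))\<^sup>2 + penalty n m h z"

definition bias_sq :: "real \<Rightarrow> real" where "bias_sq h = (L2_norm (bias h))\<^sup>2"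

lemma est_bi: "0 < h \<Longrightarrow> bounded_integrable (est n h z)"
  unfolding est_def[abs_def]
  using bounded_integrable_cmult[OF bounded_integrable_sum[of "{1..n}" "\<lambda>i. weight h (z i)"], of "1 / real n"]
  by (simp add: weight_bi)

lemma est_error: "0 < n \<Longrightarrow> est n h z x - s x = 1 / real n * devsum h {1..n} z x + bias h x"
  by (simp add: est_def devsum_def dev_def bias_def sum_subtractf diff_divide_distrib)

lemma L2_inner_errors:
  assumes "0 < n" "0 < h" "0 < k"
  shows "L2_inner (\<lambda>x. est n h z x - s x) (\<lambda>x. est n k z x - s x)
    = L2_inner (devsum h {1..n} z) (devsum k {1..n} z) / (real n)\<^sup>2
      + L2_inner (bias k) (devsum h {1..n} z) / real n
      + L2_inner (bias h) (devsum k {1..n} z) / real n + L2_inner (bias h) (bias k)"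
proof -
  note bi = bounded_integrable_cmult[OF devsum_bi[OF assms(2)], of "1 / real n" "{1..n}" z]
    bounded_integrable_cmult[OF devsum_bi[OF assms(3)], of "1 / real n" "{1..n}" z]
    bias_bi[OF assms(2)] bias_bi[OF assms(3)]
  show ?thesis
    unfolding est_error[OF assms(1)] L2_inner_add_add[OF bi(1,3,2,4)] L2_inner_cmult_left L2_inner_cmult_right
    by (subst (2) L2_inner_commute) (simp add: power2_eq_square)
qed

lemma L2_inner_devsum_devsum:
  assumes "0 < h" "0 < k"
  shows "L2_inner (devsum h {1..n} z) (devsum k {1..n} z)
    = (\<Sum>i\<in>{1..n}. L2_inner (dev h (z i)) (dev k (z i))) + offdiag n h k z"
proof -
  have "L2_inner (devsum h {1..n} z) (devsum k {1..n} z)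
      = (\<Sum>i\<in>{1..n}. \<Sum>j\<in>{1..n}. L2_inner (dev h (z i)) (dev k (z j)))"
    unfolding devsum_def[abs_def] using assms
    by (subst L2_inner_sum_left) (auto intro!: dev_bi bounded_integrable_sum sum.cong L2_inner_sum_right)
  also have "\<dots> = (\<Sum>i\<in>{1..n}. L2_inner (dev h (z i)) (dev k (z i))
      + (\<Sum>j\<in>{1..n} - {i}. L2_inner (dev h (z i)) (dev k (z j))))"
  proof (rule sum.cong[OF refl])
    fix i assume "i \<in> {1..n}"
    then show "(\<Sum>j\<in>{1..n}. L2_inner (dev h (z i)) (dev k (z j))) = L2_inner (dev h (z i)) (dev k (z i))
        + (\<Sum>j\<in>{1..n} - {i}. L2_inner (dev h (z i)) (dev k (z j)))"
      by (intro sum.remove) auto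
  qed
  finally show ?thesis by (simp add: offdiag_def sum.distrib)
qed

definition diag_const :: real where "diag_const = 2 * (K_L1 * (K_L1 * s_sup)) + (K_L1 * L2_norm s)\<^sup>2"

lemma diag_const_nonneg: "0 \<le> diag_const"
  using K_L1_ge_1 s_sup_nonneg by (simp add: diag_const_def)

text \<open>
  The diagonal of the double sum is the random quantity that the penalty removes, up to terms linear in \<open>\<bar>Y\<bar>\<close>: the products
  with the smoothed functions are bounded because \<open>s\<close> is.
\<close>

lemma dev_inner_diagonal:
  assumes h: "0 < h" and k: "0 < k"
  shows "\<bar>L2_inner (dev h z) (dev k z) - (snd z)\<^sup>2 * L2_inner (Kh h) (Kh k)\<bar> \<le> diag_const * (\<bar>snd z\<bar> + 1)"
proof -
  have eq: "L2_inner (dev h z) (dev k z) = (snd z)\<^sup>2 * L2_inner (Kh h) (Kh k)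
      - L2_inner (smooth k) (weight h z) - L2_inner (smooth h) (weight k z) + L2_inner (smooth h) (smooth k)"
    unfolding dev_def[abs_def] using assms
    by (simp add: L2_inner_diff_left L2_inner_diff_right smooth_bi weight_bi bounded_integrable_diff
        L2_inner_weight_weight L2_inner_commute)
  have cross: "\<bar>L2_inner (smooth q) (weight p z)\<bar> \<le> K_L1 * (K_L1 * s_sup) * \<bar>snd z\<bar>" if "0 < p" "0 < q" for p q
  proof -
    have "\<bar>conv (Kh p) (smooth q) (fst z)\<bar> \<le> K_L1 * (K_L1 * s_sup)"
      using conv_le_bound[OF Kh_bi[OF that(1)] smooth_bi[OF that(2)] smooth_le[OF that(2)]] that
      by (simp add: Kh_abs_integral)
    then show ?thesis
      unfolding L2_inner_weight abs_mult
      using mult_left_mono[of "\<bar>conv (Kh p) (smooth q) (fst z)\<bar>" "K_L1 * (K_L1 * s_sup)" "\<bar>snd z\<bar>"]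
      by (simp add: mult.commute)
  qed
  have "\<bar>L2_inner (smooth h) (smooth k)\<bar> \<le> L2_norm (smooth h) * L2_norm (smooth k)"
    using assms by (intro L2_Cauchy_Schwarz smooth_bi)
  also have "\<dots> \<le> (K_L1 * L2_norm s) * (K_L1 * L2_norm s)"
    using smooth_norm_le[OF h] smooth_norm_le[OF k] K_L1_ge_1 by (intro mult_mono) (auto simp: L2_norm_nonneg)
  finally have ss: "\<bar>L2_inner (smooth h) (smooth k)\<bar> \<le> (K_L1 * L2_norm s)\<^sup>2" by (simp add: power2_eq_square)
  have "0 \<le> (K_L1 * L2_norm s)\<^sup>2 * \<bar>snd z\<bar>" "0 \<le> 2 * (K_L1 * (K_L1 * s_sup))" using K_L1_ge_1 s_sup_nonneg by auto
  then show ?thesis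
    using cross[OF h k] cross[OF k h] ss unfolding eq diag_const_def distrib_left distrib_right by linarith
qed

definition diag_noise :: "nat \<Rightarrow> (nat \<Rightarrow> real \<times> real) \<Rightarrow> real"
  where "diag_noise n z = diag_const * (\<Sum>i\<in>{1..n}. \<bar>snd (z i)\<bar> + 1) / (real n)\<^sup>2"

lemma diag_noise_nonneg: "0 \<le> diag_noise n z"
  using diag_const_nonneg by (simp add: diag_noise_def sum_nonneg)

lemma diagonal_sum:
  assumes "0 < n" "0 < h" "0 < k"
  shows "\<bar>(\<Sum>i\<in>{1..n}. L2_inner (dev h (z i)) (dev k (z i))) / (real n)\<^sup>2
    - L2_inner (Kh h) (Kh k) / (real n)\<^sup>2 * (\<Sum>i\<in>{1..n}. (snd (z i))\<^sup>2)\<bar> \<le> diag_noise n z"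
proof -
  let ?c = "L2_inner (Kh h) (Kh k)"
  let ?d = "\<lambda>i. L2_inner (dev h (z i)) (dev k (z i))"
  have "\<bar>\<Sum>i\<in>{1..n}. ?d i - (snd (z i))\<^sup>2 * ?c\<bar> \<le> (\<Sum>i\<in>{1..n}. diag_const * (\<bar>snd (z i)\<bar> + 1))"
    by (rule order_trans[OF sum_abs]) (rule sum_mono, rule dev_inner_diagonal[OF assms(2,3)])
  then have "\<bar>\<Sum>i\<in>{1..n}. ?d i - (snd (z i))\<^sup>2 * ?c\<bar> / (real n)\<^sup>2 \<le> diag_noise n z"
    unfolding diag_noise_def sum_distrib_left by (intro divide_right_mono) auto
  moreover have "(\<Sum>i\<in>{1..n}. ?d i) / (real n)\<^sup>2 - ?c / (real n)\<^sup>2 * (\<Sum>i\<in>{1..n}. (snd (z i))\<^sup>2)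
      = (\<Sum>i\<in>{1..n}. ?d i - (snd (z i))\<^sup>2 * ?c) / (real n)\<^sup>2"
    unfolding sum_subtractf diff_divide_distrib sum_distrib_right[symmetric] times_divide_eq_left
      mult.commute[of ?c] ..
  ultimately show ?thesis by (simp only: abs_divide abs_power2)
qed

section \<open>The variance part of the loss\<close>

text \<open>
  Chosen such that \<open>E (exp (- Y\<^sup>2)) = exp (- 2 * square_rate)\<close>; it is positive because \<open>Y\<close> is not almost surely zero.
\<close>

definition square_rate :: real where "square_rate = - ln (expectation (\<lambda>z. exp (- (snd z)\<^sup>2))) / 2"

lemma exp_neg_square_integrable: "integrable Q (\<lambda>z. exp (- (snd z)\<^sup>2))"
  by (rule integrable_const_bound[of _ 1]) auto

lemma rate_facts: "0 < square_rate" "expectation (\<lambda>z. exp (- (snd z)\<^sup>2)) = exp (- 2 * square_rate)"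
proof -
  let ?r = "expectation (\<lambda>z. exp (- (snd z)\<^sup>2))"
  note int = exp_neg_square_integrable
  have "?r \<noteq> 0"
  proof
    assume "?r = 0"
    then have "AE z in Q. exp (- (snd z)\<^sup>2) = 0"
      using int by (subst (asm) integral_nonneg_eq_0_iff_AE) auto
    then have "AE z in Q. False" by simp
    then show False by (simp add: AE_False)
  qed
  moreover have "0 \<le> ?r" by simp
  ultimately have pos: "0 < ?r" by linarith
  have "expectation (\<lambda>z. 1 - exp (- (snd z)\<^sup>2)) \<noteq> 0"
  proof
    assume "expectation (\<lambda>z. 1 - exp (- (snd z)\<^sup>2)) = 0"
    then have "AE z in Q. 1 - exp (- (snd z)\<^sup>2) = 0"
      using int by (subst (asm) integral_nonneg_eq_0_iff_AE) auto
    then have "AE z in Q. snd z = 0" by eventually_elim simp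
    then show False using nondegenerate by simp
  qed
  moreover have "0 \<le> expectation (\<lambda>z. 1 - exp (- (snd z)\<^sup>2))" by (rule Bochner_Integration.integral_nonneg) simp
  moreover have "expectation (\<lambda>z. 1 - exp (- (snd z)\<^sup>2)) = 1 - ?r" using int by simp
  ultimately have lt: "?r < 1" by linarith
  show "0 < square_rate" using pos lt by (simp add: square_rate_def)
  show "?r = exp (- 2 * square_rate)" using pos by (simp add: square_rate_def)
qed

definition square_noise :: "nat \<Rightarrow> (nat \<Rightarrow> real \<times> real) \<Rightarrow> real"
  where "square_noise n z = exp (\<Sum>i\<in>{1..n}. square_rate - (snd (z i))\<^sup>2)"

text \<open>
  Chernoff's method at every sample point: where the empirical second moment is below \<open>square_rate\<close>, the exponential
  \<open>square_noise\<close> is at least \<open>1\<close>, and its expectation \<open>exp (- n * square_rate)\<close> is of smaller order than \<open>1 / n\<close>.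
\<close>

lemma mean_square_lower: "square_rate \<le> (\<Sum>i\<in>{1..n}. (snd (z i))\<^sup>2) / real n + square_rate * square_noise n z" if "0 < n"
proof (cases "square_rate \<le> (\<Sum>i\<in>{1..n}. (snd (z i))\<^sup>2) / real n")
  case True
  then show ?thesis using rate_facts(1) by (simp add: square_noise_def add_increasing2)
next
  case False
  then have "0 \<le> (\<Sum>i\<in>{1..n}. square_rate - (snd (z i))\<^sup>2)"
    using that by (simp add: sum_subtractf field_simps)
  then have "1 \<le> square_noise n z" by (simp add: square_noise_def)
  then have "square_rate * 1 \<le> square_rate * square_noise n z" using rate_facts(1) by (intro mult_left_mono) auto
  moreover have "0 \<le> (\<Sum>i\<in>{1..n}. (snd (z i))\<^sup>2) / real n" by (simp add: sum_nonneg)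
  ultimately show ?thesis by simp
qed

lemma square_noise_expectation:
  assumes n: "0 < n"
  shows "integrable (PiM {1..n} (\<lambda>_. Q)) (square_noise n)" "(\<integral>z. square_noise n z \<partial>PiM {1..n} (\<lambda>_. Q)) \<le> 1 / (square_rate * real n)"
proof -
  have comp: "(\<lambda>z. square_rate - (snd (z i))\<^sup>2) \<in> borel_measurable (PiM {1..n} (\<lambda>_. Q))" if "i \<in> {1..n}" for i
  proof -
    have [measurable]: "(\<lambda>z. z i) \<in> measurable (PiM {1..n} (\<lambda>_. Q)) Q" using that by auto
    show ?thesis by measurable
  qed
  have [measurable]: "(\<lambda>z. \<Sum>i\<in>{1..n}. square_rate - (snd (z i))\<^sup>2) \<in> borel_measurable (PiM {1..n} (\<lambda>_. Q))"
    by (intro borel_measurable_sum comp)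
  have m: "square_noise n \<in> borel_measurable (PiM {1..n} (\<lambda>_. Q))"
    unfolding square_noise_def[abs_def] by measurable
  have "(\<integral>\<^sup>+z. ennreal (square_noise n z) \<partial>PiM {1..n} (\<lambda>_. Q)) = (\<integral>\<^sup>+y. ennreal (exp (square_rate - (snd y)\<^sup>2)) \<partial>Q) ^ n"
    unfolding square_noise_def using nn_integral_exp_sum_iid[of "{1..n}" "\<lambda>y. square_rate - (snd y)\<^sup>2"] by simp
  also have "(\<integral>\<^sup>+y. ennreal (exp (square_rate - (snd y)\<^sup>2)) \<partial>Q) = ennreal (exp (- square_rate))"
  proof -
    have eq: "exp (square_rate - (snd y)\<^sup>2) = exp square_rate * exp (- (snd y)\<^sup>2)" for y :: "real \<times> real"
      by (simp add: exp_add[symmetric])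
    have "(\<integral>\<^sup>+y. ennreal (exp (square_rate - (snd y)\<^sup>2)) \<partial>Q) = ennreal (expectation (\<lambda>y. exp square_rate * exp (- (snd y)\<^sup>2)))"
      unfolding eq by (rule nn_integral_eq_integral) (auto simp: exp_neg_square_integrable)
    also have "expectation (\<lambda>y. exp square_rate * exp (- (snd y)\<^sup>2)) = exp (- square_rate)"
    proof -
      have "expectation (\<lambda>y. exp square_rate * exp (- (snd y)\<^sup>2)) = exp square_rate * exp (- 2 * square_rate)"
        using exp_neg_square_integrable unfolding rate_facts(2)[symmetric] by simp
      also have "\<dots> = exp (- square_rate)" unfolding exp_add[symmetric] by simp
      finally show ?thesis .
    qed
    finally show ?thesis .
  qed
  also have "ennreal (exp (- square_rate)) ^ n = ennreal (exp (- (real n * square_rate)))"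
    by (simp add: ennreal_power exp_of_nat_mult[symmetric])
  also have "\<dots> \<le> ennreal (1 / (square_rate * real n))"
  proof (rule ennreal_leI)
    have "square_rate * real n \<le> exp (real n * square_rate)" 
      using exp_ge_add_one_self[of "real n * square_rate"] unfolding mult.commute[of square_rate] by linarith
    then show "exp (- (real n * square_rate)) \<le> 1 / (square_rate * real n)"
      using rate_facts(1) n by (simp add: exp_minus inverse_eq_divide frac_le)
  qed
  finally have le: "(\<integral>\<^sup>+z. ennreal (square_noise n z) \<partial>PiM {1..n} (\<lambda>_. Q)) \<le> ennreal (1 / (square_rate * real n))" .
  have nn: "0 \<le> square_noise n z" for z by (simp add: square_noise_def)
  have "0 \<le> 1 / (square_rate * real n)" using rate_facts(1) by simp
  from integrable_of_nn_integral_le[OF m nn le this]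
  show "integrable (PiM {1..n} (\<lambda>_. Q)) (square_noise n)" "(\<integral>z. square_noise n z \<partial>PiM {1..n} (\<lambda>_. Q)) \<le> 1 / (square_rate * real n)"
    by auto
qed

lemma diag_noise_expectation:
  assumes n: "0 < n"
  shows "integrable (PiM {1..n} (\<lambda>_. Q)) (diag_noise n)"
    "(\<integral>z. diag_noise n z \<partial>PiM {1..n} (\<lambda>_. Q)) = diag_const * (expectation (\<lambda>y. \<bar>snd y\<bar>) + 1) / real n"
proof -
  interpret P: prob_space "PiM {1..n} (\<lambda>_. Q)" by (intro prob_space_PiM prob_space_axioms)
  have comp: "integrable (PiM {1..n} (\<lambda>_. Q)) (\<lambda>z. \<bar>snd (z i)\<bar>)
      \<and> (\<integral>z. \<bar>snd (z i)\<bar> \<partial>PiM {1..n} (\<lambda>_. Q)) = expectation (\<lambda>y. \<bar>snd y\<bar>)" if i: "i \<in> {1..n}" for i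
  proof -
    have m: "(\<lambda>z. z i) \<in> measurable (PiM {1..n} (\<lambda>_. Q)) Q" using i by auto
    have a: "(\<lambda>y. \<bar>snd y\<bar>) \<in> borel_measurable Q" by measurable
    have d: "distr (PiM {1..n} (\<lambda>_. Q)) Q (\<lambda>z. z i) = Q"
      by (rule distr_PiM_component[OF prob_space_axioms i])
    show ?thesis
      using integrable_distr_eq[OF m a] integral_distr[OF m a] snd_integrable unfolding d by simp
  qed
  show "integrable (PiM {1..n} (\<lambda>_. Q)) (diag_noise n)"
    unfolding diag_noise_def[abs_def]
    by (intro integrable_divide integrable_mult_right Bochner_Integration.integrable_sum
        Bochner_Integration.integrable_add P.integrable_const conjunct1[OF comp])
  have "(\<integral>z. diag_noise n z \<partial>PiM {1..n} (\<lambda>_. Q))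
      = diag_const * (\<Sum>i\<in>{1..n}. expectation (\<lambda>y. \<bar>snd y\<bar>) + 1) / (real n)\<^sup>2"
    unfolding diag_noise_def using comp by (simp add: Bochner_Integration.integral_sum P.prob_space del: One_nat_def)
  then show "(\<integral>z. diag_noise n z \<partial>PiM {1..n} (\<lambda>_. Q)) = diag_const * (expectation (\<lambda>y. \<bar>snd y\<bar>) + 1) / real n"
    using n by (simp add: power2_eq_square)
qed

section \<open>The oracle inequality at every sample point\<close>

text \<open>
  Only \<open>||e_k - e_m||^2 = ||e_k - s||^2 - 2 <e_k - s, e_m - s> + ||e_m - s||^2\<close> is used, for \<open>k = g\<close> and \<open>k = h\<close>; the last
  term cancels.
\<close>

lemma loss_selection:
  assumes pos: "0 < h" "0 < g" "0 < m"
    and sel: "criterion n m g z \<le> criterion n m h z"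
  shows "loss n g z \<le> loss n h z
    + 2 * (penalty n m h z / 2 - L2_inner (\<lambda>x. est n h z x - s x) (\<lambda>x. est n m z x - s x))
    - 2 * (penalty n m g z / 2 - L2_inner (\<lambda>x. est n g z x - s x) (\<lambda>x. est n m z x - s x))"
proof -
  have "(L2_norm (\<lambda>x. est n k z x - est n m z x))\<^sup>2
      = loss n k z - 2 * L2_inner (\<lambda>x. est n k z x - s x) (\<lambda>x. est n m z x - s x) + loss n m z"
    if "0 < k" for k
    using L2_norm_square_diff[OF bounded_integrable_diff[OF est_bi[OF that, of n z] s_bi]
        bounded_integrable_diff[OF est_bi[OF pos(3), of n z] s_bi]]
    by (simp add: loss_def)
  from this[OF pos(1)] this[OF pos(2)] show ?thesis
    using sel by (simp add: criterion_def)
qed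

lemma loss_eq:
  assumes "0 < n" "0 < h"
  shows "loss n h z = L2_inner (devsum h {1..n} z) (devsum h {1..n} z) / (real n)\<^sup>2
      + 2 * (L2_inner (bias h) (devsum h {1..n} z) / real n) + bias_sq h"
  unfolding loss_def bias_sq_def L2_norm_square L2_inner_errors[OF assms assms(2)] by simp

text \<open>
  Half the penalty cancels the squares \<open>Y_i\<^sup>2\<close> in the diagonal of \<open><e_h - s, e_m - s>\<close>. The remaining terms are the hypotheses
  \<open>U\<close>, \<open>B1\<close>, \<open>B2\<close>, the diagonal error and the product of two deterministic biases.
\<close>

lemma criterion_error:
  assumes n: "0 < n" and h: "0 < h" and m: "0 < m" and eta: "0 < \<eta>" "\<eta> \<le> 1" and X: "0 \<le> X"
    and U: "\<bar>offdiag n h m z\<bar> / (real n)\<^sup>2 \<le> \<eta> / (real n * h) + X / \<eta>"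
    and B1: "\<bar>L2_inner (bias m) (devsum h {1..n} z)\<bar> / real n \<le> \<eta> * (L2_norm (bias m))\<^sup>2 + X / \<eta>"
    and B2: "\<bar>L2_inner (bias h) (devsum m {1..n} z)\<bar> / real n \<le> \<eta> * (L2_norm (bias h))\<^sup>2 + X / \<eta>"
  shows "\<bar>penalty n m h z / 2 - L2_inner (\<lambda>x. est n h z x - s x) (\<lambda>x. est n m z x - s x)\<bar>
    \<le> 2 * \<eta> * (1 / (real n * h) + bias_sq h) + (2 * bias_sq m + 3 * X + diag_noise n z) / \<eta>"
proof -
  let ?d = "(\<Sum>i\<in>{1..n}. L2_inner (dev h (z i)) (dev m (z i))) / (real n)\<^sup>2"
  let ?p = "L2_inner (Kh h) (Kh m) / (real n)\<^sup>2 * (\<Sum>i\<in>{1..n}. (snd (z i))\<^sup>2)"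
  have pen: "penalty n m h z / 2 = ?p"
    by (simp add: penalty_def L2_inner_commute[of "Kh m"])
  have err: "L2_inner (\<lambda>x. est n h z x - s x) (\<lambda>x. est n m z x - s x)
      = ?d + offdiag n h m z / (real n)\<^sup>2 + L2_inner (bias m) (devsum h {1..n} z) / real n
        + L2_inner (bias h) (devsum m {1..n} z) / real n + L2_inner (bias h) (bias m)"
    unfolding L2_inner_errors[OF n h m] L2_inner_devsum_devsum[OF h m] by (simp add: add_divide_distrib)
  have b: "0 \<le> bias_sq h" "0 \<le> bias_sq m" by (simp_all add: bias_sq_def)
  have y: "2 * \<bar>L2_inner (bias h) (bias m)\<bar> \<le> \<eta> * bias_sq h + bias_sq m / \<eta>"
    unfolding bias_sq_def by (rule L2_inner_young[OF bias_bi[OF h] bias_bi[OF m] eta(1)])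
  have dn: "\<bar>?d - ?p\<bar> \<le> diag_noise n z" by (rule diagonal_sum[OF n h m])
  have ie: "1 \<le> 1 / \<eta>" using eta by simp
  have e1: "diag_noise n z \<le> diag_noise n z / \<eta>"
    using mult_left_mono[OF ie diag_noise_nonneg[of n z]] by simp
  have e2: "\<eta> * bias_sq m \<le> bias_sq m / \<eta>"
  proof -
    have "\<eta> \<le> 1 / \<eta>" using eta ie by linarith
    from mult_right_mono[OF this b(2)] show ?thesis by simp
  qed
  have U': "\<bar>offdiag n h m z / (real n)\<^sup>2\<bar> \<le> \<eta> / (real n * h) + X / \<eta>"
    and B1': "\<bar>L2_inner (bias m) (devsum h {1..n} z) / real n\<bar> \<le> \<eta> * bias_sq m + X / \<eta>"
    and B2': "\<bar>L2_inner (bias h) (devsum m {1..n} z) / real n\<bar> \<le> \<eta> * bias_sq h + X / \<eta>"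
    using U B1 B2 by (simp_all add: bias_sq_def abs_divide)
  have v: "0 \<le> \<eta> / (real n * h)" "0 \<le> \<eta> * bias_sq h" "0 \<le> bias_sq m / \<eta>" using eta h b by simp_all
  have "\<bar>?p - L2_inner (\<lambda>x. est n h z x - s x) (\<lambda>x. est n m z x - s x)\<bar>
      \<le> diag_noise n z + (\<eta> / (real n * h) + X / \<eta>) + (\<eta> * bias_sq m + X / \<eta>) + (\<eta> * bias_sq h + X / \<eta>)
        + \<bar>L2_inner (bias h) (bias m)\<bar>"
    unfolding err using dn U' B1' B2' by linarith
  also have "\<dots> \<le> 2 * (\<eta> / (real n * h)) + 2 * (\<eta> * bias_sq h) + 2 * (bias_sq m / \<eta>) + 3 * (X / \<eta>) + diag_noise n z / \<eta>"
  proof -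
    have "N + (w + x) + (p + x) + (u + x) + i \<le> 2 * w + 2 * u + 2 * r + 3 * x + N'"
      if "2 * i \<le> u + r" "N \<le> N'" "p \<le> r" "0 \<le> w" "0 \<le> u" "0 \<le> r" for N N' w x p u i r :: real
      using that by linarith
    from this[OF y e1 e2 v] show ?thesis .
  qed
  also have "\<dots> = 2 * \<eta> * (1 / (real n * h) + bias_sq h) + (2 * bias_sq m + 3 * X + diag_noise n z) / \<eta>"
    by (simp add: distrib_left add_divide_distrib)
  finally show ?thesis unfolding pen .
qed

text \<open>
  Leaves half of the variance term \<open>K_L2\<^sup>2 * square_rate / (nh)\<close> of the loss after the off-diagonal noise is subtracted.
\<close>

definition risk_slack :: real where "risk_slack = min 1 (K_L2\<^sup>2 * square_rate / 2)"

lemma risk_slack_bounds: "0 < risk_slack" "risk_slack \<le> 1" "risk_slack \<le> K_L2\<^sup>2 * square_rate / 2"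
  using K_L2_pos rate_facts(1) by (auto simp: risk_slack_def)

text \<open>
  The loss is not only close to bias plus variance in expectation: for every sample point it dominates both, up to the
  remainders. The variance part comes from the diagonal \<open>(K_L2\<^sup>2 / (n\<^sup>2 h)) \<Sum> Y_i\<^sup>2\<close>, whose size is given by
  \<open>mean_square_lower\<close>.
\<close>

lemma risk_lower_bound:
  assumes n: "0 < n" and h: "0 < h" and nh: "1 \<le> real n * h" and X: "0 \<le> X"
    and U: "\<bar>offdiag n h h z\<bar> / (real n)\<^sup>2 \<le> risk_slack / (real n * h) + X / risk_slack"
    and B: "\<bar>L2_inner (bias h) (devsum h {1..n} z)\<bar> / real n \<le> (1 / 4) * (L2_norm (bias h))\<^sup>2 + X / (1 / 4)"
  shows "K_L2\<^sup>2 * square_rate / 2 * (1 / (real n * h)) + bias_sq h / 2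
    \<le> loss n h z + (X / risk_slack + 8 * X + diag_noise n z + K_L2\<^sup>2 * square_rate * square_noise n z)"
proof -
  let ?v = "1 / (real n * h)"
  let ?S = "\<Sum>i\<in>{1..n}. (snd (z i))\<^sup>2"
  let ?d = "(\<Sum>i\<in>{1..n}. L2_inner (dev h (z i)) (dev h (z i))) / (real n)\<^sup>2"
  have v: "0 \<le> ?v" "?v \<le> 1" using h nh by auto
  have KK: "L2_inner (Kh h) (Kh h) = K_L2\<^sup>2 / h"
    using L2_norm_square[of "Kh h"] h by (simp add: Kh_norm power_divide)
  have dn: "\<bar>?d - K_L2\<^sup>2 / h / (real n)\<^sup>2 * ?S\<bar> \<le> diag_noise n z"
    using diagonal_sum[OF n h h, of z] unfolding KK .
  have n3: "0 \<le> square_noise n z" by (simp add: square_noise_def)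
  have "K_L2\<^sup>2 * ?v * square_rate \<le> K_L2\<^sup>2 * ?v * (?S / real n + square_rate * square_noise n z)"
    using mean_square_lower[OF n] v by (intro mult_left_mono) auto
  also have "\<dots> = K_L2\<^sup>2 / h / (real n)\<^sup>2 * ?S + K_L2\<^sup>2 * square_rate * square_noise n z * ?v"
    by (simp add: distrib_left power2_eq_square mult_ac)
  also have "K_L2\<^sup>2 * square_rate * square_noise n z * ?v \<le> K_L2\<^sup>2 * square_rate * square_noise n z * 1"
    using v rate_facts(1) n3 by (intro mult_left_mono) auto
  finally have low: "K_L2\<^sup>2 * square_rate * ?v \<le> K_L2\<^sup>2 / h / (real n)\<^sup>2 * ?S + K_L2\<^sup>2 * square_rate * square_noise n z"
    by (simp add: mult_ac)
  have U': "\<bar>offdiag n h h z / (real n)\<^sup>2\<bar> \<le> risk_slack * ?v + X / risk_slack"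
    and B': "\<bar>L2_inner (bias h) (devsum h {1..n} z) / real n\<bar> \<le> bias_sq h / 4 + 4 * X"
    using U B by (simp_all add: bias_sq_def abs_divide)
  have ev: "risk_slack * ?v \<le> K_L2\<^sup>2 * square_rate / 2 * ?v" using risk_slack_bounds(3) v(1) by (rule mult_right_mono)
  have eq: "loss n h z = ?d + offdiag n h h z / (real n)\<^sup>2
      + 2 * (L2_inner (bias h) (devsum h {1..n} z) / real n) + bias_sq h"
    unfolding loss_eq[OF n h] L2_inner_devsum_devsum[OF h h] by (simp add: add_divide_distrib)
  define vv where "vv = ?v"
  define A where "A = K_L2\<^sup>2 * square_rate"
  define T where "T = K_L2\<^sup>2 / h / (real n)\<^sup>2 * ?S"
  have half: "A / 2 * vv = (A * vv) / 2" by simp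
  show ?thesis
    using low U' B' ev dn unfolding eq vv_def[symmetric] A_def[symmetric] T_def[symmetric] half by linarith
qed

definition oracle_bound :: "nat \<Rightarrow> real set \<Rightarrow> real \<Rightarrow> ((nat \<Rightarrow> real \<times> real) \<Rightarrow> real) \<Rightarrow> bool"
  where "oracle_bound n H A \<Xi> \<longleftrightarrow> (\<forall>z. \<forall>\<theta>\<in>{0<..<1}. \<forall>m\<in>H. \<forall>h\<in>H. \<forall>g\<in>H.
      criterion n m g z \<le> criterion n m h z \<longrightarrow>
      loss n g z \<le> (1 + \<theta>) * loss n h z + A / \<theta> * bias_sq m + \<Xi> z / \<theta>)"

text \<open>
  The errors of \<open>criterion_error\<close> for the selected and the competing bandwidth are bounded by the respective losses through
  \<open>risk_lower_bound\<close>. With \<open>\<eta> = \<theta> / (16 C1)\<close> they cost \<open>\<theta> / 4\<close> of each loss, and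
  \<open>(1 + \<theta> / 4) / (1 - \<theta> / 4) \<le> 1 + \<theta>\<close>.
\<close>

lemma pathwise_oracle_inequality:
  "\<exists>A>0. \<exists>C>0. \<forall>n H. bandwidths n H \<longrightarrow>
    (\<exists>\<Xi>. remainder n (C * (ln (real n) ^ 5 / real n)) \<Xi> \<and> oracle_bound n H A \<Xi>)"
proof -
  from noise_control obtain C where C: "0 < C" and noise: "\<And>n H. bandwidths n H \<Longrightarrow>
      \<exists>X. remainder n (C * (ln (real n) ^ 5 / real n)) X \<and> noise_bound n H X"
    by blast
  define q where "q = K_L2\<^sup>2 * square_rate"
  have q: "0 < q" using K_L2_pos rate_facts(1) by (simp add: q_def)
  define M where "M = min (q / 2) (1 / 2)"
  have M: "0 < M" "M \<le> q / 2" "M \<le> 1 / 2" using q by (auto simp: M_def)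
  define C' where "C' = 1 / risk_slack + 9 + q"
  have C': "1 \<le> C'" using q risk_slack_bounds(1) by (simp add: C'_def add_nonneg_nonneg add_increasing)
  define C1 where "C1 = C' / M"
  have C1: "1 \<le> C1" using C' M by (simp add: C1_def le_divide_eq)
  define e where "e = diag_const * (expectation (\<lambda>y. \<bar>snd y\<bar>) + 1) + 1 / square_rate"
  have e: "0 < e"
  proof -
    have "0 \<le> expectation (\<lambda>y. \<bar>snd y\<bar>)" by simp
    then have "0 \<le> diag_const * (expectation (\<lambda>y. \<bar>snd y\<bar>) + 1)" using diag_const_nonneg by (intro mult_nonneg_nonneg) auto
    moreover have "0 < 1 / square_rate" using rate_facts(1) by simp
    ultimately show ?thesis by (simp only: e_def add_nonneg_pos)
  qed
  have key: "\<exists>\<Xi>. remainder n (385 * C1 * (C + 32 * e) * (ln (real n) ^ 5 / real n)) \<Xi>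
      \<and> oracle_bound n H (256 * C1) \<Xi>"
    if bw: "bandwidths n H" for n H
  proof -
    note H = bandwidthsD(1,2,4)[OF bw] and n = bandwidthsD(5)[OF bw]
    let ?P = "PiM {1..n} (\<lambda>_. Q)"
    let ?l = "ln (real n)"
    have n0: "0 < n" using n by simp
    have l: "1 / 2 \<le> ?l" by (rule ln_ge_half[OF n])
    obtain X where X: "integrable ?P X" "\<forall>z. 0 \<le> X z" "(\<integral>z. X z \<partial>?P) \<le> C * (?l ^ 5 / real n)"
        and nb: "noise_bound n H X"
      using noise[OF bw] unfolding remainder_def by blast
    have Xn: "0 \<le> X z" for z using X(2) by blast
    note UB = noise_boundD(1)[OF nb] and BB = noise_boundD(2)[OF nb]
    have Hpos: "0 < h" "1 \<le> real n * h" if "h \<in> H" for h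
    proof -
      have h: "1 / real n < h" using H(3) that by blast
      then show "0 < h" using n0 less_trans[of 0 "1 / real n" h] by simp
      show "1 \<le> real n * h" using h n0 by (simp add: divide_less_eq mult.commute)
    qed
    define \<Psi> where "\<Psi> z = X z + (diag_noise n z + square_noise n z)" for z
    have n3: "0 \<le> square_noise n z" for z by (simp add: square_noise_def)
    have Psi0: "0 \<le> \<Psi> z" for z using Xn[of z] diag_noise_nonneg[of n z] n3[of z] by (simp add: \<Psi>_def)
    have int: "integrable ?P \<Psi>"
      unfolding \<Psi>_def[abs_def]
      by (intro Bochner_Integration.integrable_add X diag_noise_expectation(1) square_noise_expectation(1) n0)
    have alg: "C * t + e * (32 * t) = (C + 32 * e) * t" for t by (simp add: algebra_simps)
    have "(\<integral>z. \<Psi> z \<partial>?P) = (\<integral>z. X z \<partial>?P) + ((\<integral>z. diag_noise n z \<partial>?P) + (\<integral>z. square_noise n z \<partial>?P))"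
      unfolding \<Psi>_def using X(1) diag_noise_expectation(1)[OF n0] square_noise_expectation(1)[OF n0]
      by (simp del: One_nat_def)
    also have "\<dots> \<le> C * (?l ^ 5 / real n) + (diag_const * (expectation (\<lambda>y. \<bar>snd y\<bar>) + 1) / real n + 1 / (square_rate * real n))"
      using X(3) diag_noise_expectation(2)[OF n0] square_noise_expectation(2)[OF n0] by (intro add_mono) auto
    also have "\<dots> = C * (?l ^ 5 / real n) + e * (1 / real n)"
      by (simp add: e_def add_divide_distrib)
    also have "\<dots> \<le> C * (?l ^ 5 / real n) + e * (32 * (?l ^ 5 / real n))"
    proof -
      have "1 \<le> 32 * ?l ^ 5" using power_mono[OF l, of 5] by (simp add: power_divide)
      then have "1 / real n \<le> 32 * (?l ^ 5 / real n)" by (simp add: divide_right_mono)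
      then show ?thesis using e by (intro add_left_mono mult_left_mono) auto
    qed
    finally have EPsi: "(\<integral>z. \<Psi> z \<partial>?P) \<le> (C + 32 * e) * (?l ^ 5 / real n)"
      using alg[of "?l ^ 5 / real n"] by linarith
    have low: "1 / (real n * h) + bias_sq h \<le> C1 * (loss n h z + \<Psi> z)" if h: "h \<in> H" for h z
    proof -
      have v: "0 \<le> 1 / (real n * h)" "0 \<le> bias_sq h" using Hpos[OF h] by (auto simp: bias_sq_def)
      have "M * (1 / (real n * h) + bias_sq h) \<le> q / 2 * (1 / (real n * h)) + 1 / 2 * bias_sq h"
        unfolding distrib_left using M v by (intro add_mono mult_right_mono) auto
      also have "\<dots> \<le> loss n h z + (X z / risk_slack + 8 * X z + diag_noise n z + q * square_noise n z)"
        using risk_lower_bound[OF n0 Hpos[OF h] Xn UB[OF h h risk_slack_bounds(1,2)] BB[OF h h]]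
        by (simp add: q_def)
      also have "\<dots> \<le> C' * (loss n h z + \<Psi> z)"
      proof -
        have L: "0 \<le> loss n h z" by (simp add: loss_def)
        have x1: "0 \<le> X z / risk_slack" "0 \<le> q * X z" "0 \<le> diag_noise n z / risk_slack" "0 \<le> q * diag_noise n z" "0 \<le> square_noise n z / risk_slack"
          "0 \<le> loss n h z / risk_slack" "0 \<le> q * loss n h z"
          using Xn[of z] diag_noise_nonneg[of n z] n3[of z] q risk_slack_bounds(1) L by auto
        have "C' * (loss n h z + \<Psi> z) = loss n h z / risk_slack + 9 * loss n h z + q * loss n h z
            + (X z / risk_slack + 9 * X z + q * X z) + (diag_noise n z / risk_slack + 9 * diag_noise n z + q * diag_noise n z)
            + (square_noise n z / risk_slack + 9 * square_noise n z + q * square_noise n z)"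
          by (simp add: C'_def \<Psi>_def distrib_left distrib_right)
        then show ?thesis using x1 L Xn[of z] diag_noise_nonneg[of n z] n3[of z] by linarith
      qed
      finally show ?thesis using M(1) by (simp add: C1_def pos_le_divide_eq mult.commute)
    qed
    have main: "loss n g z \<le> (1 + \<theta>) * loss n h z + 256 * C1 / \<theta> * bias_sq m + (385 * C1 * \<Psi> z) / \<theta>"
      if th: "0 < \<theta>" "\<theta> < 1" and mem: "m \<in> H" "h \<in> H" "g \<in> H" and crit: "criterion n m g z \<le> criterion n m h z"
      for \<theta> m h g z
    proof -
      define \<eta> where "\<eta> = \<theta> / (16 * C1)"
      have eta: "0 < \<eta>" "\<eta> \<le> 1" using th C1 by (auto simp: \<eta>_def divide_le_eq)
      have L: "0 \<le> loss n k z" for k by (simp add: loss_def)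
      have bm: "0 \<le> bias_sq m" by (simp add: bias_sq_def)
      have one: "2 * \<bar>penalty n m k z / 2 - L2_inner (\<lambda>x. est n k z x - s x) (\<lambda>x. est n m z x - s x)\<bar>
          \<le> \<theta> / 4 * (loss n k z + \<Psi> z) + (2 * bias_sq m + 3 * \<Psi> z) * (32 * C1 / \<theta>)" if k: "k \<in> H" for k
      proof -
        have "\<bar>penalty n m k z / 2 - L2_inner (\<lambda>x. est n k z x - s x) (\<lambda>x. est n m z x - s x)\<bar>
            \<le> 2 * \<eta> * (1 / (real n * k) + bias_sq k) + (2 * bias_sq m + 3 * X z + diag_noise n z) / \<eta>"
          by (rule criterion_error[OF n0 Hpos(1)[OF k] Hpos(1)[OF mem(1)] eta Xn
                UB[OF k mem(1) eta] BB[OF k mem(1) eta] BB[OF mem(1) k eta]])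
        also have "\<dots> \<le> 2 * \<eta> * (C1 * (loss n k z + \<Psi> z)) + (2 * bias_sq m + 3 * \<Psi> z) / \<eta>"
        proof (rule add_mono)
          show "2 * \<eta> * (1 / (real n * k) + bias_sq k) \<le> 2 * \<eta> * (C1 * (loss n k z + \<Psi> z))"
            using eta low[OF k, of z] by (intro mult_left_mono) auto
          have "2 * bias_sq m + 3 * X z + diag_noise n z \<le> 2 * bias_sq m + 3 * \<Psi> z"
          proof -
            have "a + 3 * x + u \<le> a + 3 * (x + (u + v))" if "0 \<le> u" "0 \<le> v" for a x u v :: real
              using that by (simp add: distrib_left)
            from this[OF diag_noise_nonneg[of n z] n3[of z]] show ?thesis unfolding \<Psi>_def .
          qed
          then show "(2 * bias_sq m + 3 * X z + diag_noise n z) / \<eta> \<le> (2 * bias_sq m + 3 * \<Psi> z) / \<eta>"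
            using eta by (intro divide_right_mono) auto
        qed
        also have "2 * \<eta> * (C1 * (loss n k z + \<Psi> z)) = \<theta> / 8 * (loss n k z + \<Psi> z)"
          using C1 by (simp add: \<eta>_def)
        also have "(2 * bias_sq m + 3 * \<Psi> z) / \<eta> = (2 * bias_sq m + 3 * \<Psi> z) * (16 * C1 / \<theta>)"
          by (simp add: \<eta>_def)
        finally have "\<bar>penalty n m k z / 2 - L2_inner (\<lambda>x. est n k z x - s x) (\<lambda>x. est n m z x - s x)\<bar>
            \<le> \<theta> / 8 * (loss n k z + \<Psi> z) + (2 * bias_sq m + 3 * \<Psi> z) * (16 * C1 / \<theta>)" .
        moreover have "2 * p \<le> \<theta> / 4 * u + v * (32 * C1 / \<theta>)"
          if "p \<le> \<theta> / 8 * u + v * (16 * C1 / \<theta>)" for p u v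
        proof -
          have "2 * p \<le> 2 * (\<theta> / 8 * u + v * (16 * C1 / \<theta>))" using that by simp
          also have "\<dots> = \<theta> / 4 * u + v * (32 * C1 / \<theta>)" by (simp add: distrib_left)
          finally show ?thesis .
        qed
        ultimately show ?thesis by blast
      qed
      \<comment> \<open>everything on the right that is not a multiple of one of the two losses\<close>
      define R where "R = \<theta> / 2 * \<Psi> z + (2 * bias_sq m + 3 * \<Psi> z) * (64 * C1 / \<theta>)"
      have R0: "0 \<le> R" using th bm Psi0[of z] C1 by (simp add: R_def)
      have "loss n g z \<le> loss n h z + \<theta> / 4 * (loss n h z + \<Psi> z) + \<theta> / 4 * (loss n g z + \<Psi> z)
          + 2 * ((2 * bias_sq m + 3 * \<Psi> z) * (32 * C1 / \<theta>))"
      proof -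
        have "lg \<le> lh + u + v + 2 * w"
          if "lg \<le> lh + 2 * p - 2 * r" "2 * \<bar>p\<bar> \<le> u + w" "2 * \<bar>r\<bar> \<le> v + w" for lg lh p r u v w :: real
          using that by linarith
        from this[OF loss_selection[OF Hpos(1)[OF mem(2)] Hpos(1)[OF mem(3)] Hpos(1)[OF mem(1)] crit]
          one[OF mem(2)] one[OF mem(3)]] show ?thesis .
      qed
      then have A: "(1 - \<theta> / 4) * loss n g z \<le> (1 + \<theta> / 4) * loss n h z + R"
        by (simp add: R_def algebra_simps)
      have "(1 + \<theta> / 4) * loss n h z \<le> ((1 - \<theta> / 4) * (1 + \<theta>)) * loss n h z"
      proof (rule mult_right_mono[OF _ L])
        have "\<theta> * \<theta> \<le> \<theta> * 1" using th by (intro mult_left_mono) auto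
        moreover have "(1 - \<theta> / 4) * (1 + \<theta>) = 1 + 3 / 4 * \<theta> - \<theta> * \<theta> / 4" by (simp add: field_simps)
        ultimately show "1 + \<theta> / 4 \<le> (1 - \<theta> / 4) * (1 + \<theta>)" using th by linarith
      qed
      moreover have "R \<le> (1 - \<theta> / 4) * (2 * R)"
      proof -
        have "1 * R \<le> ((1 - \<theta> / 4) * 2) * R" using th R0 by (intro mult_right_mono) auto
        then show ?thesis by (simp only: mult.assoc mult_1)
      qed
      ultimately have "(1 - \<theta> / 4) * loss n g z \<le> (1 - \<theta> / 4) * ((1 + \<theta>) * loss n h z + 2 * R)"
        using A unfolding distrib_left[of "1 - \<theta> / 4" "(1 + \<theta>) * loss n h z"] mult.assoc by linarith
      then have "loss n g z \<le> (1 + \<theta>) * loss n h z + 2 * R"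
        by (rule mult_left_le_imp_le) (use th in simp)
      also have "2 * R \<le> 256 * C1 / \<theta> * bias_sq m + (385 * C1 * \<Psi> z) / \<theta>"
      proof -
        have "\<theta> \<le> C1 / \<theta>"
        proof -
          have "\<theta> * \<theta> \<le> 1 * 1" using th by (intro mult_mono) auto
          then show ?thesis using th C1 by (simp add: pos_le_divide_eq)
        qed
        then have "\<theta> * \<Psi> z \<le> C1 / \<theta> * \<Psi> z" using Psi0 by (rule mult_right_mono)
        moreover have "2 * R = \<theta> * \<Psi> z + 256 * C1 / \<theta> * bias_sq m + 384 * (C1 / \<theta> * \<Psi> z)"
          by (simp add: R_def distrib_left distrib_right add_divide_distrib mult_ac)
        moreover have "(385 * C1 * \<Psi> z) / \<theta> = 385 * (C1 / \<theta> * \<Psi> z)" by simp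
        ultimately show ?thesis by linarith
      qed
      finally show ?thesis by simp
    qed
    have E: "(\<integral>z. 385 * C1 * \<Psi> z \<partial>?P) \<le> (385 * C1 * (C + 32 * e)) * (?l ^ 5 / real n)"
    proof -
      have "385 * C1 * (\<integral>z. \<Psi> z \<partial>?P) \<le> 385 * C1 * ((C + 32 * e) * (?l ^ 5 / real n))"
        using EPsi C1 by (intro mult_left_mono) auto
      then show ?thesis by (simp add: mult.assoc)
    qed
    have "remainder n (385 * C1 * (C + 32 * e) * (?l ^ 5 / real n)) (\<lambda>z. 385 * C1 * \<Psi> z)"
      unfolding remainder_def
    proof (intro conjI allI)
      show "integrable ?P (\<lambda>z. 385 * C1 * \<Psi> z)" using int by (rule integrable_mult_right)
      show "0 \<le> 385 * C1 * \<Psi> z" for z using C1 Psi0[of z] by simp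
    qed (rule E)
    moreover have "oracle_bound n H (256 * C1) (\<lambda>z. 385 * C1 * \<Psi> z)"
      unfolding oracle_bound_def
    proof (intro allI ballI impI)
      show "loss n g z \<le> (1 + \<theta>) * loss n h z + 256 * C1 / \<theta> * bias_sq m + 385 * C1 * \<Psi> z / \<theta>"
        if "\<theta> \<in> {0<..<1}" "m \<in> H" "h \<in> H" "g \<in> H" "criterion n m g z \<le> criterion n m h z" for z \<theta> m h g
        using main[OF _ _ that(2-5)] that(1) by simp
    qed
    ultimately show ?thesis by blast
  qed
  have pos: "0 < 256 * C1" "0 < 385 * C1 * (C + 32 * e)" using C1 C e by (simp_all add: add_pos_pos)
  show ?thesis
    by (rule exI[of _ "256 * C1"], rule conjI[OF pos(1)], rule exI[of _ "385 * C1 * (C + 32 * e)"],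
        rule conjI[OF pos(2)], intro allI impI, rule key)
qed

text \<open>
  The squared norm of the centred sum is dominated by the exponential of its norm, which is integrable by
  \<open>exp_moment_devsum\<close>.
\<close>

lemma loss_integrable:
  assumes n: "2 \<le> n" and h: "0 < h" "h \<le> 1"
  shows "integrable (PiM {1..n} (\<lambda>_. Q)) (loss n h)"
proof -
  let ?P = "PiM {1..n} (\<lambda>_. Q)"
  interpret P: prob_space ?P by (intro prob_space_PiM prob_space_axioms)
  define c where "c = \<alpha> / (4 * dev_const) * sqrt (h * ln (real n) / real n)"
  have c: "0 < c" using \<alpha>_pos dev_const_pos h n ln_ge_half[OF n] by (simp add: c_def)
  note m1 = devsum_norm_meas[OF h(1) subset_refl[of "{1..n}"]]
  note bias_bi[OF h(1), THEN bounded_integrable_measurable, measurable]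
  have bm: "case_prod (\<lambda>z. bias h) \<in> borel_measurable (?P \<Otimes>\<^sub>M borel)" by measurable
  note m2 = L2_inner_measurable[OF bm devsum_meas[OF h(1) subset_refl]]
  note m3 = L2_inner_measurable[OF devsum_meas[OF h(1) subset_refl] devsum_meas[OF h(1) subset_refl]]
  note [measurable] = m1 m2 m3
  have em: "(\<lambda>z. exp (c * L2_norm (devsum h {1..n} z))) \<in> borel_measurable ?P" by measurable
  have "(\<integral>\<^sup>+z. ennreal (exp (c * L2_norm (devsum h {1..n} z))) \<partial>?P) \<le> ennreal (2 * exp (exp \<alpha> * exp_mom * ln (real n)))"
    unfolding c_def by (rule exp_moment_devsum[OF n h]) auto
  then have ei: "integrable ?P (\<lambda>z. exp (c * L2_norm (devsum h {1..n} z)))"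
    by (intro integrable_of_nn_integral_le(1)[OF em]) auto
  have n0: "0 < n" using n by simp
  let ?g = "\<lambda>z. 4 / (real n * c)\<^sup>2 * exp (c * L2_norm (devsum h {1..n} z)) + 2 * bias_sq h"
  have gi: "integrable ?P ?g"
    by (intro Bochner_Integration.integrable_add integrable_mult_right ei P.integrable_const)
  show ?thesis
  proof (rule Bochner_Integration.integrable_bound[OF gi])
    show "loss n h \<in> borel_measurable ?P"
      unfolding loss_eq[OF n0 h(1), abs_def] by measurable
    show "AE z in ?P. norm (loss n h z) \<le> norm (?g z)"
    proof (rule AE_I2)
      fix z
      let ?N = "L2_norm (devsum h {1..n} z)"
      have N: "0 \<le> ?N" by (rule L2_norm_nonneg)
      have b: "0 \<le> bias_sq h" by (simp add: bias_sq_def)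
      have y: "2 * \<bar>L2_inner (bias h) (\<lambda>x. 1 / real n * devsum h {1..n} z x)\<bar>
          \<le> 1 * (L2_norm (bias h))\<^sup>2 + (L2_norm (\<lambda>x. 1 / real n * devsum h {1..n} z x))\<^sup>2 / 1"
        using h by (intro L2_inner_young bias_bi bounded_integrable_cmult devsum_bi) auto
      have "loss n h z \<le> 2 * (?N / real n)\<^sup>2 + 2 * bias_sq h"
      proof -
        let ?i = "L2_inner (bias h) (devsum h {1..n} z) / real n"
        have "2 * \<bar>?i\<bar> \<le> bias_sq h + (?N / real n)\<^sup>2"
          using y unfolding L2_inner_cmult_right L2_norm_cmult by (simp add: bias_sq_def)
        moreover have "loss n h z = (?N / real n)\<^sup>2 + 2 * ?i + bias_sq h"
          unfolding loss_eq[OF n0 h(1)] L2_norm_square[symmetric] by (simp add: power_divide)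
        ultimately show ?thesis by linarith
      qed
      also have "2 * (?N / real n)\<^sup>2 \<le> 4 / (real n * c)\<^sup>2 * exp (c * ?N)"
      proof -
        have "2 * (?N / real n)\<^sup>2 = 2 / (real n * c)\<^sup>2 * (c * ?N)\<^sup>2"
          using c by (simp add: power_mult_distrib power_divide)
        also have "\<dots> \<le> 2 / (real n * c)\<^sup>2 * (2 * exp (c * ?N))"
          using c N by (intro mult_left_mono square_le_two_exp) auto
        finally show ?thesis by simp
      qed
      finally have le: "loss n h z \<le> ?g z" by simp
      moreover have "0 \<le> loss n h z" by (simp add: loss_def)
      ultimately show "norm (loss n h z) \<le> norm (?g z)" by simp
    qed
  qed
qed

lemma bf_estimator_eq:
  assumes z: "\<And>i. i \<in> {1..n} \<Longrightarrow> z i = (X i \<omega>, Y i \<omega>)"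
  shows "bf_estimator K n X Y h \<omega> = est n h z"
proof
  fix x
  have "(\<Sum>i=1..n. K ((X i \<omega> - x) / h) * Y i \<omega>) / (real n * h) = (\<Sum>i\<in>{1..n}. weight h (z i) x) / real n"
    unfolding sum_divide_distrib
    by (intro sum.cong refl) (simp add: weight_def scaled_kernel_def z mult.commute)
  then show "bf_estimator K n X Y h \<omega> x = est n h z x"
    by (simp add: bf_estimator_def est_def)
qed

lemma crit_eq:
  assumes z: "\<And>i. i \<in> {1..n} \<Longrightarrow> z i = (X i \<omega>, Y i \<omega>)"
  shows "crit K n H X Y \<omega> h = criterion n (Min H) h z"
proof -
  have "(\<Sum>i=1..n. (Y i \<omega>)\<^sup>2) = (\<Sum>i\<in>{1..n}. (snd (z i))\<^sup>2)"
    by (intro sum.cong) (auto simp: z)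
  moreover have "bf_estimator K n X Y k \<omega> = est n k z" for k
    by (rule bf_estimator_eq) (rule z)
  ultimately show ?thesis
    by (simp only: crit_def criterion_def pen_def penalty_def)
qed

end

section \<open>The law of a regression sample\<close>

definition sample_law :: "(real \<Rightarrow> real) \<Rightarrow> (real \<Rightarrow> real) \<Rightarrow> real measure \<Rightarrow> (real \<times> real) measure"
  where "sample_law f b \<nu> = distr (density lborel (\<lambda>x. ennreal (f x)) \<Otimes>\<^sub>M \<nu>) (borel \<Otimes>\<^sub>M borel) (\<lambda>(x, e). (x, b x + e))"

context regression_sample
begin

lemma X_measurable: "i \<in> {1..n} \<Longrightarrow> random_variable borel (X i)"
  using distributed_measurable[OF X_density] by simp

lemma X_\<epsilon>_pair_indep:
  assumes i: "i \<in> {1..n}"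
  shows "indep_var borel (X i) borel (\<epsilon> i)"
proof -
  have m: "(\<lambda>x. x i) \<in> measurable (PiM {1..n} (\<lambda>_. borel :: real measure)) borel" using i by auto
  have "indep_var borel ((\<lambda>x. x i) \<circ> (\<lambda>\<omega>. \<lambda>i\<in>{1..n}. X i \<omega>)) borel ((\<lambda>x. x i) \<circ> (\<lambda>\<omega>. \<lambda>i\<in>{1..n}. \<epsilon> i \<omega>))"
    by (rule indep_var_compose[OF X_\<epsilon>_indep m m])
  then show ?thesis using i by (simp add: comp_def)
qed

text \<open>
  The model only says that the two families are independent inside and that the two vectors are independent of each other.
  On rectangles the probability factorises into all \<open>2 n\<close> marginals, and rectangles generate the product
  sigma algebra of a pair.
\<close>

lemma pairs_indep: "indep_vars (\<lambda>_. borel \<Otimes>\<^sub>M borel) (\<lambda>i \<omega>. (X i \<omega>, \<epsilon> i \<omega>)) {1..n}"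
proof (cases "n = 0")
  case True
  then show ?thesis by (simp add: indep_vars_def indep_sets_def)
next
  case False
  let ?E = "{a \<times> b | a b. a \<in> sets (borel :: real measure) \<and> b \<in> sets (borel :: real measure)}"
  show ?thesis
  proof (subst indep_vars_finite[where E = "\<lambda>_. ?E"])
    show "{1..n} \<noteq> {}" "finite {1..n}" using False by auto
    show "sets (borel \<Otimes>\<^sub>M borel) = sigma_sets (space (borel \<Otimes>\<^sub>M borel)) ?E"
      by (simp add: sets_pair_measure space_pair_measure)
    show "random_variable (borel \<Otimes>\<^sub>M borel) (\<lambda>\<omega>. (X i \<omega>, \<epsilon> i \<omega>))" if "i \<in> {1..n}" for i
      using X_measurable[OF that] \<epsilon>_measurable[OF that] by measurable
    show "Int_stable ?E" by (rule Int_stable_pair_measure_generator)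
    show "space (borel \<Otimes>\<^sub>M borel) \<in> ?E" by (auto simp: space_pair_measure intro!: exI[of _ UNIV])
    show "?E \<subseteq> Pow (space (borel \<Otimes>\<^sub>M borel))" by (auto simp: space_pair_measure)
    show "\<forall>A\<in>{1..n} \<rightarrow> ?E. prob (\<Inter>j\<in>{1..n}. (\<lambda>\<omega>. (X j \<omega>, \<epsilon> j \<omega>)) -` A j \<inter> space M)
        = (\<Prod>j\<in>{1..n}. prob ((\<lambda>\<omega>. (X j \<omega>, \<epsilon> j \<omega>)) -` A j \<inter> space M))"
    proof
      fix A assume "A \<in> {1..n} \<rightarrow> ?E"
      then have "\<forall>j\<in>{1..n}. \<exists>a b. A j = a \<times> b \<and> a \<in> sets (borel :: real measure) \<and> b \<in> sets (borel :: real measure)"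
        by auto
      then obtain a b where ab: "\<And>j. j \<in> {1..n} \<Longrightarrow> A j = a j \<times> b j"
          "\<And>j. j \<in> {1..n} \<Longrightarrow> a j \<in> sets (borel :: real measure)"
          "\<And>j. j \<in> {1..n} \<Longrightarrow> b j \<in> sets (borel :: real measure)"
        by metis
      let ?X = "\<lambda>\<omega>. \<lambda>i\<in>{1..n}. X i \<omega>" and ?e = "\<lambda>\<omega>. \<lambda>i\<in>{1..n}. \<epsilon> i \<omega>"
      have "(\<Inter>j\<in>{1..n}. (\<lambda>\<omega>. (X j \<omega>, \<epsilon> j \<omega>)) -` A j \<inter> space M)
          = (\<lambda>\<omega>. (?X \<omega>, ?e \<omega>)) -` (Pi\<^sub>E {1..n} a \<times> Pi\<^sub>E {1..n} b) \<inter> space M"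
        using ab(1) False by (auto simp: PiE_iff)
      then have "prob (\<Inter>j\<in>{1..n}. (\<lambda>\<omega>. (X j \<omega>, \<epsilon> j \<omega>)) -` A j \<inter> space M)
          = prob (?X -` Pi\<^sub>E {1..n} a \<inter> space M) * prob (?e -` Pi\<^sub>E {1..n} b \<inter> space M)"
        using ab by (simp only:) (intro indep_varD[OF X_\<epsilon>_indep] sets_PiM_I_finite, auto)
      also have "?X -` Pi\<^sub>E {1..n} a \<inter> space M = (\<Inter>j\<in>{1..n}. X j -` a j \<inter> space M)"
        using False by (auto simp: PiE_iff)
      also have "?e -` Pi\<^sub>E {1..n} b \<inter> space M = (\<Inter>j\<in>{1..n}. \<epsilon> j -` b j \<inter> space M)"
        using False by (auto simp: PiE_iff)
      also have "prob (\<Inter>j\<in>{1..n}. X j -` a j \<inter> space M) = (\<Prod>j\<in>{1..n}. prob (X j -` a j \<inter> space M))"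
        using ab(2) False by (intro indep_varsD[OF X_indep]) auto
      also have "prob (\<Inter>j\<in>{1..n}. \<epsilon> j -` b j \<inter> space M) = (\<Prod>j\<in>{1..n}. prob (\<epsilon> j -` b j \<inter> space M))"
        using ab(3) False by (intro indep_varsD[OF \<epsilon>_indep]) auto
      also have "(\<Prod>j\<in>{1..n}. prob (X j -` a j \<inter> space M)) * (\<Prod>j\<in>{1..n}. prob (\<epsilon> j -` b j \<inter> space M))
          = (\<Prod>j\<in>{1..n}. prob ((\<lambda>\<omega>. (X j \<omega>, \<epsilon> j \<omega>)) -` A j \<inter> space M))"
        unfolding prod.distrib[symmetric]
        by (intro prod.cong refl) (simp only: ab indep_varD[OF X_\<epsilon>_pair_indep ab(2) ab(3)])
      finally show "prob (\<Inter>j\<in>{1..n}. (\<lambda>\<omega>. (X j \<omega>, \<epsilon> j \<omega>)) -` A j \<inter> space M)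
          = (\<Prod>j\<in>{1..n}. prob ((\<lambda>\<omega>. (X j \<omega>, \<epsilon> j \<omega>)) -` A j \<inter> space M))" .
    qed
  qed
qed

lemma pair_law:
  assumes i: "i \<in> {1..n}"
  shows "distr M (borel \<Otimes>\<^sub>M borel) (\<lambda>\<omega>. (X i \<omega>, \<epsilon> i \<omega>)) = density lborel (\<lambda>x. ennreal (f x)) \<Otimes>\<^sub>M \<nu>"
proof -
  have "distr M borel (X i) = density lborel (\<lambda>x. ennreal (f x))"
    using distributed_distr_eq_density[OF X_density[OF i]] by (simp cong: distr_cong)
  then show ?thesis
    using X_\<epsilon>_pair_indep[OF i] \<epsilon>_law[OF i] by (simp add: indep_var_distribution_eq)
qed

lemma sample_law_eq:
  assumes b[measurable]: "b \<in> borel_measurable borel" and i: "i \<in> {1..n}"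
  shows "sample_law f b \<nu> = distr M (borel \<Otimes>\<^sub>M borel) (\<lambda>\<omega>. (X i \<omega>, Y i \<omega>))"
proof -
  note [measurable] = X_measurable[OF i] \<epsilon>_measurable[OF i]
  have "sample_law f b \<nu> = distr M (borel \<Otimes>\<^sub>M borel) ((\<lambda>(x, e). (x, b x + e)) \<circ> (\<lambda>\<omega>. (X i \<omega>, \<epsilon> i \<omega>)))"
    unfolding sample_law_def pair_law[OF i, symmetric] by (rule distr_distr) measurable
  also have "\<dots> = distr M (borel \<Otimes>\<^sub>M borel) (\<lambda>\<omega>. (X i \<omega>, Y i \<omega>))"
    using Y_eq[OF i] by (intro distr_cong) auto
  finally show ?thesis .
qed

text \<open>
  All samples with the same \<open>f\<close>, \<open>b\<close> and \<open>\<nu>\<close> have the same joint law, on whatever probability space they live. This is what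
  makes the constants independent of the sample.
\<close>

lemma sample_joint_law:
  assumes b[measurable]: "b \<in> borel_measurable borel" and n: "0 < n"
  shows "(\<lambda>\<omega>. \<lambda>i\<in>{1..n}. (X i \<omega>, Y i \<omega>)) \<in> measurable M (PiM {1..n} (\<lambda>_. sample_law f b \<nu>))"
    and "distr M (PiM {1..n} (\<lambda>_. sample_law f b \<nu>)) (\<lambda>\<omega>. \<lambda>i\<in>{1..n}. (X i \<omega>, Y i \<omega>))
      = PiM {1..n} (\<lambda>_. sample_law f b \<nu>)"
proof -
  let ?B = "borel \<Otimes>\<^sub>M borel :: (real \<times> real) measure"
  let ?Z = "\<lambda>i \<omega>. (X i \<omega>, b (X i \<omega>) + \<epsilon> i \<omega>)"
  have meas: "?Z i \<in> measurable M ?B" if "i \<in> {1..n}" for i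
    using X_measurable[OF that] \<epsilon>_measurable[OF that] by measurable
  have indep: "indep_vars (\<lambda>_. ?B) ?Z {1..n}"
    using indep_vars_compose2[OF pairs_indep, of "\<lambda>_ (x, e). (x, b x + e)" "\<lambda>_. ?B"] by simp
  have eq: "(\<lambda>i\<in>{1..n}. (X i \<omega>, Y i \<omega>)) = (\<lambda>i\<in>{1..n}. ?Z i \<omega>)" if "\<omega> \<in> space M" for \<omega>
    using Y_eq[OF _ that] by (auto simp: restrict_def)
  have Q: "distr M ?B (?Z i) = sample_law f b \<nu>" if i: "i \<in> {1..n}" for i
    unfolding sample_law_eq[OF b i] using Y_eq[OF i] by (intro distr_cong) auto
  have sets: "sets (PiM {1..n} (\<lambda>_. sample_law f b \<nu>)) = sets (PiM {1..n} (\<lambda>_. ?B))"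
    by (intro sets_PiM_cong) (auto simp: sample_law_def)
  have "(\<lambda>\<omega>. \<lambda>i\<in>{1..n}. ?Z i \<omega>) \<in> measurable M (PiM {1..n} (\<lambda>_. ?B))"
    by (intro measurable_restrict meas)
  then have "(\<lambda>\<omega>. \<lambda>i\<in>{1..n}. ?Z i \<omega>) \<in> measurable M (PiM {1..n} (\<lambda>_. sample_law f b \<nu>))"
    by (simp only: measurable_cong_sets[OF refl sets])
  then show "(\<lambda>\<omega>. \<lambda>i\<in>{1..n}. (X i \<omega>, Y i \<omega>)) \<in> measurable M (PiM {1..n} (\<lambda>_. sample_law f b \<nu>))"
    using eq by (simp cong: measurable_cong)
  have "distr M (PiM {1..n} (\<lambda>_. sample_law f b \<nu>)) (\<lambda>\<omega>. \<lambda>i\<in>{1..n}. (X i \<omega>, Y i \<omega>))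
      = distr M (PiM {1..n} (\<lambda>_. ?B)) (\<lambda>\<omega>. \<lambda>i\<in>{1..n}. ?Z i \<omega>)"
    using eq sets by (intro distr_cong) auto
  also have "\<dots> = PiM {1..n} (\<lambda>i. distr M ?B (?Z i))"
    using indep_vars_iff_distr_eq_PiM'[where I = "{1..n}" and M' = "\<lambda>_. ?B" and X = ?Z] meas indep n by simp
  also have "\<dots> = PiM {1..n} (\<lambda>_. sample_law f b \<nu>)"
    using Q by (intro PiM_cong) auto
  finally show "distr M (PiM {1..n} (\<lambda>_. sample_law f b \<nu>)) (\<lambda>\<omega>. \<lambda>i\<in>{1..n}. (X i \<omega>, Y i \<omega>))
      = PiM {1..n} (\<lambda>_. sample_law f b \<nu>)" .
qed

text \<open>
  \<open>D\<close> is a bound for \<open>\<bar>b\<bar> f + E \<bar>\<epsilon>\<bar> f\<close>. If \<open>Y\<close> vanished almost surely then \<open>\<epsilon> = - b(X)\<close> would be independent of itself,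
  so \<open>E \<epsilon>\<^sup>2 = - E \<epsilon> E b(X) = 0\<close>, against \<open>\<sigma>\<^sup>2 > 0\<close>.
\<close>

lemma regression_law_of_sample:
  assumes K: "bounded_integrable K" "\<And>y. K (- y) = K y" "(\<integral>x. K x \<partial>lborel) = 1"
    and f: "f \<in> borel_measurable borel" "\<And>x. 0 \<le> f x" "bounded (range f)"
    and b[measurable]: "b \<in> borel_measurable borel" and bf: "bounded (range (\<lambda>x. b x * f x))"
    and sig: "\<sigma>\<^sup>2 > 0" and al: "\<alpha> > 0"
    and i: "i \<in> {1..n}" and exp: "integrable M (\<lambda>\<omega>. exp (\<alpha> * \<bar>Y i \<omega>\<bar>))"
  shows "\<exists>D. regression_law (sample_law f b \<nu>) K (\<lambda>x. b x * f x) \<alpha> D"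
proof -
  let ?Q = "sample_law f b \<nu>"
  note [measurable] = X_measurable[OF i] \<epsilon>_measurable[OF i] f(1)
  have Ymeas [measurable]: "Y i \<in> borel_measurable M"
  proof -
    have "(\<lambda>\<omega>. b (X i \<omega>) + \<epsilon> i \<omega>) \<in> borel_measurable M" by measurable
    then show ?thesis using Y_eq[OF i] by (simp cong: measurable_cong)
  qed
  have Q: "?Q = distr M (borel \<Otimes>\<^sub>M borel) (\<lambda>\<omega>. (X i \<omega>, Y i \<omega>))" by (rule sample_law_eq[OF b i])
  note dens = X_density[OF i]
  note eint = \<epsilon>_integrable[OF i]
  have Yint: "integrable M (Y i)"
  proof (rule Bochner_Integration.integrable_bound)
    show "integrable M (\<lambda>\<omega>. (1 / \<alpha>) * exp (\<alpha> * \<bar>Y i \<omega>\<bar>))" using exp by (rule integrable_mult_right)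
    show "AE \<omega> in M. norm (Y i \<omega>) \<le> norm ((1 / \<alpha>) * exp (\<alpha> * \<bar>Y i \<omega>\<bar>))"
    proof (rule AE_I2)
      fix \<omega>
      have "\<alpha> * \<bar>Y i \<omega>\<bar> \<le> exp (\<alpha> * \<bar>Y i \<omega>\<bar>)" using exp_ge_add_one_self[of "\<alpha> * \<bar>Y i \<omega>\<bar>"] by linarith
      then show "norm (Y i \<omega>) \<le> norm ((1 / \<alpha>) * exp (\<alpha> * \<bar>Y i \<omega>\<bar>))"
        using al by (simp add: field_simps)
    qed
  qed measurable
  have bint: "integrable M (\<lambda>\<omega>. b (X i \<omega>))"
  proof -
    have "integrable M (\<lambda>\<omega>. Y i \<omega> - \<epsilon> i \<omega>)" using Yint eint by simp
    then show ?thesis using Y_eq[OF i] by (simp cong: Bochner_Integration.integrable_cong)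
  qed
  have s_int: "integrable lborel (\<lambda>x. b x * f x)"
    using distributed_integrable[OF dens, of b] f(2) bint by (simp add: mult.commute)
  obtain Sb where Sb: "0 \<le> Sb" "\<And>x. \<bar>b x * f x\<bar> \<le> Sb"
  proof -
    obtain c where "\<And>x. \<bar>b x * f x\<bar> \<le> c" using bf by (auto simp: bounded_iff)
    then show thesis using that[of c] by (meson abs_ge_zero order_trans)
  qed
  obtain F where F: "0 \<le> F" "\<And>x. f x \<le> F"
  proof -
    obtain c where "\<And>x. \<bar>f x\<bar> \<le> c" using f(3) by (auto simp: bounded_iff)
    then show thesis using that[of c] f(2) by (metis abs_of_nonneg order_trans)
  qed
  define m where "m = expectation (\<lambda>\<omega>. \<bar>\<epsilon> i \<omega>\<bar>)"
  have m0: "0 \<le> m" by (simp add: m_def)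
  have e0: "expectation (\<epsilon> i) = 0" by (rule \<epsilon>_centered[OF i])
  interpret Q: prob_space ?Q unfolding Q by (rule prob_space_distr) measurable
  have "regression_law ?Q K (\<lambda>x. b x * f x) \<alpha> (Sb + m * F)"
  proof
    show "sets ?Q = sets (borel \<Otimes>\<^sub>M borel)" by (simp add: sample_law_def)
    show "bounded_integrable K" "K (- x) = K x" "(\<integral>x. K x \<partial>lborel) = 1" "0 < \<alpha>" for x
      using K al by auto
    show "bounded_integrable (\<lambda>x. b x * f x)" using s_int bf by (simp add: bounded_integrable_def)
    show "0 \<le> Sb + m * F" using Sb(1) m0 F(1) by simp
    show "integrable ?Q (\<lambda>z. exp (\<alpha> * \<bar>snd z\<bar>))"
    proof -
      have XY: "(\<lambda>\<omega>. (X i \<omega>, Y i \<omega>)) \<in> measurable M (borel \<Otimes>\<^sub>M borel)" by measurable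
      have "(\<lambda>z. exp (\<alpha> * \<bar>snd z\<bar>)) \<in> borel_measurable (borel \<Otimes>\<^sub>M borel :: (real \<times> real) measure)"
        by measurable
      from integrable_distr_eq[OF XY this] show ?thesis unfolding Q using exp by simp
    qed
    show "(\<integral>z. snd z * g (fst z) \<partial>?Q) = (\<integral>t. b t * f t * g t \<partial>lborel)"
      if g[measurable]: "g \<in> borel_measurable borel" and gb: "bounded (range g)" for g
    proof -
      obtain c where c: "\<And>x. \<bar>g x\<bar> \<le> c" using gb by (auto simp: bounded_iff)
      have gint: "integrable M (\<lambda>\<omega>. g (X i \<omega>))"
        by (rule integrable_const_bound[of _ c]) (use c in auto)
      have ind: "indep_var borel (\<lambda>\<omega>. g (X i \<omega>)) borel (\<epsilon> i)"
        using indep_var_compose[OF X_\<epsilon>_pair_indep[OF i] g, of "\<lambda>x. x" borel] by (simp add: comp_def)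
      have bg: "integrable M (\<lambda>\<omega>. b (X i \<omega>) * g (X i \<omega>))"
      proof (rule Bochner_Integration.integrable_bound)
        show "integrable M (\<lambda>\<omega>. c * b (X i \<omega>))" using bint by simp
        show "AE \<omega> in M. norm (b (X i \<omega>) * g (X i \<omega>)) \<le> norm (c * b (X i \<omega>))"
        proof (rule AE_I2)
          fix \<omega>
          have "\<bar>g (X i \<omega>)\<bar> \<le> \<bar>c\<bar>" using c[of "X i \<omega>"] by linarith
          then show "norm (b (X i \<omega>) * g (X i \<omega>)) \<le> norm (c * b (X i \<omega>))"
            using mult_right_mono[of "\<bar>g (X i \<omega>)\<bar>" "\<bar>c\<bar>" "\<bar>b (X i \<omega>)\<bar>"] by (simp add: abs_mult mult.commute)
        qed
      qed measurable
      have "(\<integral>z. snd z * g (fst z) \<partial>?Q) = expectation (\<lambda>\<omega>. Y i \<omega> * g (X i \<omega>))"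
        unfolding Q by (subst integral_distr) auto
      also have "\<dots> = expectation (\<lambda>\<omega>. b (X i \<omega>) * g (X i \<omega>) + \<epsilon> i \<omega> * g (X i \<omega>))"
        using Y_eq[OF i] by (intro Bochner_Integration.integral_cong) (auto simp: distrib_right)
      also have "\<dots> = expectation (\<lambda>\<omega>. b (X i \<omega>) * g (X i \<omega>)) + expectation (\<lambda>\<omega>. \<epsilon> i \<omega> * g (X i \<omega>))"
        using bg indep_var_integrable[OF ind gint eint] by (simp add: mult.commute)
      also have "expectation (\<lambda>\<omega>. \<epsilon> i \<omega> * g (X i \<omega>)) = 0"
        using indep_var_lebesgue_integral[OF ind gint eint] e0 by (simp add: mult.commute)
      also have "expectation (\<lambda>\<omega>. b (X i \<omega>) * g (X i \<omega>)) = (\<integral>t. f t * (b t * g t) \<partial>lborel)"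
        using distributed_integral[OF dens, of "\<lambda>t. b t * g t"] f(2) by simp
      finally show ?thesis by (simp add: mult_ac)
    qed
    show "(\<integral>\<^sup>+z. ennreal (\<bar>snd z\<bar> * g (fst z)) \<partial>?Q) \<le> ennreal (Sb + m * F) * (\<integral>\<^sup>+t. ennreal (g t) \<partial>lborel)"
      if g[measurable]: "g \<in> borel_measurable borel" and g0: "\<And>t. 0 \<le> g t" for g
    proof -
      let ?G = "\<integral>\<^sup>+t. ennreal (g t) \<partial>lborel"
      have "(\<integral>\<^sup>+z. ennreal (\<bar>snd z\<bar> * g (fst z)) \<partial>?Q) = (\<integral>\<^sup>+\<omega>. ennreal (\<bar>Y i \<omega>\<bar> * g (X i \<omega>)) \<partial>M)"
        unfolding Q by (subst nn_integral_distr) auto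
      also have "\<dots> \<le> (\<integral>\<^sup>+\<omega>. ennreal (\<bar>b (X i \<omega>)\<bar> * g (X i \<omega>)) + ennreal (\<bar>\<epsilon> i \<omega>\<bar> * g (X i \<omega>)) \<partial>M)"
      proof (rule nn_integral_mono)
        fix \<omega> assume "\<omega> \<in> space M"
        then have "\<bar>Y i \<omega>\<bar> * g (X i \<omega>) \<le> (\<bar>b (X i \<omega>)\<bar> + \<bar>\<epsilon> i \<omega>\<bar>) * g (X i \<omega>)"
          using Y_eq[OF i] g0 by (intro mult_right_mono) auto
        then show "ennreal (\<bar>Y i \<omega>\<bar> * g (X i \<omega>)) \<le> ennreal (\<bar>b (X i \<omega>)\<bar> * g (X i \<omega>)) + ennreal (\<bar>\<epsilon> i \<omega>\<bar> * g (X i \<omega>))"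
          using g0 by (simp add: ennreal_plus[symmetric] distrib_right ennreal_leI del: ennreal_plus)
      qed
      also have "\<dots> = (\<integral>\<^sup>+\<omega>. ennreal (\<bar>b (X i \<omega>)\<bar> * g (X i \<omega>)) \<partial>M) + (\<integral>\<^sup>+\<omega>. ennreal (\<bar>\<epsilon> i \<omega>\<bar> * g (X i \<omega>)) \<partial>M)"
        by (rule nn_integral_add) measurable
      also have "(\<integral>\<^sup>+\<omega>. ennreal (\<bar>b (X i \<omega>)\<bar> * g (X i \<omega>)) \<partial>M) \<le> ennreal Sb * ?G"
      proof -
        have "(\<integral>\<^sup>+\<omega>. ennreal (\<bar>b (X i \<omega>)\<bar> * g (X i \<omega>)) \<partial>M) = (\<integral>\<^sup>+t. ennreal (f t) * ennreal (\<bar>b t\<bar> * g t) \<partial>lborel)"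
          using distributed_nn_integral[OF dens, of "\<lambda>t. ennreal (\<bar>b t\<bar> * g t)"] by simp
        also have "\<dots> \<le> (\<integral>\<^sup>+t. ennreal Sb * ennreal (g t) \<partial>lborel)"
        proof (rule nn_integral_mono)
          fix t
          have "f t * (\<bar>b t\<bar> * g t) = \<bar>b t * f t\<bar> * g t" using f(2) by (simp add: abs_mult)
          also have "\<dots> \<le> Sb * g t" using Sb g0 by (intro mult_right_mono)
          finally show "ennreal (f t) * ennreal (\<bar>b t\<bar> * g t) \<le> ennreal Sb * ennreal (g t)"
            using f(2) Sb(1) by (simp add: ennreal_mult'[symmetric] ennreal_leI)
        qed
        also have "\<dots> = ennreal Sb * ?G" by (rule nn_integral_cmult) measurable
        finally show ?thesis .
      qed
      also have "(\<integral>\<^sup>+\<omega>. ennreal (\<bar>\<epsilon> i \<omega>\<bar> * g (X i \<omega>)) \<partial>M) \<le> ennreal (m * F) * ?G"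
      proof -
        interpret N: prob_space "distr M borel (\<epsilon> i)" by (rule prob_space_distr) measurable
        have pl: "distr M (borel \<Otimes>\<^sub>M borel) (\<lambda>\<omega>. (X i \<omega>, \<epsilon> i \<omega>)) = distr M borel (X i) \<Otimes>\<^sub>M distr M borel (\<epsilon> i)"
          using X_\<epsilon>_pair_indep[OF i] by (simp add: indep_var_distribution_eq)
        have "(\<integral>\<^sup>+\<omega>. ennreal (\<bar>\<epsilon> i \<omega>\<bar> * g (X i \<omega>)) \<partial>M)
            = (\<integral>\<^sup>+z. ennreal (\<bar>snd z\<bar> * g (fst z)) \<partial>(distr M borel (X i) \<Otimes>\<^sub>M distr M borel (\<epsilon> i)))"
          unfolding pl[symmetric] by (subst nn_integral_distr) auto
        also have "\<dots> = (\<integral>\<^sup>+x. \<integral>\<^sup>+e. ennreal \<bar>e\<bar> * ennreal (g x) \<partial>distr M borel (\<epsilon> i) \<partial>distr M borel (X i))"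
          by (subst N.nn_integral_fst[symmetric]) (auto simp: ennreal_mult g0)
        also have "\<dots> = (\<integral>\<^sup>+x. ennreal m * ennreal (g x) \<partial>distr M borel (X i))"
        proof -
          have "(\<integral>\<^sup>+e. ennreal \<bar>e\<bar> \<partial>distr M borel (\<epsilon> i)) = ennreal m"
            unfolding m_def using eint by (subst nn_integral_distr) (auto intro!: nn_integral_eq_integral)
          then show ?thesis by (simp add: nn_integral_multc)
        qed
        also have "\<dots> = (\<integral>\<^sup>+\<omega>. ennreal m * ennreal (g (X i \<omega>)) \<partial>M)"
          by (rule nn_integral_distr) measurable
        also have "\<dots> = ennreal m * (\<integral>\<^sup>+\<omega>. ennreal (g (X i \<omega>)) \<partial>M)"
          by (rule nn_integral_cmult) measurable
        also have "(\<integral>\<^sup>+\<omega>. ennreal (g (X i \<omega>)) \<partial>M) = (\<integral>\<^sup>+t. ennreal (f t) * ennreal (g t) \<partial>lborel)"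
          using distributed_nn_integral[OF dens, of "\<lambda>t. ennreal (g t)"] by simp
        also have "\<dots> \<le> (\<integral>\<^sup>+t. ennreal F * ennreal (g t) \<partial>lborel)"
          using F by (intro nn_integral_mono mult_right_mono ennreal_leI) auto
        also have "\<dots> = ennreal F * ?G" by (rule nn_integral_cmult) measurable
        finally show ?thesis using m0 F(1) by (simp add: ennreal_mult mult.assoc mult_left_mono)
      qed
      finally show ?thesis using Sb(1) m0 F(1) by (simp add: ennreal_plus distrib_right add_mono)
    qed
    show "\<not> (AE z in ?Q. snd z = 0)"
    proof
      assume "AE z in ?Q. snd z = 0"
      then have "AE \<omega> in M. Y i \<omega> = 0"
        unfolding Q by (subst (asm) AE_distr_iff) auto
      then have ae: "AE \<omega> in M. (\<epsilon> i \<omega>)\<^sup>2 = - (\<epsilon> i \<omega> * b (X i \<omega>))"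
      proof (rule AE_mp, intro AE_I2 impI)
        fix \<omega> assume "\<omega> \<in> space M" "Y i \<omega> = 0"
        then have "b (X i \<omega>) = - \<epsilon> i \<omega>" using Y_eq[OF i] by fastforce
        then show "(\<epsilon> i \<omega>)\<^sup>2 = - (\<epsilon> i \<omega> * b (X i \<omega>))" by (simp add: power2_eq_square)
      qed
      have ind: "indep_var borel (\<lambda>\<omega>. b (X i \<omega>)) borel (\<epsilon> i)"
        using indep_var_compose[OF X_\<epsilon>_pair_indep[OF i] b, of "\<lambda>x. x" borel] by (simp add: comp_def)
      have "expectation (\<lambda>\<omega>. (\<epsilon> i \<omega>)\<^sup>2) = expectation (\<lambda>\<omega>. - (\<epsilon> i \<omega> * b (X i \<omega>)))"
        using ae by (intro integral_cong_AE) auto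
      also have "\<dots> = - (expectation (\<epsilon> i) * expectation (\<lambda>\<omega>. b (X i \<omega>)))"
        using indep_var_lebesgue_integral[OF ind bint eint] by (simp add: mult.commute)
      finally have "expectation (\<lambda>\<omega>. (\<epsilon> i \<omega>)\<^sup>2) = 0" using e0 by simp
      then show False using \<epsilon>_variance[OF i] sig e0 by simp
    qed
  qed
  then show ?thesis by blast
qed

end

section \<open>The oracle inequality in expectation\<close>

theorem theorem4p2:
  fixes K f b :: "real \<Rightarrow> real"
    and \<nu> :: "real measure"
    and \<sigma> \<alpha> :: real
  assumes K_measurable: "K \<in> borel_measurable borel"
    and K_bounded: "bounded (range K)"
    and K_square_integrable: "integrable lborel (\<lambda>y. (K y)\<^sup>2)"
    and K_symmetric: "\<And>y. K (- y) = K y"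
    and K_integral: "has_bochner_integral lborel K 1"
    and K_0: "K 0 > 0"
    and f_measurable: "f \<in> borel_measurable borel"
    and f_nonneg: "\<And>x. 0 \<le> f x"
    and f_bounded: "bounded (range f)"
    and b_measurable: "b \<in> borel_measurable borel"
    and bf_bounded: "bounded (range (\<lambda>x. b x * f x))"
    and \<sigma>_pos: "\<sigma>\<^sup>2 > 0"
    and \<alpha>_pos: "\<alpha> > 0"
  shows "\<exists>\<aa>>0. \<exists>\<bb>>0.
    \<forall>(n::nat) (M::'a measure) X \<epsilon> Y H hsel \<theta>.
      regression_sample M n f b \<nu> \<sigma> X \<epsilon> Y \<longrightarrow>
      integrable M (\<lambda>\<omega>. exp (\<alpha> * \<bar>Y 1 \<omega>\<bar>)) \<longrightarrow>
      bandwidths n H \<longrightarrow>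
      1 / (real n * Min H) \<le> 1 \<longrightarrow>
      pco_selection M K n H X Y hsel \<longrightarrow>
      \<theta> \<in> {0<..<1} \<longrightarrow>
      (\<integral>\<omega>. (L2_norm (\<lambda>x. bf_estimator K n X Y (hsel \<omega>) \<omega> x - b x * f x))\<^sup>2 \<partial>M)
      \<le> (1 + \<theta>) * (INF h\<in>H.
            \<integral>\<omega>. (L2_norm (\<lambda>x. bf_estimator K n X Y h \<omega> x - b x * f x))\<^sup>2 \<partial>M)
        + \<aa> / \<theta> * (L2_norm (\<lambda>x. conv (scaled_kernel K (Min H)) (\<lambda>y. b y * f y) x - b x * f x))\<^sup>2
        + \<bb> / \<theta> * (ln (real n) ^ 5 / real n)"
proof (cases "\<exists>(n::nat) (M::'a measure) X \<epsilon> Y. regression_sample M n f b \<nu> \<sigma> X \<epsilon> Y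
    \<and> integrable M (\<lambda>\<omega>. exp (\<alpha> * \<bar>Y 1 \<omega>\<bar>)) \<and> 0 < n")
  case False
  \<comment> \<open>if there is no sample at all, then any constants do\<close>
  have no_sample: "False"
    if "regression_sample M n f b \<nu> \<sigma> X \<epsilon> Y" "integrable M (\<lambda>\<omega>. exp (\<alpha> * \<bar>Y 1 \<omega>\<bar>))" "bandwidths n H"
    for n :: nat and M :: "'a measure" and X \<epsilon> Y H
  proof -
    have "0 < n" using bandwidthsD(5)[OF that(3)] by simp
    then show False using False that(1,2) by blast
  qed
  show ?thesis
    by (rule exI[of _ 1], rule conjI[OF zero_less_one], rule exI[of _ 1], rule conjI[OF zero_less_one],
        intro allI impI, rule FalseE, rule no_sample)
next
  case True
  then obtain n\<^sub>0 M\<^sub>0 X\<^sub>0 \<epsilon>\<^sub>0 Y\<^sub>0 where sample: "regression_sample (M\<^sub>0 :: 'a measure) n\<^sub>0 f b \<nu> \<sigma> X\<^sub>0 \<epsilon>\<^sub>0 Y\<^sub>0"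
    and exp0: "integrable M\<^sub>0 (\<lambda>\<omega>. exp (\<alpha> * \<bar>Y\<^sub>0 1 \<omega>\<bar>))" and n0: "0 < n\<^sub>0"
    by blast
  have K_bi: "bounded_integrable K" "(\<integral>x. K x \<partial>lborel) = 1"
    using K_integral K_bounded by (auto simp: bounded_integrable_def has_bochner_integral_iff)
  have one: "1 \<in> {1..n\<^sub>0}" using n0 by simp
  obtain D where "regression_law (sample_law f b \<nu>) K (\<lambda>x. b x * f x) \<alpha> D"
    using regression_sample.regression_law_of_sample[OF sample K_bi(1) K_symmetric K_bi(2) f_measurable f_nonneg
        f_bounded b_measurable bf_bounded \<sigma>_pos \<alpha>_pos one exp0] by blast
  then interpret R: regression_law "sample_law f b \<nu>" K "\<lambda>x. b x * f x" \<alpha> D .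
  obtain A C where A: "0 < A" and C: "0 < C" and pathwise: "\<And>n H. bandwidths n H \<Longrightarrow>
      \<exists>\<Xi>. R.remainder n (C * (ln (real n) ^ 5 / real n)) \<Xi> \<and> R.oracle_bound n H A \<Xi>"
    using R.pathwise_oracle_inequality by blast
  have key: "(\<integral>\<omega>. (L2_norm (\<lambda>x. bf_estimator K n X Y (hsel \<omega>) \<omega> x - b x * f x))\<^sup>2 \<partial>M)
      \<le> (1 + \<theta>) * (INF h\<in>H.
            \<integral>\<omega>. (L2_norm (\<lambda>x. bf_estimator K n X Y h \<omega> x - b x * f x))\<^sup>2 \<partial>M)
        + A / \<theta> * (L2_norm (\<lambda>x. conv (scaled_kernel K (Min H)) (\<lambda>y. b y * f y) x - b x * f x))\<^sup>2
        + C / \<theta> * (ln (real n) ^ 5 / real n)"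
    if S: "regression_sample M n f b \<nu> \<sigma> X \<epsilon> Y" and bw: "bandwidths n H"
      and sel: "pco_selection M K n H X Y hsel" and th: "\<theta> \<in> {0<..<1}"
    for n :: nat and M :: "'a measure" and X \<epsilon> Y H hsel \<theta>
  proof -
    interpret S: regression_sample M n f b \<nu> \<sigma> X \<epsilon> Y by (rule S)
    note H = bandwidthsD[OF bw]
    let ?P = "PiM {1..n} (\<lambda>_. sample_law f b \<nu>)"
    let ?Z = "\<lambda>\<omega>. \<lambda>i\<in>{1..n}. (X i \<omega>, Y i \<omega>)"
    have n0: "0 < n" using H(5) by simp
    note Zm = S.sample_joint_law(1)[OF b_measurable n0] and Zd = S.sample_joint_law(2)[OF b_measurable n0]
    from pathwise[OF bw] obtain \<Xi> where Xi: "integrable ?P \<Xi>" "\<forall>z. 0 \<le> \<Xi> z"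
        "(\<integral>z. \<Xi> z \<partial>?P) \<le> C * (ln (real n) ^ 5 / real n)"
      and path: "\<And>z g h m. m \<in> H \<Longrightarrow> h \<in> H \<Longrightarrow> g \<in> H \<Longrightarrow> R.criterion n m g z \<le> R.criterion n m h z \<Longrightarrow>
          R.loss n g z \<le> (1 + \<theta>) * R.loss n h z + A / \<theta> * R.bias_sq m + \<Xi> z / \<theta>"
      using th unfolding R.remainder_def R.oracle_bound_def by blast
    have m: "Min H \<in> H" using H by simp
    have bias2: "R.bias_sq (Min H) = (L2_norm (\<lambda>x. conv (scaled_kernel K (Min H)) (\<lambda>y. b y * f y) x - b x * f x))\<^sup>2"
      by (simp add: R.bias_sq_def R.bias_def[abs_def] R.smooth_def)
    have Zi: "?Z \<omega> i = (X i \<omega>, Y i \<omega>)" if "i \<in> {1..n}" for \<omega> i using that by simp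
    have loss: "(L2_norm (\<lambda>x. bf_estimator K n X Y h \<omega> x - b x * f x))\<^sup>2 = R.loss n h (?Z \<omega>)" for h \<omega>
      unfolding R.loss_def using R.bf_estimator_eq[where z = "?Z \<omega>" and n = n and X = X and Y = Y and \<omega> = \<omega> and h = h, OF Zi] by simp
    have crit: "crit K n H X Y \<omega> h = R.criterion n (Min H) h (?Z \<omega>)" for h \<omega>
      by (rule R.crit_eq[where z = "?Z \<omega>" and n = n and X = X and Y = Y and \<omega> = \<omega>, OF Zi])
    have lint: "integrable M (\<lambda>\<omega>. R.loss n h (?Z \<omega>))" if h: "h \<in> H" for h
    proof -
      have h': "0 < h" "h \<le> 1" using H(4) h n0 less_trans[of 0 "1 / real n" h] by auto
      have li: "integrable ?P (R.loss n h)" by (rule R.loss_integrable[OF H(5) h'])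
      then show ?thesis
        using integrable_distr_eq[OF Zm borel_measurable_integrable[OF li]] Zd by simp
    qed
    have Xint: "integrable M (\<lambda>\<omega>. \<Xi> (?Z \<omega>))" "(\<integral>\<omega>. \<Xi> (?Z \<omega>) \<partial>M) = (\<integral>z. \<Xi> z \<partial>?P)"
      using integrable_distr_eq[OF Zm borel_measurable_integrable[OF Xi(1)]]
        integral_distr[OF Zm borel_measurable_integrable[OF Xi(1)]] Xi(1) Zd by simp_all
    have bound: "(\<integral>\<omega>. R.loss n (hsel \<omega>) (?Z \<omega>) \<partial>M)
        \<le> (1 + \<theta>) * (\<integral>\<omega>. R.loss n h (?Z \<omega>) \<partial>M) + A / \<theta> * R.bias_sq (Min H) + C / \<theta> * (ln (real n) ^ 5 / real n)"
      if h: "h \<in> H" for h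
    proof -
      let ?g = "\<lambda>\<omega>. (1 + \<theta>) * R.loss n h (?Z \<omega>) + A / \<theta> * R.bias_sq (Min H) + \<Xi> (?Z \<omega>) / \<theta>"
      have gi: "integrable M ?g"
        by (intro Bochner_Integration.integrable_add integrable_mult_right integrable_divide lint[OF h]
            Xint(1) S.integrable_const)
      have "(\<integral>\<omega>. R.loss n (hsel \<omega>) (?Z \<omega>) \<partial>M) \<le> (\<integral>\<omega>. ?g \<omega> \<partial>M)"
      proof (rule integral_mono'[OF gi])
        fix \<omega> assume w: "\<omega> \<in> space M"
        have "is_arg_min (crit K n H X Y \<omega>) (\<lambda>h. h \<in> H) (hsel \<omega>)"
          using sel w by (simp add: pco_selection_def)
        then have "hsel \<omega> \<in> H" "crit K n H X Y \<omega> (hsel \<omega>) \<le> crit K n H X Y \<omega> h"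
          using h by (auto simp: is_arg_min_def not_less)
        then show "R.loss n (hsel \<omega>) (?Z \<omega>) \<le> ?g \<omega>"
          using path[OF m h] unfolding crit by blast
        show "0 \<le> ?g \<omega>"
          using th A Xi(2) by (intro add_nonneg_nonneg mult_nonneg_nonneg divide_nonneg_nonneg)
            (auto simp: R.loss_def R.bias_sq_def)
      qed
      also have "\<dots> = (1 + \<theta>) * (\<integral>\<omega>. R.loss n h (?Z \<omega>) \<partial>M) + A / \<theta> * R.bias_sq (Min H) + (\<integral>z. \<Xi> z \<partial>?P) / \<theta>"
        unfolding Xint(2)[symmetric] using lint[OF h] Xint(1) by (simp add: S.prob_space del: One_nat_def)
      also have "(\<integral>z. \<Xi> z \<partial>?P) / \<theta> \<le> C * (ln (real n) ^ 5 / real n) / \<theta>"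
        using Xi(3) th by (intro divide_right_mono) auto
      also have "C * (ln (real n) ^ 5 / real n) / \<theta> = C / \<theta> * (ln (real n) ^ 5 / real n)" by simp
      finally show ?thesis by (simp only:)
    qed
    let ?L = "\<integral>\<omega>. R.loss n (hsel \<omega>) (?Z \<omega>) \<partial>M"
    let ?rest = "A / \<theta> * R.bias_sq (Min H) + C / \<theta> * (ln (real n) ^ 5 / real n)"
    have "(?L - ?rest) / (1 + \<theta>) \<le> (INF h\<in>H. \<integral>\<omega>. R.loss n h (?Z \<omega>) \<partial>M)"
    proof (rule cINF_greatest[OF H(3)])
      fix h assume "h \<in> H"
      from bound[OF this] show "(?L - ?rest) / (1 + \<theta>) \<le> (\<integral>\<omega>. R.loss n h (?Z \<omega>) \<partial>M)"
        using th by (simp add: pos_divide_le_eq algebra_simps)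
    qed
    then have "?L - ?rest \<le> (1 + \<theta>) * (INF h\<in>H. \<integral>\<omega>. R.loss n h (?Z \<omega>) \<partial>M)"
      using th by (simp add: pos_divide_le_eq mult.commute)
    then show ?thesis unfolding loss bias2[symmetric] by linarith
  qed
  show ?thesis
    by (rule exI[of _ A], rule conjI[OF A], rule exI[of _ C], rule conjI[OF C], intro allI impI, rule key)
qed

end
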